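(* Let $\mathcal A$ be an abelian length category and let $(\mathbf t,\mathbf f)$ and $(\mathbf u,\mathbf v)$ be torsion pairs in $\mathcal A$ with $\mathbf t\subsetneq\mathbf u$ forming a wide interval, and let $\mathcal W=\mathbf u\cap\mathbf f$. Assume that $(\mathbf t,\mathbf f)$ is widely generated and $(\mathbf u,\mathbf v)$ is widely cogenerated. Then there is a bijection $$\Phi:\operatorname{Up}(\mathbf u)\coprod\operatorname{Low}(\mathbf u)\to\operatorname{Up}(\mathbf t)\coprod\operatorname{Low}(\mathbf t)$$ defined as follows: (1) for $[V]\in\operatorname{Up}(\mathbf u)$, take a $\mathcal W$-envelope $e_V:V\to W_V$. It is either a monomorphism or an epimorphism; if it is a monomorphism, $\Phi([V]):=[\operatorname{coker}e_V]$; if it is an epimorphism, $\Phi([V]):=[\ker e_V]$. (2) for $[U]\in\operatorname{Low}(\mathbf u)$, if $U\in\mathcal W$ then $\Phi([U]):=[U]$; otherwise $\Phi([U]):=[T]$, where $T$ is the unique (up to isomorphism) torsion, almost torsionfree object for $(\mathbf t,\mathbf f)$ with $\operatorname{Hom}(T,U)\neq 0$.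
   Context: An abelian length category is an essentially small abelian category in which every object has a finite composition series. All subcategories are full and closed under isomorphism. A torsion pair in $\mathcal A$ is a pair $(\mathbf t,\mathbf f)$ of subcategories such that $\operatorname{Hom}(T,F)=0$ for all $T\in\mathbf t$, $F\in\mathbf f$, and every object $M$ admits a short exact sequence $0\to T\to M\to F\to 0$ with $T\in\mathbf t$, $F\in\mathbf f$; $\mathbf t$ is the torsion class and $\mathbf f$ the torsionfree class. A subcategory is wide if it is closed under kernels, cokernels and extensions. Two torsion pairs $(\mathbf t,\mathbf f)$, $(\mathbf u,\mathbf v)$ with $\mathbf t\subsetneq\mathbf u$ form a wide interval if $\mathbf u\cap\mathbf f$ is a wide subcategory. A torsion pair $(\mathbf t,\mathbf f)$ is widely generated if $\mathbf t$ is the smallest torsion class containing some wide subcategory, and widely cogenerated if $\mathbf f$ is the smallest torsionfree class containing some wide subcategory. A non-zero object $F\in\mathbf f$ is $\mathbf f$-simple if all its proper quotients are in $\mathbf t$; a non-zero object $T\in\mathbf t$ is $\mathbf t$-simple if all its proper subobjects are in $\mathbf f$. An object $B$ is torsionfree, almost torsion for $(\mathbf t,\mathbf f)$ if it is $\mathbf f$-simple and for every $F\in\mathbf f$ and every map $B\to F$ the cokernel is in $\mathbf f$. Dually, $B$ is torsion, almost torsionfree for $(\mathbf t,\mathbf f)$ if it is $\mathbf t$-simple and for every $T\in\mathbf t$ and every map $T\to B$ the kernel is in $\mathbf t$. $\operatorname{Up}(\mathbf t)$ is the set of isomorphism classes of torsionfree, almost torsion objects for $(\mathbf t,\mathbf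 f)$, and $\operatorname{Low}(\mathbf t)$ is the set of isomorphism classes of torsion, almost torsionfree objects for $(\mathbf t,\mathbf f)$; similarly for $(\mathbf u,\mathbf v)$. (These two sets are disjoint, since no non-zero object lies both in $\mathbf t$ and in $\mathbf f$, so an isomorphism class determines the component of the disjoint union to which it belongs.) For a full subcategory $\mathcal C$, a morphism $e:X\to C$ with $C\in\mathcal C$ is a $\mathcal C$-envelope if every morphism $X\to C'$ with $C'\in\mathcal C$ factors through $e$, and every endomorphism $h$ of $C$ with $he=e$ is an automorphism. *)

theory Defs
  imports "HOL-Algebra.Group"
begin

text \<open>
  A category is given by a set of objects and a set of arrows, each arrow carrying its source and
  target, so distinct hom-sets are disjoint. As the objects and the arrows form sets, such a
  category is small; an essentially small category is treated through a small category equivalent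
  to it. \<open>Add\<close> and \<open>Zero\<close> carry the additive structure of the hom-sets. The operations are
  only constrained on objects of \<open>Obj\<close> and on composable, respectively parallel, arrows of
  \<open>Arr\<close>.
\<close>

record ('o, 'm) precategory =
  Obj   :: "'o set"
  Arr   :: "'m set"
  Src   :: "'m \<Rightarrow> 'o"
  Tgt   :: "'m \<Rightarrow> 'o"
  Ident :: "'o \<Rightarrow> 'm"
  Comp  :: "'m \<Rightarrow> 'm \<Rightarrow> 'm"    (infixr \<open>\<cdot>\<index>\<close> 70)

record ('o, 'm) preadditive = "('o, 'm) precategory" +
  Add   :: "'m \<Rightarrow> 'm \<Rightarrow> 'm"
  Zero  :: "'o \<Rightarrow> 'o \<Rightarrow> 'm"

definition Hom :: "('o, 'm, 'x) precategory_scheme \<Rightarrow> 'o \<Rightarrow> 'o \<Rightarrow> 'm set" where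
  "Hom C X Y = {f \<in> Arr C. Src C f = X \<and> Tgt C f = Y}"

text \<open>\<open>g \<cdot> f\<close> is \<open>g\<close> after \<open>f\<close>.\<close>

locale category =
  fixes C :: "('o, 'm, 'x) precategory_scheme" (structure)
  assumes src_closed: "f \<in> Arr C \<Longrightarrow> Src C f \<in> Obj C"
    and tgt_closed: "f \<in> Arr C \<Longrightarrow> Tgt C f \<in> Obj C"
    and ident_closed: "X \<in> Obj C \<Longrightarrow> Ident C X \<in> Hom C X X"
    and comp_closed: "f \<in> Hom C X Y \<Longrightarrow> g \<in> Hom C Y Z \<Longrightarrow> g \<cdot> f \<in> Hom C X Z"
    and comp_ident_right: "f \<in> Hom C X Y \<Longrightarrow> f \<cdot> Ident C X = f"
    and comp_ident_left: "f \<in> Hom C X Y \<Longrightarrow> Ident C Y \<cdot> f = f"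
    and comp_assoc:
      "f \<in> Hom C X Y \<Longrightarrow> g \<in> Hom C Y Z \<Longrightarrow> h \<in> Hom C Z U \<Longrightarrow> (h \<cdot> g) \<cdot> f = h \<cdot> (g \<cdot> f)"

definition monic :: "('o, 'm, 'x) precategory_scheme \<Rightarrow> 'm \<Rightarrow> bool" where
  "monic C f \<longleftrightarrow> f \<in> Arr C \<and>
     (\<forall>Z \<in> Obj C. \<forall>g \<in> Hom C Z (Src C f). \<forall>h \<in> Hom C Z (Src C f).
        f \<cdot>\<^bsub>C\<^esub> g = f \<cdot>\<^bsub>C\<^esub> h \<longrightarrow> g = h)"

definition epic :: "('o, 'm, 'x) precategory_scheme \<Rightarrow> 'm \<Rightarrow> bool" where
  "epic C f \<longleftrightarrow> f \<in> Arr C \<and>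
     (\<forall>Z \<in> Obj C. \<forall>g \<in> Hom C (Tgt C f) Z. \<forall>h \<in> Hom C (Tgt C f) Z.
        g \<cdot>\<^bsub>C\<^esub> f = h \<cdot>\<^bsub>C\<^esub> f \<longrightarrow> g = h)"

definition isomorphism :: "('o, 'm, 'x) precategory_scheme \<Rightarrow> 'm \<Rightarrow> bool" where
  "isomorphism C f \<longleftrightarrow> f \<in> Arr C \<and>
     (\<exists>g \<in> Hom C (Tgt C f) (Src C f).
        g \<cdot>\<^bsub>C\<^esub> f = Ident C (Src C f) \<and> f \<cdot>\<^bsub>C\<^esub> g = Ident C (Tgt C f))"

definition isomorphic :: "('o, 'm, 'x) precategory_scheme \<Rightarrow> 'o \<Rightarrow> 'o \<Rightarrow> bool" where
  "isomorphic C X Y \<longleftrightarrow> (\<exists>f \<in> Hom C X Y. isomorphism C f)"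

definition iso_class :: "('o, 'm, 'x) precategory_scheme \<Rightarrow> 'o \<Rightarrow> 'o set" where
  "iso_class C X = {Y \<in> Obj C. isomorphic C X Y}"

definition zero_object :: "('o, 'm, 'x) precategory_scheme \<Rightarrow> 'o \<Rightarrow> bool" where
  "zero_object C Z \<longleftrightarrow> Z \<in> Obj C \<and>
     (\<forall>X \<in> Obj C. (\<exists>!f. f \<in> Hom C Z X) \<and> (\<exists>!f. f \<in> Hom C X Z))"

locale preadditive_category = category C
  for C :: "('o, 'm, 'x) preadditive_scheme" (structure) +
  assumes hom_comm_group: "X \<in> Obj C \<Longrightarrow> Y \<in> Obj C \<Longrightarrow>
      comm_group \<lparr>carrier = Hom C X Y, mult = Add C, one = Zero C X Y\<rparr>"
    and comp_add_right: "f \<in> Hom C X Y \<Longrightarrow> f' \<in> Hom C X Y \<Longrightarrow> g \<in> Hom C Y Z \<Longrightarrow>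
      g \<cdot> Add C f f' = Add C (g \<cdot> f) (g \<cdot> f')"
    and comp_add_left: "f \<in> Hom C X Y \<Longrightarrow> g \<in> Hom C Y Z \<Longrightarrow> g' \<in> Hom C Y Z \<Longrightarrow>
      Add C g g' \<cdot> f = Add C (g \<cdot> f) (g' \<cdot> f)"

definition is_kernel :: "('o, 'm, 'x) preadditive_scheme \<Rightarrow> 'm \<Rightarrow> 'm \<Rightarrow> bool" where
  "is_kernel C f k \<longleftrightarrow> f \<in> Arr C \<and> k \<in> Arr C \<and> Tgt C k = Src C f \<and>
     f \<cdot>\<^bsub>C\<^esub> k = Zero C (Src C k) (Tgt C f) \<and>
     (\<forall>Z \<in> Obj C. \<forall>g \<in> Hom C Z (Src C f). f \<cdot>\<^bsub>C\<^esub> g = Zero C Z (Tgt C f) \<longrightarrow>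
        (\<exists>!h. h \<in> Hom C Z (Src C k) \<and> k \<cdot>\<^bsub>C\<^esub> h = g))"

definition is_cokernel :: "('o, 'm, 'x) preadditive_scheme \<Rightarrow> 'm \<Rightarrow> 'm \<Rightarrow> bool" where
  "is_cokernel C f c \<longleftrightarrow> f \<in> Arr C \<and> c \<in> Arr C \<and> Src C c = Tgt C f \<and>
     c \<cdot>\<^bsub>C\<^esub> f = Zero C (Src C f) (Tgt C c) \<and>
     (\<forall>Z \<in> Obj C. \<forall>g \<in> Hom C (Tgt C f) Z. g \<cdot>\<^bsub>C\<^esub> f = Zero C (Src C f) Z \<longrightarrow>
        (\<exists>!h. h \<in> Hom C (Tgt C c) Z \<and> h \<cdot>\<^bsub>C\<^esub> c = g))"

definition is_biproduct ::
    "('o, 'm, 'x) preadditive_scheme \<Rightarrow> 'o \<Rightarrow> 'o \<Rightarrow> 'o \<Rightarrow> 'm \<Rightarrow> 'm \<Rightarrow> 'm \<Rightarrow> 'm \<Rightarrow> bool" where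
  "is_biproduct C X Y P i j p q \<longleftrightarrow> P \<in> Obj C \<and>
     i \<in> Hom C X P \<and> j \<in> Hom C Y P \<and> p \<in> Hom C P X \<and> q \<in> Hom C P Y \<and>
     p \<cdot>\<^bsub>C\<^esub> i = Ident C X \<and> q \<cdot>\<^bsub>C\<^esub> j = Ident C Y \<and>
     q \<cdot>\<^bsub>C\<^esub> i = Zero C X Y \<and> p \<cdot>\<^bsub>C\<^esub> j = Zero C Y X \<and>
     Add C (i \<cdot>\<^bsub>C\<^esub> p) (j \<cdot>\<^bsub>C\<^esub> q) = Ident C P"

locale abelian_category = preadditive_category C
  for C :: "('o, 'm, 'x) preadditive_scheme" (structure) +
  assumes ex_zero_object: "\<exists>Z. zero_object C Z"
    and ex_biproduct: "X \<in> Obj C \<Longrightarrow> Y \<in> Obj C \<Longrightarrow> \<exists>P i j p q. is_biproduct C X Y P i j p q"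
    and ex_kernel: "f \<in> Arr C \<Longrightarrow> \<exists>k. is_kernel C f k"
    and ex_cokernel: "f \<in> Arr C \<Longrightarrow> \<exists>c. is_cokernel C f c"
    and monic_normal: "monic C f \<Longrightarrow> \<exists>g. is_kernel C g f"
    and epic_normal: "epic C f \<Longrightarrow> \<exists>g. is_cokernel C g f"

definition simple_object :: "('o, 'm, 'x) precategory_scheme \<Rightarrow> 'o \<Rightarrow> bool" where
  "simple_object C S \<longleftrightarrow> S \<in> Obj C \<and> \<not> zero_object C S \<and>
     (\<forall>m. monic C m \<and> Tgt C m = S \<longrightarrow> zero_object C (Src C m) \<or> isomorphism C m)"

text \<open>
  A finite filtration \<open>0 = X 0 \<rightarrow> X 1 \<rightarrow> \<dots> \<rightarrow> X n = M\<close> by monomorphisms with simple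
  subquotients.
\<close>

definition has_composition_series :: "('o, 'm, 'x) preadditive_scheme \<Rightarrow> 'o \<Rightarrow> bool" where
  "has_composition_series C M \<longleftrightarrow>
     (\<exists>(n::nat) (X :: nat \<Rightarrow> 'o) (i :: nat \<Rightarrow> 'm).
        zero_object C (X 0) \<and> X n = M \<and>
        (\<forall>k<n. i k \<in> Hom C (X k) (X (Suc k)) \<and> monic C (i k) \<and>
           (\<exists>c. is_cokernel C (i k) c \<and> simple_object C (Tgt C c))))"

locale abelian_length_category = abelian_category C
  for C :: "('o, 'm, 'x) preadditive_scheme" (structure) +
  assumes ex_composition_series: "M \<in> Obj C \<Longrightarrow> has_composition_series C M"

text \<open>\<open>0 \<rightarrow> X \<rightarrow> M \<rightarrow> Y \<rightarrow> 0\<close>, with maps \<open>i\<close> and \<open>p\<close>.\<close>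

definition short_exact :: "('o, 'm, 'x) preadditive_scheme \<Rightarrow> 'm \<Rightarrow> 'm \<Rightarrow> bool" where
  "short_exact C i p \<longleftrightarrow> is_kernel C p i \<and> is_cokernel C i p"

text \<open>Full subcategories closed under isomorphism, given by their sets of objects.\<close>

definition subcategory :: "('o, 'm, 'x) precategory_scheme \<Rightarrow> 'o set \<Rightarrow> bool" where
  "subcategory C S \<longleftrightarrow> S \<subseteq> Obj C \<and>
     (\<forall>X \<in> S. \<forall>Y \<in> Obj C. isomorphic C X Y \<longrightarrow> Y \<in> S)"

definition torsion_pair :: "('o, 'm, 'x) preadditive_scheme \<Rightarrow> 'o set \<Rightarrow> 'o set \<Rightarrow> bool" where
  "torsion_pair C t f \<longleftrightarrow> subcategory C t \<and> subcategory C f \<and>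
     (\<forall>T \<in> t. \<forall>F \<in> f. Hom C T F = {Zero C T F}) \<and>
     (\<forall>M \<in> Obj C. \<exists>T \<in> t. \<exists>F \<in> f. \<exists>i \<in> Hom C T M. \<exists>p \<in> Hom C M F. short_exact C i p)"

definition torsion_class :: "('o, 'm, 'x) preadditive_scheme \<Rightarrow> 'o set \<Rightarrow> bool" where
  "torsion_class C t \<longleftrightarrow> (\<exists>f. torsion_pair C t f)"

definition torsionfree_class :: "('o, 'm, 'x) preadditive_scheme \<Rightarrow> 'o set \<Rightarrow> bool" where
  "torsionfree_class C f \<longleftrightarrow> (\<exists>t. torsion_pair C t f)"

text \<open>
  The closure conditions give a zero object as soon as \<open>W\<close> is non-empty. The empty set also
  satisfies them, but it generates the same torsion class, and cogenerates the same torsionfree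
  class, as the zero objects, and \<open>u \<inter> f\<close> is never empty, so admitting it changes nothing below.
\<close>

definition wide :: "('o, 'm, 'x) preadditive_scheme \<Rightarrow> 'o set \<Rightarrow> bool" where
  "wide C W \<longleftrightarrow> subcategory C W \<and>
     (\<forall>X \<in> W. \<forall>Y \<in> W. \<forall>f \<in> Hom C X Y.
        (\<forall>k. is_kernel C f k \<longrightarrow> Src C k \<in> W) \<and> (\<forall>c. is_cokernel C f c \<longrightarrow> Tgt C c \<in> W)) \<and>
     (\<forall>X \<in> W. \<forall>Y \<in> W. \<forall>E \<in> Obj C. \<forall>i \<in> Hom C X E. \<forall>p \<in> Hom C E Y.
        short_exact C i p \<longrightarrow> E \<in> W)"

definition wide_interval ::
    "('o, 'm, 'x) preadditive_scheme \<Rightarrow> 'o set \<Rightarrow> 'o set \<Rightarrow> 'o set \<Rightarrow> 'o set \<Rightarrow> bool" where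
  "wide_interval C t f u v \<longleftrightarrow>
     torsion_pair C t f \<and> torsion_pair C u v \<and> t \<subset> u \<and> wide C (u \<inter> f)"

definition widely_generated :: "('o, 'm, 'x) preadditive_scheme \<Rightarrow> 'o set \<Rightarrow> 'o set \<Rightarrow> bool" where
  "widely_generated C t f \<longleftrightarrow> torsion_pair C t f \<and>
     (\<exists>W. wide C W \<and> W \<subseteq> t \<and> (\<forall>t'. torsion_class C t' \<and> W \<subseteq> t' \<longrightarrow> t \<subseteq> t'))"

definition widely_cogenerated :: "('o, 'm, 'x) preadditive_scheme \<Rightarrow> 'o set \<Rightarrow> 'o set \<Rightarrow> bool" where
  "widely_cogenerated C t f \<longleftrightarrow> torsion_pair C t f \<and>
     (\<exists>W. wide C W \<and> W \<subseteq> f \<and> (\<forall>f'. torsionfree_class C f' \<and> W \<subseteq> f' \<longrightarrow> f \<subseteq> f'))"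

definition f_simple :: "('o, 'm, 'x) preadditive_scheme \<Rightarrow> 'o set \<Rightarrow> 'o set \<Rightarrow> 'o \<Rightarrow> bool" where
  "f_simple C t f F \<longleftrightarrow> F \<in> f \<and> \<not> zero_object C F \<and>
     (\<forall>q. epic C q \<and> Src C q = F \<and> \<not> isomorphism C q \<longrightarrow> Tgt C q \<in> t)"

definition t_simple :: "('o, 'm, 'x) preadditive_scheme \<Rightarrow> 'o set \<Rightarrow> 'o set \<Rightarrow> 'o \<Rightarrow> bool" where
  "t_simple C t f T \<longleftrightarrow> T \<in> t \<and> \<not> zero_object C T \<and>
     (\<forall>m. monic C m \<and> Tgt C m = T \<and> \<not> isomorphism C m \<longrightarrow> Src C m \<in> f)"

definition torsionfree_almost_torsion ::
    "('o, 'm, 'x) preadditive_scheme \<Rightarrow> 'o set \<Rightarrow> 'o set \<Rightarrow> 'o \<Rightarrow> bool" where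
  "torsionfree_almost_torsion C t f B \<longleftrightarrow> f_simple C t f B \<and>
     (\<forall>F \<in> f. \<forall>g \<in> Hom C B F. \<forall>c. is_cokernel C g c \<longrightarrow> Tgt C c \<in> f)"

definition torsion_almost_torsionfree ::
    "('o, 'm, 'x) preadditive_scheme \<Rightarrow> 'o set \<Rightarrow> 'o set \<Rightarrow> 'o \<Rightarrow> bool" where
  "torsion_almost_torsionfree C t f B \<longleftrightarrow> t_simple C t f B \<and>
     (\<forall>T \<in> t. \<forall>g \<in> Hom C T B. \<forall>k. is_kernel C g k \<longrightarrow> Src C k \<in> t)"

text \<open>
  The two halves of a torsion pair determine each other; both are passed as arguments.
\<close>

definition Up :: "('o, 'm, 'x) preadditive_scheme \<Rightarrow> 'o set \<Rightarrow> 'o set \<Rightarrow> 'o set set" where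
  "Up C t f = {iso_class C B |B. torsionfree_almost_torsion C t f B}"

definition Low :: "('o, 'm, 'x) preadditive_scheme \<Rightarrow> 'o set \<Rightarrow> 'o set \<Rightarrow> 'o set set" where
  "Low C t f = {iso_class C B |B. torsion_almost_torsionfree C t f B}"

definition is_envelope :: "('o, 'm, 'x) precategory_scheme \<Rightarrow> 'o set \<Rightarrow> 'o \<Rightarrow> 'm \<Rightarrow> bool" where
  "is_envelope C S X e \<longleftrightarrow> e \<in> Arr C \<and> Src C e = X \<and> Tgt C e \<in> S \<and>
     (\<forall>Y \<in> S. \<forall>g \<in> Hom C X Y. \<exists>h \<in> Hom C (Tgt C e) Y. h \<cdot>\<^bsub>C\<^esub> e = g) \<and>
     (\<forall>h \<in> Hom C (Tgt C e) (Tgt C e). h \<cdot>\<^bsub>C\<^esub> e = e \<longrightarrow> isomorphism C h)"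

text \<open>
  The isomorphism class underlying an element of a disjoint union \<open>Up C t f <+> Low C t f\<close>. As
  \<open>Up C t f\<close> and \<open>Low C t f\<close> are disjoint, it determines the element.
\<close>

definition underlying_class :: "'a + 'a \<Rightarrow> 'a" where
  "underlying_class = case_sum id id"

end

theory Submission
  imports Defs
begin

text \<open>
  Put \<open>W = u \<inter> f\<close>. Tilting at \<open>(t, f)\<close> gives an abelian category whose simple objects are the
  objects of \<open>Up t\<close> and the shifted objects of \<open>Low t\<close>, and likewise for \<open>(u, v)\<close>. The first of
  these categories is tilted at the Serre subcategory \<open>W\<close> to obtain the second, and the simple
  objects correspond to each other by universal extension by \<open>W\<close>, up to a shift for those in
  \<open>W\<close>. The proof expresses this correspondence inside the given category, without derived
  categories, as a relation \<open>partner\<close> with four cases: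

  \<^item> \<open>V \<in> Up u\<close> and \<open>T \<in> Low t\<close> are partners if there is an exact sequence
    \<open>0 \<rightarrow> V \<rightarrow> P \<rightarrow> T \<rightarrow> 0\<close> with \<open>P \<in> W\<close>;
  \<^item> \<open>V \<in> Up u\<close> and \<open>F \<in> Up t\<close> are partners if there is an exact sequence
    \<open>0 \<rightarrow> F \<rightarrow> V \<rightarrow> X \<rightarrow> 0\<close> with \<open>X \<in> W\<close>;
  \<^item> \<open>U \<in> Low u\<close> and \<open>T \<in> Low t\<close> are partners if there is an exact sequence
    \<open>0 \<rightarrow> K \<rightarrow> T \<rightarrow> U \<rightarrow> 0\<close> with \<open>K \<in> W\<close>;
  \<^item> \<open>U \<in> Low u\<close> and \<open>F \<in> Up t\<close> are partners if they are isomorphic.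

  In the opposite category the roles of \<open>t\<close> and \<open>v\<close>, of \<open>f\<close> and \<open>u\<close>, of \<open>Up u\<close> and \<open>Low t\<close>, and of
  \<open>Low u\<close> and \<open>Up t\<close> are exchanged, and the relation becomes its converse (\<open>matched_dual\<close>). So
  bijectivity follows once every object of \<open>Up u\<close> and \<open>Low u\<close> is shown to have a partner
  (\<open>matched_exists\<close>), which is unique up to isomorphism (\<open>matched_unique\<close>).

  Uniqueness: in the first two cases the map \<open>V \<rightarrow> P\<close>, respectively \<open>V \<rightarrow> X\<close>, is the reflection of \<open>V\<close>
  into \<open>W\<close> (\<open>reflection_with_Low_cokernel\<close>, \<open>reflection_with_Up_kernel\<close>). So it is the envelope of
  the theorem, and the partner is its cokernel or kernel. In the third case \<open>T\<close> is recovered as the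
  torsion part of a fibre product over \<open>U\<close> (\<open>Low_t_over_Low_u_unique\<close>).

  Existence: if \<open>V\<close> does not embed into an object of \<open>W\<close>, its largest quotient in \<open>W\<close> has its kernel
  in \<open>Up t\<close> (\<open>Up_without_embedding\<close>). If it does, the cokernel of a minimal embedding is torsion, and
  some \<open>T \<in> Low t\<close> maps to it, which is pulled back (\<open>Up_with_embedding\<close>). If \<open>U \<in> Low u\<close> is in \<open>W\<close>, it
  is in \<open>Up t\<close> itself (\<open>Low_in_heart\<close>); otherwise it is in \<open>t\<close>, and some \<open>T \<in> Low t\<close> maps onto it with
  kernel in \<open>W\<close> (\<open>map_Low_t_to_Low_u\<close>). That objects \<open>T\<close> exist is what wide generation provides: every
  non-zero object of \<open>t\<close> receives a non-zero map from an object of \<open>Low t\<close>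
  (\<open>generating_torsion_almost_torsionfree\<close>).
\<close>

section \<open>Opposite categories\<close>

text \<open>
  The type is unchanged, so every statement about categories can be applied to the opposite
  category; all dual statements below are obtained in this way.
\<close>

definition opposite ::
    "('o, 'm, 'x) preadditive_scheme \<Rightarrow> ('o, 'm, 'x) preadditive_scheme" where
  "opposite C = C\<lparr>Src := Tgt C, Tgt := Src C, Comp := (\<lambda>g f. f \<cdot>\<^bsub>C\<^esub> g), Zero := (\<lambda>X Y. Zero C Y X)\<rparr>"

lemma opposite_simps [simp]:
  "Obj (opposite C) = Obj C" "Arr (opposite C) = Arr C" "Src (opposite C) = Tgt C"
  "Tgt (opposite C) = Src C" "Ident (opposite C) = Ident C"
  "g \<cdot>\<^bsub>opposite C\<^esub> f = f \<cdot>\<^bsub>C\<^esub> g" "Add (opposite C) = Add C" "Zero (opposite C) X Y = Zero C Y X"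
  by (simp_all add: opposite_def)

lemma Hom_opposite [simp]: "Hom (opposite C) X Y = Hom C Y X"
  by (auto simp: Hom_def)

lemma monic_opposite [simp]: "monic (opposite C) = epic C"
  by (auto simp: monic_def epic_def fun_eq_iff)

lemma epic_opposite [simp]: "epic (opposite C) = monic C"
  by (auto simp: monic_def epic_def fun_eq_iff)

lemma isomorphism_opposite [simp]: "isomorphism (opposite C) = isomorphism C"
  by (auto simp: isomorphism_def fun_eq_iff)

lemma zero_object_opposite [simp]: "zero_object (opposite C) = zero_object C"
  by (auto simp: zero_object_def fun_eq_iff)

lemma is_kernel_opposite [simp]: "is_kernel (opposite C) = is_cokernel C"
  by (auto simp: is_kernel_def is_cokernel_def fun_eq_iff)

lemma is_cokernel_opposite [simp]: "is_cokernel (opposite C) = is_kernel C"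
  by (auto simp: is_kernel_def is_cokernel_def fun_eq_iff)

lemma short_exact_opposite [simp]: "short_exact (opposite C) i p = short_exact C p i"
  by (auto simp: short_exact_def)

lemma is_biproduct_opposite [simp]:
  "is_biproduct (opposite C) X Y P i j p q = is_biproduct C X Y P p q i j"
  by (auto simp: is_biproduct_def)

lemma category_opposite:
  assumes "category C"
  shows "category (opposite C)"
proof -
  interpret category C by fact
  show ?thesis
    by unfold_locales
      (auto simp: src_closed tgt_closed ident_closed comp_ident_left comp_ident_right
        comp_assoc[symmetric] intro: comp_closed)
qed

lemma (in abelian_category) ex_biproduct_symmetric:
  assumes "X \<in> Obj C" "Y \<in> Obj C"
  shows "\<exists>P i j p q. is_biproduct C X Y P p q i j"
  using ex_biproduct[OF assms] by blast

lemma abelian_opposite: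
  assumes "abelian_category C"
  shows "abelian_category (opposite C)"
proof -
  interpret abelian_category C by fact
  interpret op: category "opposite C" by (rule category_opposite) unfold_locales
  show ?thesis
    by (intro abelian_category.intro preadditive_category.intro op.category_axioms
        preadditive_category_axioms.intro abelian_category_axioms.intro)
      (use ex_zero_object in \<open>auto simp: ex_kernel ex_cokernel monic_normal epic_normal
        hom_comm_group comp_add_left comp_add_right intro: ex_biproduct_symmetric\<close>)
qed

section \<open>Monomorphisms, epimorphisms and isomorphisms\<close>

context category
begin

lemma HomD:
  assumes "g \<in> Hom C X Y"
  shows "g \<in> Arr C" "Src C g = X" "Tgt C g = Y" "X \<in> Obj C" "Y \<in> Obj C"
  using assms src_closed tgt_closed by (auto simp: Hom_def)

lemma monicI:
  assumes "m \<in> Hom C X Y"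
    and "\<And>Z g h. g \<in> Hom C Z X \<Longrightarrow> h \<in> Hom C Z X \<Longrightarrow> m \<cdot> g = m \<cdot> h \<Longrightarrow> g = h"
  shows "monic C m"
  using assms by (auto simp: monic_def HomD)

lemma epicI:
  assumes "e \<in> Hom C X Y"
    and "\<And>Z g h. g \<in> Hom C Y Z \<Longrightarrow> h \<in> Hom C Y Z \<Longrightarrow> g \<cdot> e = h \<cdot> e \<Longrightarrow> g = h"
  shows "epic C e"
  using assms by (auto simp: epic_def HomD)

lemma monicD:
  assumes "monic C m" "m \<in> Hom C X Y" "g \<in> Hom C Z X" "h \<in> Hom C Z X" "m \<cdot> g = m \<cdot> h"
  shows "g = h"
  using assms HomD[OF assms(2)] HomD[OF assms(3)] unfolding monic_def by blast

lemma epicD: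
  assumes "epic C e" "e \<in> Hom C X Y" "g \<in> Hom C Y Z" "h \<in> Hom C Y Z" "g \<cdot> e = h \<cdot> e"
  shows "g = h"
  using assms HomD[OF assms(2)] HomD[OF assms(3)] unfolding epic_def by blast

lemma monic_comp:
  assumes "g \<in> Hom C X Y" "h \<in> Hom C Y Z" "monic C g" "monic C h"
  shows "monic C (h \<cdot> g)"
proof (rule monicI[OF comp_closed[OF assms(1,2)]])
  fix A a b assume ab: "a \<in> Hom C A X" "b \<in> Hom C A X" "(h \<cdot> g) \<cdot> a = (h \<cdot> g) \<cdot> b"
  then have "h \<cdot> (g \<cdot> a) = h \<cdot> (g \<cdot> b)"
    by (simp add: comp_assoc[OF _ assms(1,2)])
  then have "g \<cdot> a = g \<cdot> b"
    using monicD[OF assms(4,2) comp_closed[OF ab(1) assms(1)] comp_closed[OF ab(2) assms(1)]] by simp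
  then show "a = b" by (rule monicD[OF assms(3,1) ab(1,2)])
qed

lemma epic_comp:
  assumes "g \<in> Hom C X Y" "h \<in> Hom C Y Z" "epic C g" "epic C h"
  shows "epic C (h \<cdot> g)"
proof (rule epicI[OF comp_closed[OF assms(1,2)]])
  fix A a b assume ab: "a \<in> Hom C Z A" "b \<in> Hom C Z A" "a \<cdot> (h \<cdot> g) = b \<cdot> (h \<cdot> g)"
  then have "(a \<cdot> h) \<cdot> g = (b \<cdot> h) \<cdot> g"
    by (simp add: comp_assoc[OF assms(1,2)])
  then have "a \<cdot> h = b \<cdot> h"
    using epicD[OF assms(3,1) comp_closed[OF assms(2) ab(1)] comp_closed[OF assms(2) ab(2)]] by simp
  then show "a = b" by (rule epicD[OF assms(4,2) ab(1,2)])
qed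

lemma monic_factor:
  assumes "g \<in> Hom C X Y" "h \<in> Hom C Y Z" "monic C (h \<cdot> g)"
  shows "monic C g"
proof (rule monicI[OF assms(1)])
  fix A a b assume ab: "a \<in> Hom C A X" "b \<in> Hom C A X" "g \<cdot> a = g \<cdot> b"
  then have "(h \<cdot> g) \<cdot> a = (h \<cdot> g) \<cdot> b" by (simp add: comp_assoc[OF _ assms(1,2)])
  then show "a = b" by (rule monicD[OF assms(3) comp_closed[OF assms(1,2)] ab(1,2)])
qed

lemma epic_factor:
  assumes "g \<in> Hom C X Y" "h \<in> Hom C Y Z" "epic C (h \<cdot> g)"
  shows "epic C h"
proof (rule epicI[OF assms(2)])
  fix A a b assume ab: "a \<in> Hom C Z A" "b \<in> Hom C Z A" "a \<cdot> h = b \<cdot> h"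
  then have "a \<cdot> (h \<cdot> g) = b \<cdot> (h \<cdot> g)" by (simp add: comp_assoc[OF assms(1,2), symmetric])
  then show "a = b" by (rule epicD[OF assms(3) comp_closed[OF assms(1,2)] ab(1,2)])
qed

lemma isomorphismI:
  assumes "g \<in> Hom C X Y" "h \<in> Hom C Y X" "h \<cdot> g = Ident C X" "g \<cdot> h = Ident C Y"
  shows "isomorphism C g"
  using assms HomD[OF assms(1)] by (auto simp: isomorphism_def)

lemma isomorphismE:
  assumes "isomorphism C g" "g \<in> Hom C X Y"
  obtains h where "h \<in> Hom C Y X" "h \<cdot> g = Ident C X" "g \<cdot> h = Ident C Y" "isomorphism C h"
proof -
  obtain h where "h \<in> Hom C Y X" "h \<cdot> g = Ident C X" "g \<cdot> h = Ident C Y"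
    using assms HomD[OF assms(2)] unfolding isomorphism_def by auto
  with that isomorphismI[OF this(1) assms(2) this(3,2)] show thesis by blast
qed

lemma isomorphism_ident: "X \<in> Obj C \<Longrightarrow> isomorphism C (Ident C X)"
  using isomorphismI[OF ident_closed ident_closed] comp_ident_left[OF ident_closed] by blast

lemma isomorphism_monic:
  assumes "isomorphism C g" "g \<in> Hom C X Y"
  shows "monic C g"
proof -
  obtain h where h: "h \<in> Hom C Y X" "h \<cdot> g = Ident C X" by (rule isomorphismE[OF assms])
  have "monic C (Ident C X)"
    by (rule monicI[OF ident_closed]) (simp_all add: HomD[OF assms(2)] comp_ident_left)
  then show ?thesis using monic_factor[OF assms(2) h(1)] h(2) by simp
qed

lemma isomorphism_epic:
  assumes "isomorphism C g" "g \<in> Hom C X Y"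
  shows "epic C g"
proof -
  obtain h where h: "h \<in> Hom C Y X" "g \<cdot> h = Ident C Y" by (rule isomorphismE[OF assms])
  have "epic C (Ident C Y)"
    by (rule epicI[OF ident_closed]) (simp_all add: HomD[OF assms(2)] comp_ident_right)
  then show ?thesis using epic_factor[OF h(1) assms(2)] h(2) by simp
qed

lemma isomorphism_comp:
  assumes "isomorphism C g" "isomorphism C h" "g \<in> Hom C X Y" "h \<in> Hom C Y Z"
  shows "isomorphism C (h \<cdot> g)"
proof -
  obtain g' where g': "g' \<in> Hom C Y X" "g' \<cdot> g = Ident C X" "g \<cdot> g' = Ident C Y"
    by (rule isomorphismE[OF assms(1,3)])
  obtain h' where h': "h' \<in> Hom C Z Y" "h' \<cdot> h = Ident C Y" "h \<cdot> h' = Ident C Z"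
    by (rule isomorphismE[OF assms(2,4)])
  note hg = comp_closed[OF assms(3,4)] and gh' = comp_closed[OF h'(1) g'(1)]
  have 1: "(g' \<cdot> h') \<cdot> (h \<cdot> g) = Ident C X"
    by (simp add: comp_assoc[OF hg h'(1) g'(1)] comp_assoc[OF assms(3,4) h'(1), symmetric]
        h' g' comp_ident_left[OF assms(3)])
  have 2: "(h \<cdot> g) \<cdot> (g' \<cdot> h') = Ident C Z"
    by (simp add: comp_assoc[OF gh' assms(3,4)] comp_assoc[OF h'(1) g'(1) assms(3), symmetric]
        h' g' comp_ident_left[OF h'(1)])
  show ?thesis by (rule isomorphismI[OF hg gh' 1 2])
qed

lemma isomorphicI: "h \<in> Hom C X Y \<Longrightarrow> isomorphism C h \<Longrightarrow> isomorphic C X Y"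
  by (auto simp: isomorphic_def)

lemma isomorphic_refl: "X \<in> Obj C \<Longrightarrow> isomorphic C X X"
  using isomorphism_ident ident_closed isomorphicI by metis

lemma isomorphic_sym: "isomorphic C X Y \<Longrightarrow> isomorphic C Y X"
  unfolding isomorphic_def by (meson isomorphismE)

lemma isomorphic_trans: "isomorphic C X Y \<Longrightarrow> isomorphic C Y Z \<Longrightarrow> isomorphic C X Z"
  unfolding isomorphic_def by (meson isomorphism_comp comp_closed)

lemma iso_class_eq_iff:
  assumes "X \<in> Obj C" "Y \<in> Obj C"
  shows "iso_class C X = iso_class C Y \<longleftrightarrow> isomorphic C X Y"
proof
  assume "iso_class C X = iso_class C Y"
  then have "Y \<in> iso_class C X" using assms(2) isomorphic_refl by (simp add: iso_class_def)
  then show "isomorphic C X Y" by (simp add: iso_class_def)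
next
  assume "isomorphic C X Y"
  then have "isomorphic C X Z \<longleftrightarrow> isomorphic C Y Z" for Z
    by (meson isomorphic_sym isomorphic_trans)
  then show "iso_class C X = iso_class C Y" by (simp add: iso_class_def)
qed

end

lemma isomorphic_opposite:
  assumes "category C"
  shows "isomorphic (opposite C) X Y \<longleftrightarrow> isomorphic C X Y"
proof -
  interpret category C by fact
  show ?thesis using isomorphic_sym by (auto simp: isomorphic_def)
qed

section \<open>Zero maps, kernels and cokernels\<close>

context preadditive_category
begin

abbreviation hom_group :: "'o \<Rightarrow> 'o \<Rightarrow> 'm monoid" where
  "hom_group X Y \<equiv> \<lparr>carrier = Hom C X Y, mult = Add C, one = Zero C X Y\<rparr>"

definition diff :: "'m \<Rightarrow> 'm \<Rightarrow> 'm" where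
  "diff g h = Add C g (inv\<^bsub>hom_group (Src C g) (Tgt C g)\<^esub> h)"

lemma zero_closed: "X \<in> Obj C \<Longrightarrow> Y \<in> Obj C \<Longrightarrow> Zero C X Y \<in> Hom C X Y"
  using comm_group.axioms(2)[OF hom_comm_group, of X Y] group.is_monoid monoid.one_closed by fastforce

lemma add_closed: "g \<in> Hom C X Y \<Longrightarrow> h \<in> Hom C X Y \<Longrightarrow> Add C g h \<in> Hom C X Y"
  using comm_group.axioms(2)[OF hom_comm_group, of X Y] HomD monoid.m_closed group.is_monoid
  by fastforce

lemma add_zero:
  assumes "g \<in> Hom C X Y"
  shows "Add C g (Zero C X Y) = g" "Add C (Zero C X Y) g = g"
proof -
  interpret G: comm_group "hom_group X Y" using hom_comm_group HomD[OF assms] by blast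
  show "Add C g (Zero C X Y) = g" "Add C (Zero C X Y) g = g"
    using G.r_one[of g] G.l_one[of g] assms by auto
qed

lemma add_idem_zero:
  assumes "g \<in> Hom C X Y" "Add C g g = g"
  shows "g = Zero C X Y"
proof -
  interpret G: comm_group "hom_group X Y" using hom_comm_group HomD[OF assms(1)] by blast
  show ?thesis using G.l_cancel_one[of g g] assms by auto
qed

lemma comp_zero_right:
  assumes "g \<in> Hom C Y Z" "X \<in> Obj C"
  shows "g \<cdot> Zero C X Y = Zero C X Z"
proof (rule add_idem_zero)
  have z: "Zero C X Y \<in> Hom C X Y" by (rule zero_closed[OF assms(2) HomD(4)[OF assms(1)]])
  show "g \<cdot> Zero C X Y \<in> Hom C X Z" by (rule comp_closed[OF z assms(1)])
  show "Add C (g \<cdot> Zero C X Y) (g \<cdot> Zero C X Y) = g \<cdot> Zero C X Y"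
    using comp_add_right[OF z z assms(1)] add_zero[OF z] by simp
qed

lemma comp_zero_left:
  assumes "g \<in> Hom C X Y" "Z \<in> Obj C"
  shows "Zero C Y Z \<cdot> g = Zero C X Z"
proof (rule add_idem_zero)
  have z: "Zero C Y Z \<in> Hom C Y Z" by (rule zero_closed[OF HomD(5)[OF assms(1)] assms(2)])
  show "Zero C Y Z \<cdot> g \<in> Hom C X Z" by (rule comp_closed[OF assms(1) z])
  show "Add C (Zero C Y Z \<cdot> g) (Zero C Y Z \<cdot> g) = Zero C Y Z \<cdot> g"
    using comp_add_left[OF assms(1) z z] add_zero[OF z] by simp
qed

lemma diff_unique:
  assumes "g \<in> Hom C X Y" "h \<in> Hom C X Y"
  shows "diff g h \<in> Hom C X Y" "Add C (diff g h) h = g"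
    and "d \<in> Hom C X Y \<Longrightarrow> Add C d h = g \<Longrightarrow> d = diff g h"
proof -
  interpret G: comm_group "hom_group X Y" using hom_comm_group HomD[OF assms(1)] by blast
  have d: "diff g h = g \<otimes>\<^bsub>hom_group X Y\<^esub> inv\<^bsub>hom_group X Y\<^esub> h"
    using HomD[OF assms(1)] by (simp add: diff_def)
  show "diff g h \<in> Hom C X Y"
    using G.m_closed[of g "inv\<^bsub>hom_group X Y\<^esub> h"] G.inv_closed[of h] assms d by simp
  show "Add C (diff g h) h = g"
    using G.inv_solve_right[of "diff g h" g h] G.m_closed[of g "inv\<^bsub>hom_group X Y\<^esub> h"]
      G.inv_closed[of h] assms d by auto
  show "d = diff g h" if "d \<in> Hom C X Y" "Add C d h = g"
    using G.inv_solve_right[of d g h] assms d that by auto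
qed

lemma diff_closed: "g \<in> Hom C X Y \<Longrightarrow> h \<in> Hom C X Y \<Longrightarrow> diff g h \<in> Hom C X Y"
  by (rule diff_unique(1))

lemma diff_eq_zero_iff:
  assumes "g \<in> Hom C X Y" "h \<in> Hom C X Y"
  shows "diff g h = Zero C X Y \<longleftrightarrow> g = h"
  using diff_unique(2)[OF assms] diff_unique(3)[OF assms, of "Zero C X Y"] add_zero(2)[OF assms(2)]
    zero_closed[OF HomD(4,5)[OF assms(1)]] by auto

lemma diff_zero_right:
  assumes "g \<in> Hom C X Y"
  shows "diff g (Zero C X Y) = g"
  using diff_unique(3)[OF assms zero_closed assms] add_zero(1)[OF assms] HomD(4,5)[OF assms] by simp

lemma comp_diff_right:
  assumes "g \<in> Hom C X Y" "h \<in> Hom C X Y" "k \<in> Hom C Y Z"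
  shows "k \<cdot> diff g h = diff (k \<cdot> g) (k \<cdot> h)"
proof (rule diff_unique(3)[OF comp_closed comp_closed])
  show "Add C (k \<cdot> diff g h) (k \<cdot> h) = k \<cdot> g"
    using comp_add_right[OF diff_closed[OF assms(1,2)] assms(2,3)] diff_unique(2)[OF assms(1,2)]
    by simp
qed (use assms comp_closed[OF diff_closed] in auto)

lemma comp_diff_left:
  assumes "k \<in> Hom C X Y" "g \<in> Hom C Y Z" "h \<in> Hom C Y Z"
  shows "diff g h \<cdot> k = diff (g \<cdot> k) (h \<cdot> k)"
proof (rule diff_unique(3)[OF comp_closed comp_closed])
  show "Add C (diff g h \<cdot> k) (h \<cdot> k) = g \<cdot> k"
    using comp_add_left[OF assms(1) diff_closed[OF assms(2,3)] assms(3)] diff_unique(2)[OF assms(2,3)]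
    by simp
qed (use assms comp_closed[OF _ diff_closed] in auto)

text \<open>
  In a preadditive category two arrows with the same composite differ by an arrow that is killed,
  so cancellation has to be tested on zero maps only.
\<close>

lemma monic_zeroI:
  assumes "m \<in> Hom C X Y"
    and "\<And>Z g. g \<in> Hom C Z X \<Longrightarrow> m \<cdot> g = Zero C Z Y \<Longrightarrow> g = Zero C Z X"
  shows "monic C m"
proof (rule monicI[OF assms(1)])
  fix Z g h assume gh: "g \<in> Hom C Z X" "h \<in> Hom C Z X" "m \<cdot> g = m \<cdot> h"
  have "m \<cdot> diff g h = Zero C Z Y"
    using comp_diff_right[OF gh(1,2) assms(1)] gh(3)
      diff_eq_zero_iff[OF comp_closed[OF gh(1) assms(1)] comp_closed[OF gh(2) assms(1)]] by simp
  then show "g = h"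
    using assms(2)[OF diff_closed[OF gh(1,2)]] diff_eq_zero_iff[OF gh(1,2)] by simp
qed

lemma epic_zeroI:
  assumes "e \<in> Hom C X Y"
    and "\<And>Z g. g \<in> Hom C Y Z \<Longrightarrow> g \<cdot> e = Zero C X Z \<Longrightarrow> g = Zero C Y Z"
  shows "epic C e"
proof (rule epicI[OF assms(1)])
  fix Z g h assume gh: "g \<in> Hom C Y Z" "h \<in> Hom C Y Z" "g \<cdot> e = h \<cdot> e"
  have "diff g h \<cdot> e = Zero C X Z"
    using comp_diff_left[OF assms(1) gh(1,2)] gh(3)
      diff_eq_zero_iff[OF comp_closed[OF assms(1) gh(1)] comp_closed[OF assms(1) gh(2)]] by simp
  then show "g = h"
    using assms(2)[OF diff_closed[OF gh(1,2)]] diff_eq_zero_iff[OF gh(1,2)] by simp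
qed

lemma monic_zeroD:
  assumes "monic C m" "m \<in> Hom C X Y" "g \<in> Hom C Z X" "m \<cdot> g = Zero C Z Y"
  shows "g = Zero C Z X"
  using monicD[OF assms(1-3) zero_closed[OF HomD(4)[OF assms(3)] HomD(4)[OF assms(2)]]] assms(4)
    comp_zero_right[OF assms(2) HomD(4)[OF assms(3)]] by simp

lemma epic_zeroD:
  assumes "epic C e" "e \<in> Hom C X Y" "g \<in> Hom C Y Z" "g \<cdot> e = Zero C X Z"
  shows "g = Zero C Y Z"
  using epicD[OF assms(1-3) zero_closed[OF HomD(5)[OF assms(2)] HomD(5)[OF assms(3)]]] assms(4)
    comp_zero_left[OF assms(2) HomD(5)[OF assms(3)]] by simp

text \<open>
  Every arrow factors through the identity of its source and of its target, so the vanishing of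
  the identity kills all arrows into and out of the object.
\<close>

lemma zero_object_iff: "zero_object C X \<longleftrightarrow> X \<in> Obj C \<and> Ident C X = Zero C X X"
proof
  assume "zero_object C X"
  then show "X \<in> Obj C \<and> Ident C X = Zero C X X"
    unfolding zero_object_def using ident_closed zero_closed by blast
next
  assume X: "X \<in> Obj C \<and> Ident C X = Zero C X X"
  have "g = Zero C X Y" if "g \<in> Hom C X Y" for g Y
    using X comp_ident_right[OF that] comp_zero_right[OF that, of X] by simp
  moreover have "g = Zero C Y X" if "g \<in> Hom C Y X" for g Y
    using X comp_ident_left[OF that] comp_zero_left[OF that, of X] by simp
  ultimately show "zero_object C X"
    unfolding zero_object_def using X zero_closed by blast
qed

lemma from_zero_object:
  assumes "zero_object C X" "g \<in> Hom C X Y"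
  shows "g = Zero C X Y"
  using assms zero_closed[OF HomD(4,5)[OF assms(2)]] HomD(5)[OF assms(2)]
  unfolding zero_object_def by blast

lemma to_zero_object:
  assumes "zero_object C Y" "g \<in> Hom C X Y"
  shows "g = Zero C X Y"
  using assms zero_closed[OF HomD(4,5)[OF assms(2)]] HomD(4)[OF assms(2)]
  unfolding zero_object_def by blast

lemma zero_monic_source:
  assumes "monic C m" "m \<in> Hom C X Y" "m = Zero C X Y"
  shows "zero_object C X"
  using monic_zeroD[OF assms(1,2) ident_closed[OF HomD(4)[OF assms(2)]]] comp_ident_right[OF assms(2)]
    assms(3) HomD(4)[OF assms(2)] zero_object_iff by simp

lemma zero_epic_target:
  assumes "epic C e" "e \<in> Hom C X Y" "e = Zero C X Y"
  shows "zero_object C Y"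
  using epic_zeroD[OF assms(1,2) ident_closed[OF HomD(5)[OF assms(2)]]] comp_ident_left[OF assms(2)]
    assms(3) HomD(5)[OF assms(2)] zero_object_iff by simp

lemma is_kernelI:
  assumes "g \<in> Hom C X Y" "k \<in> Hom C K X" "g \<cdot> k = Zero C K Y" "monic C k"
    and "\<And>Z a. a \<in> Hom C Z X \<Longrightarrow> g \<cdot> a = Zero C Z Y \<Longrightarrow> \<exists>b \<in> Hom C Z K. k \<cdot> b = a"
  shows "is_kernel C g k"
proof -
  have "\<exists>!b. b \<in> Hom C Z K \<and> k \<cdot> b = a" if "a \<in> Hom C Z X" "g \<cdot> a = Zero C Z Y" for Z a
    using assms(5)[OF that] monicD[OF assms(4,2)] by blast
  then show ?thesis
    unfolding is_kernel_def using assms(3) HomD(1-3)[OF assms(1)] HomD(1-3)[OF assms(2)] by simp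
qed

lemma is_cokernelI:
  assumes "g \<in> Hom C X Y" "c \<in> Hom C Y K" "c \<cdot> g = Zero C X K" "epic C c"
    and "\<And>Z a. a \<in> Hom C Y Z \<Longrightarrow> a \<cdot> g = Zero C X Z \<Longrightarrow> \<exists>b \<in> Hom C K Z. b \<cdot> c = a"
  shows "is_cokernel C g c"
proof -
  have "\<exists>!b. b \<in> Hom C K Z \<and> b \<cdot> c = a" if "a \<in> Hom C Y Z" "a \<cdot> g = Zero C X Z" for Z a
    using assms(5)[OF that] epicD[OF assms(4,2)] by blast
  then show ?thesis
    unfolding is_cokernel_def using assms(3) HomD(1-3)[OF assms(1)] HomD(1-3)[OF assms(2)] by simp
qed

lemma kernelD:
  assumes "is_kernel C g k" "g \<in> Hom C X Y"
  shows "k \<in> Hom C (Src C k) X" "g \<cdot> k = Zero C (Src C k) Y" "monic C k" "Src C k \<in> Obj C"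
    and "\<And>Z a. a \<in> Hom C Z X \<Longrightarrow> g \<cdot> a = Zero C Z Y \<Longrightarrow> \<exists>b \<in> Hom C Z (Src C k). k \<cdot> b = a"
proof -
  note g = HomD[OF assms(2)]
  show k: "k \<in> Hom C (Src C k) X" using assms(1) g by (auto simp: is_kernel_def Hom_def)
  show gk: "g \<cdot> k = Zero C (Src C k) Y" using assms(1) g by (auto simp: is_kernel_def)
  show "Src C k \<in> Obj C" by (rule HomD(4)[OF k])
  have ex1: "\<exists>!h. h \<in> Hom C Z (Src C k) \<and> k \<cdot> h = a"
    if "a \<in> Hom C Z X" "g \<cdot> a = Zero C Z Y" for Z a
    using assms(1) g(2,3) that HomD(4)[OF that(1)] unfolding is_kernel_def by simp
  then show "\<exists>b \<in> Hom C Z (Src C k). k \<cdot> b = a" if "a \<in> Hom C Z X" "g \<cdot> a = Zero C Z Y" for Z a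
    using that by blast
  show "monic C k"
  proof (rule monicI[OF k])
    fix Z a b assume ab: "a \<in> Hom C Z (Src C k)" "b \<in> Hom C Z (Src C k)" "k \<cdot> a = k \<cdot> b"
    have "g \<cdot> (k \<cdot> a) = Zero C Z Y"
      using comp_assoc[OF ab(1) k assms(2)] gk comp_zero_left[OF ab(1) g(5)] by simp
    from ex1[OF comp_closed[OF ab(1) k] this] show "a = b" using ab by auto
  qed
qed

lemma cokernelD:
  assumes "is_cokernel C g c" "g \<in> Hom C X Y"
  shows "c \<in> Hom C Y (Tgt C c)" "c \<cdot> g = Zero C X (Tgt C c)" "epic C c" "Tgt C c \<in> Obj C"
    and "\<And>Z a. a \<in> Hom C Y Z \<Longrightarrow> a \<cdot> g = Zero C X Z \<Longrightarrow> \<exists>b \<in> Hom C (Tgt C c) Z. b \<cdot> c = a"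
proof -
  note g = HomD[OF assms(2)]
  show c: "c \<in> Hom C Y (Tgt C c)" using assms(1) g by (auto simp: is_cokernel_def Hom_def)
  show cg: "c \<cdot> g = Zero C X (Tgt C c)" using assms(1) g by (auto simp: is_cokernel_def)
  show "Tgt C c \<in> Obj C" by (rule HomD(5)[OF c])
  have ex1: "\<exists>!h. h \<in> Hom C (Tgt C c) Z \<and> h \<cdot> c = a"
    if "a \<in> Hom C Y Z" "a \<cdot> g = Zero C X Z" for Z a
    using assms(1) g(2,3) that HomD(5)[OF that(1)] unfolding is_cokernel_def by simp
  then show "\<exists>b \<in> Hom C (Tgt C c) Z. b \<cdot> c = a" if "a \<in> Hom C Y Z" "a \<cdot> g = Zero C X Z" for Z a
    using that by blast
  show "epic C c"
  proof (rule epicI[OF c])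
    fix Z a b assume ab: "a \<in> Hom C (Tgt C c) Z" "b \<in> Hom C (Tgt C c) Z" "a \<cdot> c = b \<cdot> c"
    have "(a \<cdot> c) \<cdot> g = Zero C X Z"
      using comp_assoc[OF assms(2) c ab(1)] cg comp_zero_right[OF ab(1) g(4)] by simp
    from ex1[OF comp_closed[OF c ab(1)] this] show "a = b" using ab by auto
  qed
qed

end

section \<open>Images, pushouts and pullbacks\<close>

context abelian_category
begin

lemma abelian_op: "abelian_category (opposite C)"
  by (rule abelian_opposite) unfold_locales

text \<open>
  A monomorphism is by axiom the kernel of some \<open>g\<close>. Since \<open>g\<close> factors through the cokernel
  \<open>c\<close>, whatever \<open>c\<close> kills is killed by \<open>g\<close>, so \<open>m\<close> is a kernel of its own cokernel.
\<close>

lemma normal_monic: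
  assumes "monic C m" "m \<in> Hom C X Y" "is_cokernel C m c"
  shows "short_exact C m c"
proof -
  note c = cokernelD[OF assms(3,2)]
  obtain g where g: "is_kernel C g m" using monic_normal[OF assms(1)] by blast
  then have g': "g \<in> Hom C Y (Tgt C g)" using HomD[OF assms(2)] by (auto simp: is_kernel_def Hom_def)
  have gm: "g \<cdot> m = Zero C X (Tgt C g)" using kernelD(2)[OF g g'] HomD(2)[OF assms(2)] by simp
  obtain b where b: "b \<in> Hom C (Tgt C c) (Tgt C g)" "b \<cdot> c = g" using c(5)[OF g' gm] by blast
  have "is_kernel C c m"
  proof (rule is_kernelI[OF c(1) assms(2) c(2) assms(1)])
    fix Z a assume a: "a \<in> Hom C Z Y" "c \<cdot> a = Zero C Z (Tgt C c)"
    then have "g \<cdot> a = Zero C Z (Tgt C g)"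
      using comp_assoc[OF a(1) c(1) b(1)] comp_zero_right[OF b(1) HomD(4)[OF a(1)]] b(2) by simp
    then show "\<exists>b \<in> Hom C Z X. m \<cdot> b = a" using kernelD(5)[OF g g' a(1)] HomD(2)[OF assms(2)] by simp
  qed
  then show ?thesis using assms(3) by (simp add: short_exact_def)
qed

lemma normal_epic:
  assumes "epic C e" "e \<in> Hom C X Y" "is_kernel C e k"
  shows "short_exact C k e"
  using abelian_category.normal_monic[OF abelian_op, of e Y X k] assms by simp

lemma cokernel_exists:
  assumes "g \<in> Hom C X Y"
  obtains c Z where "is_cokernel C g c" "c \<in> Hom C Y Z"
  using ex_cokernel[OF HomD(1)[OF assms]] cokernelD(1)[OF _ assms] by blast

lemma kernel_exists:
  assumes "g \<in> Hom C X Y"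
  obtains k Z where "is_kernel C g k" "k \<in> Hom C Z X"
  using ex_kernel[OF HomD(1)[OF assms]] kernelD(1)[OF _ assms] by blast

lemma monic_short_exact:
  assumes "monic C m" "m \<in> Hom C X Y"
  obtains c Z where "c \<in> Hom C Y Z" "short_exact C m c"
  by (rule cokernel_exists[OF assms(2)]) (use normal_monic[OF assms] that in blast)

lemma epic_short_exact:
  assumes "epic C e" "e \<in> Hom C X Y"
  obtains k Z where "k \<in> Hom C Z X" "short_exact C k e"
  by (rule kernel_exists[OF assms(2)]) (use normal_epic[OF assms] that in blast)

lemma short_exactD:
  assumes "short_exact C i p" "i \<in> Hom C X M" "p \<in> Hom C M Y"
  shows "is_kernel C p i" "is_cokernel C i p" "monic C i" "epic C p" "p \<cdot> i = Zero C X Y"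
    and "\<And>Z a. a \<in> Hom C Z M \<Longrightarrow> p \<cdot> a = Zero C Z Y \<Longrightarrow> \<exists>b \<in> Hom C Z X. i \<cdot> b = a"
    and "\<And>Z a. a \<in> Hom C M Z \<Longrightarrow> a \<cdot> i = Zero C X Z \<Longrightarrow> \<exists>b \<in> Hom C Y Z. b \<cdot> p = a"
proof -
  show k: "is_kernel C p i" and c: "is_cokernel C i p" using assms(1) by (auto simp: short_exact_def)
  have s: "Src C i = X" "Tgt C p = Y" using HomD[OF assms(2)] HomD[OF assms(3)] by auto
  note kk = kernelD[OF k assms(3), unfolded s] and cc = cokernelD[OF c assms(2), unfolded s]
  show "monic C i" "epic C p" "p \<cdot> i = Zero C X Y" using kk cc by auto
  show "\<exists>b \<in> Hom C Z X. i \<cdot> b = a" if "a \<in> Hom C Z M" "p \<cdot> a = Zero C Z Y" for Z a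
    by (rule kk(5)[OF that])
  show "\<exists>b \<in> Hom C Y Z. b \<cdot> p = a" if "a \<in> Hom C M Z" "a \<cdot> i = Zero C X Z" for Z a
    by (rule cc(5)[OF that])
qed

lemma balanced:
  assumes "monic C m" "epic C m" "m \<in> Hom C X Y"
  shows "isomorphism C m"
proof -
  obtain c Z where c: "c \<in> Hom C Y Z" "short_exact C m c" by (rule monic_short_exact[OF assms(1,3)])
  note s = short_exactD[OF c(2) assms(3) c(1)]
  note Y = HomD(5)[OF assms(3)] and X = HomD(4)[OF assms(3)]
  have "c = Zero C Y Z" by (rule epic_zeroD[OF assms(2,3) c(1) s(5)])
  then have "c \<cdot> Ident C Y = Zero C Y Z" using comp_ident_right[OF c(1)] by simp
  then obtain b where b: "b \<in> Hom C Y X" "m \<cdot> b = Ident C Y"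
    using s(6)[OF ident_closed[OF Y]] by blast
  have "m \<cdot> (b \<cdot> m) = m \<cdot> Ident C X"
    using comp_assoc[OF assms(3) b(1) assms(3)] b(2) comp_ident_left[OF assms(3)]
      comp_ident_right[OF assms(3)] by simp
  then have "b \<cdot> m = Ident C X"
    by (rule monicD[OF assms(1,3) comp_closed[OF assms(3) b(1)] ident_closed[OF X]])
  then show ?thesis using isomorphismI[OF assms(3) b(1) _ b(2)] by blast
qed

text \<open>
  The image is the kernel of the cokernel. The corestriction \<open>e\<close> is epic: if \<open>h\<close> kills \<open>e\<close>, then
  \<open>g\<close> factors through the subobject \<open>ker h\<close> of the image, every cokernel that kills this smaller
  subobject kills \<open>g\<close>, and so \<open>ker h\<close> is already the whole image.
\<close>

lemma image_factorization:
  assumes "g \<in> Hom C X Y"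
  obtains I e m where "e \<in> Hom C X I" "m \<in> Hom C I Y" "epic C e" "monic C m" "m \<cdot> e = g"
proof -
  obtain c Q where c: "is_cokernel C g c" "c \<in> Hom C Y Q" by (rule cokernel_exists[OF assms])
  note cD = cokernelD[OF c(1) assms]
  have Q: "Tgt C c = Q" using HomD[OF c(2)] by simp
  obtain m I where m: "is_kernel C c m" "m \<in> Hom C I Y" by (rule kernel_exists[OF c(2)])
  have I: "Src C m = I" using HomD[OF m(2)] by simp
  note mD = kernelD[OF m(1) c(2), unfolded I]
  obtain e where e: "e \<in> Hom C X I" "m \<cdot> e = g" using mD(5)[OF assms] cD(2) Q by auto
  have "epic C e"
  proof (rule epic_zeroI[OF e(1)])
    fix Z h assume h: "h \<in> Hom C I Z" "h \<cdot> e = Zero C X Z"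
    obtain k K where k: "is_kernel C h k" "k \<in> Hom C K I" by (rule kernel_exists[OF h(1)])
    have K: "Src C k = K" using HomD[OF k(2)] by simp
    note kD = kernelD[OF k(1) h(1), unfolded K]
    obtain e' where e': "e' \<in> Hom C X K" "k \<cdot> e' = e" using kD(5)[OF e(1) h(2)] by blast
    have mk: "m \<cdot> k \<in> Hom C K Y" by (rule comp_closed[OF k(2) m(2)])
    have mkm: "monic C (m \<cdot> k)" by (rule monic_comp[OF k(2) m(2) kD(3) mD(3)])
    obtain d D where d: "d \<in> Hom C Y D" "short_exact C (m \<cdot> k) d"
      by (rule monic_short_exact[OF mkm mk])
    note dD = short_exactD[OF d(2) mk d(1)]
    have "d \<cdot> g = (d \<cdot> (m \<cdot> k)) \<cdot> e'"
      using comp_assoc[OF e'(1) mk d(1)] comp_assoc[OF e'(1) k(2) m(2)] e(2) e'(2) by simp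
    then have "d \<cdot> g = Zero C X D" using dD(5) comp_zero_left[OF e'(1) HomD(5)[OF d(1)]] by simp
    then obtain d' where d': "d' \<in> Hom C Q D" "d' \<cdot> c = d" using cD(5)[OF d(1)] Q by auto
    have "d \<cdot> m = Zero C I D"
      using comp_assoc[OF m(2) c(2) d'(1)] d'(2) mD(2) comp_zero_right[OF d'(1) HomD(4)[OF m(2)]] by simp
    then obtain s where s: "s \<in> Hom C I K" "(m \<cdot> k) \<cdot> s = m" using dD(6)[OF m(2)] by blast
    note Io = HomD(4)[OF m(2)]
    have "m \<cdot> (k \<cdot> s) = m \<cdot> Ident C I"
      using s comp_assoc[OF s(1) k(2) m(2)] comp_ident_right[OF m(2)] by simp
    then have ks: "k \<cdot> s = Ident C I"
      by (rule monicD[OF mD(3) m(2) comp_closed[OF s(1) k(2)] ident_closed[OF Io]])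
    have "h = (h \<cdot> k) \<cdot> s" using comp_assoc[OF s(1) k(2) h(1)] ks comp_ident_right[OF h(1)] by simp
    then show "h = Zero C I Z" using kD(2) comp_zero_left[OF s(1) HomD(5)[OF h(1)]] by simp
  qed
  then show thesis using that[OF e(1) m(2) _ mD(3) e(2)] by blast
qed

lemma kernel_zero_monic:
  assumes "is_kernel C g k" "g \<in> Hom C X Y" "zero_object C (Src C k)"
  shows "monic C g"
proof (rule monic_zeroI[OF assms(2)])
  fix Z a assume a: "a \<in> Hom C Z X" "g \<cdot> a = Zero C Z Y"
  note k = kernelD[OF assms(1,2)]
  obtain b where b: "b \<in> Hom C Z (Src C k)" "k \<cdot> b = a" using k(5)[OF a] by blast
  then show "a = Zero C Z X"
    using to_zero_object[OF assms(3) b(1)] comp_zero_right[OF k(1) HomD(4)[OF a(1)]] by simp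
qed

lemma cokernel_zero_epic:
  assumes "is_cokernel C g c" "g \<in> Hom C X Y" "zero_object C (Tgt C c)"
  shows "epic C g"
  using abelian_category.kernel_zero_monic[OF abelian_op, of g c Y X] assms by simp

lemma cokernel_of_zero:
  assumes "is_cokernel C (Zero C X Y) c" "X \<in> Obj C" "Y \<in> Obj C"
  shows "isomorphism C c" "c \<in> Hom C Y (Tgt C c)"
proof -
  note z = zero_closed[OF assms(2,3)]
  note c = cokernelD[OF assms(1) z]
  obtain b where b: "b \<in> Hom C (Tgt C c) Y" "b \<cdot> c = Ident C Y"
    using c(5)[OF ident_closed[OF assms(3)]] comp_ident_left[OF z] by blast
  have "monic C c"
    by (rule monic_factor[OF c(1) b(1)])
      (simp add: b isomorphism_monic[OF isomorphism_ident ident_closed] assms(3))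
  then show "isomorphism C c" "c \<in> Hom C Y (Tgt C c)" using balanced[OF _ c(3,1)] c(1) by auto
qed

lemma cokernel_unique:
  assumes "g \<in> Hom C X Y" "is_cokernel C g c" "is_cokernel C g d"
  obtains h where "h \<in> Hom C (Tgt C c) (Tgt C d)" "isomorphism C h" "h \<cdot> c = d"
proof -
  note c = cokernelD[OF assms(2,1)] and d = cokernelD[OF assms(3,1)]
  obtain h where h: "h \<in> Hom C (Tgt C c) (Tgt C d)" "h \<cdot> c = d" using c(5)[OF d(1,2)] by blast
  obtain k where k: "k \<in> Hom C (Tgt C d) (Tgt C c)" "k \<cdot> d = c" using d(5)[OF c(1,2)] by blast
  have "(k \<cdot> h) \<cdot> c = Ident C (Tgt C c) \<cdot> c"
    using comp_assoc[OF c(1) h(1) k(1)] h k comp_ident_left[OF c(1)] by simp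
  then have kh: "k \<cdot> h = Ident C (Tgt C c)"
    by (rule epicD[OF c(3,1) comp_closed[OF h(1) k(1)] ident_closed[OF c(4)]])
  have "(h \<cdot> k) \<cdot> d = Ident C (Tgt C d) \<cdot> d"
    using comp_assoc[OF d(1) k(1) h(1)] h k comp_ident_left[OF d(1)] by simp
  then have "h \<cdot> k = Ident C (Tgt C d)"
    by (rule epicD[OF d(3,1) comp_closed[OF k(1) h(1)] ident_closed[OF d(4)]])
  then show thesis using that[OF h(1) isomorphismI[OF h(1) k(1) kh] h(2)] by blast
qed

lemma kernel_unique:
  assumes "g \<in> Hom C X Y" "is_kernel C g k" "is_kernel C g l"
  obtains h where "h \<in> Hom C (Src C l) (Src C k)" "isomorphism C h" "k \<cdot> h = l"
  by (rule abelian_category.cokernel_unique[OF abelian_op, of g Y X k l, simplified, OF assms])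
    (rule that)

text \<open>
  The idempotent \<open>1 - i r\<close> kills \<open>i\<close>, so it factors through \<open>p\<close>, and the other factor is the
  section.
\<close>

lemma retraction_section:
  assumes "short_exact C i p" "i \<in> Hom C X M" "p \<in> Hom C M Y" "r \<in> Hom C M X" "r \<cdot> i = Ident C X"
  obtains s where "s \<in> Hom C Y M" "p \<cdot> s = Ident C Y"
proof -
  note s = short_exactD[OF assms(1-3)]
  have M: "M \<in> Obj C" "Y \<in> Obj C" using HomD[OF assms(3)] by auto
  note ir = comp_closed[OF assms(4,2)] and iM = ident_closed[OF M(1)]
  have "diff (Ident C M) (i \<cdot> r) \<cdot> i = diff i ((i \<cdot> r) \<cdot> i)"
    using comp_diff_left[OF assms(2) iM ir] comp_ident_left[OF assms(2)] by simp
  also have "(i \<cdot> r) \<cdot> i = i"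
    using comp_assoc[OF assms(2,4,2)] assms(5) comp_ident_right[OF assms(2)] by simp
  also have "diff i i = Zero C X M" using diff_eq_zero_iff[OF assms(2,2)] by simp
  finally obtain b where b: "b \<in> Hom C Y M" "b \<cdot> p = diff (Ident C M) (i \<cdot> r)"
    using s(7)[OF diff_closed[OF iM ir]] by blast
  have "(p \<cdot> b) \<cdot> p = diff p (p \<cdot> (i \<cdot> r))"
    using comp_assoc[OF assms(3) b(1) assms(3)] b(2) comp_diff_right[OF iM ir assms(3)]
      comp_ident_right[OF assms(3)] by simp
  also have "p \<cdot> (i \<cdot> r) = Zero C M Y"
    using comp_assoc[OF assms(4,2,3)] s(5) comp_zero_left[OF assms(4) M(2)] by simp
  finally have "(p \<cdot> b) \<cdot> p = Ident C Y \<cdot> p" using diff_zero_right[OF assms(3)] comp_ident_left[OF assms(3)] by simp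
  then have "p \<cdot> b = Ident C Y"
    by (rule epicD[OF s(4) assms(3) comp_closed[OF b(1) assms(3)] ident_closed[OF M(2)]])
  then show thesis using that b(1) by blast
qed

lemma section_retraction:
  assumes "short_exact C i p" "i \<in> Hom C X M" "p \<in> Hom C M Y" "s \<in> Hom C Y M" "p \<cdot> s = Ident C Y"
  obtains r where "r \<in> Hom C M X" "r \<cdot> i = Ident C X"
  by (rule abelian_category.retraction_section[OF abelian_op, of p i Y M X s, simplified, OF assms(1,3,2,4,5)])
    (rule that)

lemma short_exact_iso_left:
  assumes "short_exact C i p" "i \<in> Hom C X M" "p \<in> Hom C M Y" "h \<in> Hom C X' X" "isomorphism C h"
  shows "short_exact C (i \<cdot> h) p"
proof -
  note s = short_exactD[OF assms(1-3)]
  note ih = comp_closed[OF assms(4,2)]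
  have m: "monic C (i \<cdot> h)" by (rule monic_comp[OF assms(4,2) isomorphism_monic[OF assms(5,4)] s(3)])
  have z: "p \<cdot> (i \<cdot> h) = Zero C X' Y"
    using comp_assoc[OF assms(4,2,3)] s(5) comp_zero_left[OF assms(4) HomD(5)[OF assms(3)]] by simp
  obtain h' where h': "h' \<in> Hom C X X'" "h \<cdot> h' = Ident C X" by (rule isomorphismE[OF assms(5,4)])
  have "is_kernel C p (i \<cdot> h)"
  proof (rule is_kernelI[OF assms(3) ih z m])
    fix Z a assume a: "a \<in> Hom C Z M" "p \<cdot> a = Zero C Z Y"
    obtain b where b: "b \<in> Hom C Z X" "i \<cdot> b = a" using s(6)[OF a] by blast
    have "(i \<cdot> h) \<cdot> (h' \<cdot> b) = a"
      using comp_assoc[OF comp_closed[OF b(1) h'(1)] assms(4,2)] comp_assoc[OF b(1) h'(1) assms(4)]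
        h'(2) comp_ident_left[OF b(1)] b(2) by simp
    then show "\<exists>b \<in> Hom C Z X'. (i \<cdot> h) \<cdot> b = a" using comp_closed[OF b(1) h'(1)] by blast
  qed
  then show ?thesis by (rule normal_epic[OF s(4) assms(3)])
qed

lemma short_exact_iso_right:
  assumes "short_exact C i p" "i \<in> Hom C X M" "p \<in> Hom C M Y" "h \<in> Hom C Y Y'" "isomorphism C h"
  shows "short_exact C i (h \<cdot> p)"
  using abelian_category.short_exact_iso_left[OF abelian_op, of p i Y M X h Y'] assms by simp

lemma biproduct_copair:
  assumes "is_biproduct C A B P i j p q"
  shows "x \<in> Hom C A Y \<Longrightarrow> y \<in> Hom C B Y \<Longrightarrow> \<exists>w \<in> Hom C P Y. w \<cdot> i = x \<and> w \<cdot> j = y"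
    and "z \<in> Hom C P Y \<Longrightarrow> w \<in> Hom C P Y \<Longrightarrow> z \<cdot> i = w \<cdot> i \<Longrightarrow> z \<cdot> j = w \<cdot> j \<Longrightarrow> z = w"
proof -
  have h: "i \<in> Hom C A P" "j \<in> Hom C B P" "p \<in> Hom C P A" "q \<in> Hom C P B"
    and e: "p \<cdot> i = Ident C A" "q \<cdot> j = Ident C B" "q \<cdot> i = Zero C A B" "p \<cdot> j = Zero C B A"
      "Add C (i \<cdot> p) (j \<cdot> q) = Ident C P"
    using assms by (auto simp: is_biproduct_def)
  show "\<exists>w \<in> Hom C P Y. w \<cdot> i = x \<and> w \<cdot> j = y" if x: "x \<in> Hom C A Y" and y: "y \<in> Hom C B Y"
  proof -
    note xp = comp_closed[OF h(3) x] and yq = comp_closed[OF h(4) y]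
    have "Add C (x \<cdot> p) (y \<cdot> q) \<cdot> i = x"
      using comp_add_left[OF h(1) xp yq] comp_assoc[OF h(1,3) x] comp_assoc[OF h(1,4) y] e
        comp_ident_right[OF x] comp_zero_right[OF y HomD(4)[OF x]] add_zero[OF x] by simp
    moreover have "Add C (x \<cdot> p) (y \<cdot> q) \<cdot> j = y"
      using comp_add_left[OF h(2) xp yq] comp_assoc[OF h(2,3) x] comp_assoc[OF h(2,4) y] e
        comp_ident_right[OF y] comp_zero_right[OF x HomD(4)[OF y]] add_zero[OF y] by simp
    ultimately show ?thesis using add_closed[OF xp yq] by blast
  qed
  show "z = w" if z: "z \<in> Hom C P Y" and w: "w \<in> Hom C P Y" and zw: "z \<cdot> i = w \<cdot> i" "z \<cdot> j = w \<cdot> j"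
  proof -
    note ip = comp_closed[OF h(3,1)] and jq = comp_closed[OF h(4,2)]
    have "z = Add C (z \<cdot> (i \<cdot> p)) (z \<cdot> (j \<cdot> q))"
      using comp_add_right[OF ip jq z] e comp_ident_right[OF z] by simp
    also have "\<dots> = Add C (w \<cdot> (i \<cdot> p)) (w \<cdot> (j \<cdot> q))"
      using comp_assoc[OF h(3,1) z] comp_assoc[OF h(4,2) z] comp_assoc[OF h(3,1) w]
        comp_assoc[OF h(4,2) w] zw by simp
    also have "\<dots> = w"
      using comp_add_right[OF ip jq w] e comp_ident_right[OF w] by simp
    finally show ?thesis .
  qed
qed

lemma biproduct_pair:
  assumes "is_biproduct C A B P i j p q" "x \<in> Hom C Y A" "y \<in> Hom C Y B"
  shows "\<exists>w \<in> Hom C Y P. p \<cdot> w = x \<and> q \<cdot> w = y"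
  using abelian_category.biproduct_copair(1)[OF abelian_op, of A B P p q i j x Y y] assms by simp

lemma biproduct_short_exact:
  assumes "is_biproduct C A B P i j p q"
  shows "short_exact C i q" "i \<in> Hom C A P" "q \<in> Hom C P B"
proof -
  have h: "i \<in> Hom C A P" "j \<in> Hom C B P" "p \<in> Hom C P A" "q \<in> Hom C P B"
    and e: "p \<cdot> i = Ident C A" "q \<cdot> j = Ident C B" "q \<cdot> i = Zero C A B"
    using assms by (auto simp: is_biproduct_def)
  have A: "A \<in> Obj C" "B \<in> Obj C" using HomD[OF h(1)] HomD[OF h(2)] by auto
  have m: "monic C i"
    by (rule monic_factor[OF h(1,3)]) (simp add: e isomorphism_monic[OF isomorphism_ident ident_closed] A)
  have ep: "epic C q"
    by (rule epic_factor[OF h(2,4)]) (simp add: e isomorphism_epic[OF isomorphism_ident ident_closed] A)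
  have "is_cokernel C i q"
  proof (rule is_cokernelI[OF h(1,4) e(3) ep])
    fix Z a assume a: "a \<in> Hom C P Z" "a \<cdot> i = Zero C A Z"
    note Z = HomD(5)[OF a(1)] and aj = comp_closed[OF h(2) a(1)]
    have "((a \<cdot> j) \<cdot> q) \<cdot> i = a \<cdot> i"
      using comp_assoc[OF h(1,4) aj] e(3) comp_zero_right[OF aj A(1)] a(2) by simp
    moreover have "((a \<cdot> j) \<cdot> q) \<cdot> j = a \<cdot> j"
      using comp_assoc[OF h(2,4) aj] e(2) comp_ident_right[OF aj] by simp
    ultimately have "(a \<cdot> j) \<cdot> q = a"
      by (rule biproduct_copair(2)[OF assms comp_closed[OF h(4) aj] a(1)])
    then show "\<exists>b \<in> Hom C B Z. b \<cdot> q = a" using aj by blast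
  qed
  then show "short_exact C i q" by (rule normal_monic[OF m h(1)])
qed (use assms in \<open>auto simp: is_biproduct_def\<close>)

text \<open>
  The pushout is the cokernel of \<open>(k, - g) : K \<rightarrow> V \<oplus> B\<close>. This map is monic because \<open>k\<close> is, hence
  it is the kernel of its cokernel; injectivity of \<open>k'\<close> (and of \<open>g'\<close> when \<open>g\<close> is monic) is read
  off from this. The pushout square identifies the cokernel of \<open>k'\<close> with that of \<open>k\<close>, and the
  cokernel of \<open>g'\<close> with that of \<open>g\<close>.
\<close>

lemma pushout_short_exact:
  assumes "short_exact C k q" "k \<in> Hom C K V" "q \<in> Hom C V X" "g \<in> Hom C K B"
  obtains Z k' q' g' where "k' \<in> Hom C B Z" "q' \<in> Hom C Z X" "g' \<in> Hom C V Z"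
    "short_exact C k' q'" "g' \<cdot> k = k' \<cdot> g" "q' \<cdot> g' = q"
    "\<And>Y z w. z \<in> Hom C Z Y \<Longrightarrow> w \<in> Hom C Z Y \<Longrightarrow> z \<cdot> g' = w \<cdot> g' \<Longrightarrow> z \<cdot> k' = w \<cdot> k' \<Longrightarrow> z = w"
    "epic C g \<Longrightarrow> epic C g'"
    "\<And>c D. monic C g \<Longrightarrow> c \<in> Hom C B D \<Longrightarrow> is_cokernel C g c \<Longrightarrow>
       \<exists>c' \<in> Hom C Z D. short_exact C g' c'"
proof -
  note s = short_exactD[OF assms(1-3)]
  have V: "V \<in> Obj C" and B: "B \<in> Obj C" and K: "K \<in> Obj C" and X: "X \<in> Obj C"
    using HomD[OF assms(2)] HomD[OF assms(3)] HomD[OF assms(4)] by auto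
  obtain P i j p r where bp: "is_biproduct C V B P i j p r" using ex_biproduct[OF V B] by blast
  then have h: "i \<in> Hom C V P" "j \<in> Hom C B P" "p \<in> Hom C P V" "r \<in> Hom C P B"
    and e: "p \<cdot> i = Ident C V" "r \<cdot> j = Ident C B" "r \<cdot> i = Zero C V B" "p \<cdot> j = Zero C B V"
    by (auto simp: is_biproduct_def)
  define d where "d = diff (i \<cdot> k) (j \<cdot> g)"
  note ik = comp_closed[OF assms(2) h(1)] and jg = comp_closed[OF assms(4) h(2)]
  have d: "d \<in> Hom C K P" unfolding d_def by (rule diff_closed[OF ik jg])
  have pd: "p \<cdot> d = k"
    unfolding d_def using comp_diff_right[OF ik jg h(3)] comp_assoc[OF assms(2) h(1,3)]
      comp_assoc[OF assms(4) h(2,3)] e comp_ident_left[OF assms(2)] comp_zero_left[OF assms(4) V]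
      diff_zero_right[OF assms(2)] by simp
  have md: "monic C d" by (rule monic_factor[OF d h(3)]) (simp add: pd s)
  have rd: "r \<cdot> d = diff (Zero C K B) g"
    unfolding d_def using comp_diff_right[OF ik jg h(4)] comp_assoc[OF assms(2) h(1,4)]
      comp_assoc[OF assms(4) h(2,4)] e comp_ident_left[OF assms(4)] comp_zero_left[OF assms(2) B] by simp
  obtain c Z where c: "c \<in> Hom C P Z" "short_exact C d c" by (rule monic_short_exact[OF md d])
  note cD = short_exactD[OF c(2) d c(1)]
  have Z: "Z \<in> Obj C" using HomD[OF c(1)] by auto
  define g' where "g' = c \<cdot> i"
  define k' where "k' = c \<cdot> j"
  have g': "g' \<in> Hom C V Z" unfolding g'_def by (rule comp_closed[OF h(1) c(1)])
  have k': "k' \<in> Hom C B Z" unfolding k'_def by (rule comp_closed[OF h(2) c(1)])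
  have gk: "g' \<cdot> k = k' \<cdot> g"
    using cD(5) comp_diff_right[OF ik jg c(1)] comp_assoc[OF assms(2) h(1) c(1)]
      comp_assoc[OF assms(4) h(2) c(1)] diff_eq_zero_iff[OF comp_closed[OF ik c(1)] comp_closed[OF jg c(1)]]
    unfolding d_def g'_def k'_def by simp
  have univ: "\<exists>z \<in> Hom C Z Y. z \<cdot> g' = x \<and> z \<cdot> k' = y"
    if x: "x \<in> Hom C V Y" and y: "y \<in> Hom C B Y" and xy: "x \<cdot> k = y \<cdot> g" for x y Y
  proof -
    obtain w where w: "w \<in> Hom C P Y" "w \<cdot> i = x" "w \<cdot> j = y"
      using biproduct_copair(1)[OF bp x y] by blast
    have "w \<cdot> d = diff (x \<cdot> k) (y \<cdot> g)"
      unfolding d_def using comp_diff_right[OF ik jg w(1)] comp_assoc[OF assms(2) h(1) w(1)]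
        comp_assoc[OF assms(4) h(2) w(1)] w by simp
    then have "w \<cdot> d = Zero C K Y"
      using diff_eq_zero_iff[OF comp_closed[OF assms(2) x] comp_closed[OF assms(4) y]] xy by simp
    then obtain z where z: "z \<in> Hom C Z Y" "z \<cdot> c = w" using cD(7)[OF w(1)] by blast
    have "z \<cdot> g' = x" "z \<cdot> k' = y"
      using comp_assoc[OF h(1) c(1) z(1)] comp_assoc[OF h(2) c(1) z(1)] z w unfolding g'_def k'_def by auto
    then show ?thesis using z by blast
  qed
  have joint: "z = w" if z: "z \<in> Hom C Z Y" and w: "w \<in> Hom C Z Y"
    and zw: "z \<cdot> g' = w \<cdot> g'" "z \<cdot> k' = w \<cdot> k'" for Y z w
  proof -
    have "z \<cdot> c = w \<cdot> c"
      by (rule biproduct_copair(2)[OF bp comp_closed[OF c(1) z] comp_closed[OF c(1) w]])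
        (use zw comp_assoc[OF h(1) c(1) z] comp_assoc[OF h(2) c(1) z] comp_assoc[OF h(1) c(1) w]
          comp_assoc[OF h(2) c(1) w] in \<open>simp_all add: g'_def k'_def\<close>)
    then show ?thesis by (rule epicD[OF cD(4) c(1) z w])
  qed
  have mk': "monic C k'"
  proof (rule monic_zeroI[OF k'])
    fix Y a assume a: "a \<in> Hom C Y B" "k' \<cdot> a = Zero C Y Z"
    note ja = comp_closed[OF a(1) h(2)]
    have "c \<cdot> (j \<cdot> a) = Zero C Y Z" using a(2) comp_assoc[OF a(1) h(2) c(1)] by (simp add: k'_def)
    then obtain b where b: "b \<in> Hom C Y K" "d \<cdot> b = j \<cdot> a" using cD(6)[OF ja] by blast
    have "k \<cdot> b = p \<cdot> (j \<cdot> a)" using comp_assoc[OF b(1) d h(3)] pd b(2) by simp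
    also have "\<dots> = Zero C Y V" using comp_assoc[OF a(1) h(2,3)] e comp_zero_left[OF a(1) V] by simp
    finally have "b = Zero C Y K" by (rule monic_zeroD[OF s(3) assms(2) b(1)])
    then have "j \<cdot> a = Zero C Y P" using b(2) comp_zero_right[OF d HomD(4)[OF a(1)]] by simp
    then have "r \<cdot> (j \<cdot> a) = Zero C Y B" using comp_zero_right[OF h(4) HomD(4)[OF a(1)]] by simp
    then show "a = Zero C Y B" using comp_assoc[OF a(1) h(2,4)] e comp_ident_left[OF a(1)] by simp
  qed
  have "q \<cdot> k = Zero C B X \<cdot> g" using s(5) comp_zero_left[OF assms(4) X] by simp
  then obtain q' where q': "q' \<in> Hom C Z X" "q' \<cdot> g' = q" "q' \<cdot> k' = Zero C B X"
    using univ[OF assms(3) zero_closed[OF B X]] by blast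
  have "epic C q'" by (rule epic_factor[OF g' q'(1)]) (simp add: q' s)
  then have "is_cokernel C k' q'"
  proof (intro is_cokernelI[OF k' q'(1,3)])
    fix Y a assume a: "a \<in> Hom C Z Y" "a \<cdot> k' = Zero C B Y"
    note Y = HomD(5)[OF a(1)] and ag = comp_closed[OF g' a(1)]
    have "(a \<cdot> g') \<cdot> k = (a \<cdot> k') \<cdot> g"
      using comp_assoc[OF assms(2) g' a(1)] comp_assoc[OF assms(4) k' a(1)] gk by simp
    then have "(a \<cdot> g') \<cdot> k = Zero C K Y" using a(2) comp_zero_left[OF assms(4) Y] by simp
    then obtain b where b: "b \<in> Hom C X Y" "b \<cdot> q = a \<cdot> g'" using s(7)[OF ag] by blast
    have "b \<cdot> q' = a"
      by (rule joint[OF comp_closed[OF q'(1) b(1)] a(1)])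
        (use comp_assoc[OF g' q'(1) b(1)] comp_assoc[OF k' q'(1) b(1)] b q' a
          comp_zero_right[OF b(1) B] in simp_all)
    then show "\<exists>b \<in> Hom C X Y. b \<cdot> q' = a" using b by blast
  qed
  then have sx: "short_exact C k' q'" by (rule normal_monic[OF mk' k'])
  have ep: "epic C g'" if g: "epic C g"
  proof (rule epic_zeroI[OF g'])
    fix Y a assume a: "a \<in> Hom C Z Y" "a \<cdot> g' = Zero C V Y"
    note Y = HomD(5)[OF a(1)]
    have "(a \<cdot> k') \<cdot> g = (a \<cdot> g') \<cdot> k"
      using comp_assoc[OF assms(2) g' a(1)] comp_assoc[OF assms(4) k' a(1)] gk by simp
    then have "(a \<cdot> k') \<cdot> g = Zero C K Y" using a(2) comp_zero_left[OF assms(2) Y] by simp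
    then have "a \<cdot> k' = Zero C B Y" by (rule epic_zeroD[OF g assms(4) comp_closed[OF k' a(1)]])
    then show "a = Zero C Z Y"
      by (intro joint[OF a(1) zero_closed[OF Z Y]])
        (use a comp_zero_left[OF g' Y] comp_zero_left[OF k' Y] in simp_all)
  qed
  have mono: "\<exists>c' \<in> Hom C Z D. short_exact C g' c'"
    if g: "monic C g" and f: "f \<in> Hom C B D" "is_cokernel C g f" for f D
  proof -
    have D: "D \<in> Obj C" "Tgt C f = D" using HomD[OF f(1)] by auto
    note fD = cokernelD[OF f(2) assms(4), unfolded D(2)]
    have mg: "monic C g'"
    proof (rule monic_zeroI[OF g'])
      fix Y a assume a: "a \<in> Hom C Y V" "g' \<cdot> a = Zero C Y Z"
      note ia = comp_closed[OF a(1) h(1)] and Y = HomD(4)[OF a(1)]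
      have "c \<cdot> (i \<cdot> a) = Zero C Y Z" using a(2) comp_assoc[OF a(1) h(1) c(1)] by (simp add: g'_def)
      then obtain b where b: "b \<in> Hom C Y K" "d \<cdot> b = i \<cdot> a" using cD(6)[OF ia] by blast
      have gb: "g \<cdot> b \<in> Hom C Y B" by (rule comp_closed[OF b(1) assms(4)])
      have "diff (Zero C Y B) (g \<cdot> b) = (r \<cdot> d) \<cdot> b"
        unfolding rd using comp_diff_left[OF b(1) zero_closed[OF K B] assms(4)]
          comp_zero_left[OF b(1) B] by simp
      also have "\<dots> = r \<cdot> (i \<cdot> a)" using comp_assoc[OF b(1) d h(4)] b(2) by simp
      also have "\<dots> = Zero C Y B" using comp_assoc[OF a(1) h(1,4)] e comp_zero_left[OF a(1) B] by simp
      finally have "g \<cdot> b = Zero C Y B" using diff_eq_zero_iff[OF zero_closed[OF Y B] gb] by simp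
      then have "b = Zero C Y K" by (rule monic_zeroD[OF g assms(4) b(1)])
      then have "i \<cdot> a = Zero C Y P" using b(2) comp_zero_right[OF d Y] by simp
      then have "p \<cdot> (i \<cdot> a) = Zero C Y V" using comp_zero_right[OF h(3) Y] by simp
      then show "a = Zero C Y V" using comp_assoc[OF a(1) h(1,3)] e comp_ident_left[OF a(1)] by simp
    qed
    have "Zero C V D \<cdot> k = f \<cdot> g" using fD(2) comp_zero_left[OF assms(2) D(1)] by simp
    then obtain f' where f': "f' \<in> Hom C Z D" "f' \<cdot> g' = Zero C V D" "f' \<cdot> k' = f"
      using univ[OF zero_closed[OF V D(1)] f(1)] by blast
    have "epic C f'" by (rule epic_factor[OF k' f'(1)]) (simp add: f' fD)
    then have "is_cokernel C g' f'"
    proof (intro is_cokernelI[OF g' f'(1,2)])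
      fix Y a assume a: "a \<in> Hom C Z Y" "a \<cdot> g' = Zero C V Y"
      note Y = HomD(5)[OF a(1)] and ak = comp_closed[OF k' a(1)]
      have "(a \<cdot> k') \<cdot> g = (a \<cdot> g') \<cdot> k"
        using comp_assoc[OF assms(2) g' a(1)] comp_assoc[OF assms(4) k' a(1)] gk by simp
      then have "(a \<cdot> k') \<cdot> g = Zero C K Y" using a(2) comp_zero_left[OF assms(2) Y] by simp
      then obtain b where b: "b \<in> Hom C D Y" "b \<cdot> f = a \<cdot> k'" using fD(5)[OF ak] by blast
      have "b \<cdot> f' = a"
        by (rule joint[OF comp_closed[OF f'(1) b(1)] a(1)])
          (use comp_assoc[OF g' f'(1) b(1)] comp_assoc[OF k' f'(1) b(1)] b f' a
            comp_zero_right[OF b(1) V] in simp_all)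
      then show "\<exists>b \<in> Hom C D Y. b \<cdot> f' = a" using b by blast
    qed
    then show ?thesis using normal_monic[OF mg g'] f'(1) by blast
  qed
  show thesis by (rule that[OF k' q'(1) g' sx gk q'(2) joint ep mono])
qed

lemma pullback_short_exact:
  assumes "short_exact C i p" "i \<in> Hom C X M" "p \<in> Hom C M Y" "g \<in> Hom C B Y"
  obtains Z i' p' g' where "i' \<in> Hom C X Z" "p' \<in> Hom C Z B" "g' \<in> Hom C Z M"
    "short_exact C i' p'" "p \<cdot> g' = g \<cdot> p'" "g' \<cdot> i' = i"
    "\<And>A z w. z \<in> Hom C A Z \<Longrightarrow> w \<in> Hom C A Z \<Longrightarrow> g' \<cdot> z = g' \<cdot> w \<Longrightarrow> p' \<cdot> z = p' \<cdot> w \<Longrightarrow> z = w"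
    "monic C g \<Longrightarrow> monic C g'"
    "\<And>k D. epic C g \<Longrightarrow> k \<in> Hom C D B \<Longrightarrow> is_kernel C g k \<Longrightarrow>
       \<exists>k' \<in> Hom C D Z. short_exact C k' g'"
proof (rule abelian_category.pushout_short_exact[OF abelian_op, of p i Y M X g B])
qed (use assms that in \<open>simp_all\<close>)

end

section \<open>Length\<close>

text \<open>
  A composition series of length \<open>n\<close>, in a form that supports induction.
\<close>

inductive filtered :: "('o, 'm, 'x) preadditive_scheme \<Rightarrow> nat \<Rightarrow> 'o \<Rightarrow> bool" for C where
  filtered_zero: "zero_object C Z \<Longrightarrow> filtered C 0 Z"
| filtered_step: "filtered C n X \<Longrightarrow> i \<in> Hom C X M \<Longrightarrow> c \<in> Hom C M S \<Longrightarrow> short_exact C i c \<Longrightarrow>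
    simple_object C S \<Longrightarrow> filtered C (Suc n) M"

context abelian_category
begin

lemma zero_object_monic_iso:
  assumes "monic C m" "m \<in> Hom C X Y" "zero_object C Y"
  shows "isomorphism C m" "zero_object C X"
proof -
  have "epic C m"
    by (rule epic_zeroI[OF assms(2)]) (rule from_zero_object[OF assms(3)])
  then show "isomorphism C m" by (rule balanced[OF assms(1) _ assms(2)])
  show "zero_object C X" by (rule zero_monic_source[OF assms(1,2) to_zero_object[OF assms(3,2)]])
qed

lemma zero_object_epic_iso:
  assumes "epic C e" "e \<in> Hom C X Y" "zero_object C X"
  shows "isomorphism C e" "zero_object C Y"
  using abelian_category.zero_object_monic_iso[OF abelian_op, of e Y X] assms by simp_all

lemma simple_target:
  assumes "simple_object C S" "g \<in> Hom C X S"
  shows "g = Zero C X S \<or> epic C g"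
proof -
  obtain I e m where g: "e \<in> Hom C X I" "m \<in> Hom C I S" "epic C e" "monic C m" "m \<cdot> e = g"
    by (rule image_factorization[OF assms(2)])
  have "zero_object C I \<or> isomorphism C m"
    using assms(1) g(4) HomD[OF g(2)] unfolding simple_object_def by blast
  then show ?thesis
  proof
    assume "zero_object C I"
    then have "g = Zero C X S"
      using to_zero_object[OF _ g(1)] comp_zero_right[OF g(2) HomD(4)[OF g(1)]] g(5) by simp
    then show ?thesis ..
  next
    assume "isomorphism C m"
    then show ?thesis using epic_comp[OF g(1,2,3) isomorphism_epic[OF _ g(2)]] g(5) by simp
  qed
qed

lemma simple_epic_source:
  assumes "simple_object C S" "epic C g" "g \<in> Hom C S R"
  shows "zero_object C R \<or> isomorphism C g"
proof -
  obtain k K where k: "k \<in> Hom C K S" "short_exact C k g" by (rule epic_short_exact[OF assms(2,3)])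
  note s = short_exactD[OF k(2,1) assms(3)]
  have "zero_object C K \<or> isomorphism C k"
    using assms(1) s(3) HomD[OF k(1)] unfolding simple_object_def by blast
  then show ?thesis
  proof
    assume "zero_object C K"
    then have "monic C g" using kernel_zero_monic[OF s(1) assms(3)] HomD(2)[OF k(1)] by simp
    then show ?thesis using balanced[OF _ assms(2,3)] by blast
  next
    assume "isomorphism C k"
    then have "g = Zero C S R"
      using epic_zeroD[OF isomorphism_epic[OF _ k(1)] k(1) assms(3) s(5)] by blast
    then show ?thesis using zero_epic_target[OF assms(2,3)] by blast
  qed
qed

lemma composition_series_filtered:
  assumes "has_composition_series C M"
  obtains n where "filtered C n M"
proof -
  obtain n X i where X: "zero_object C (X 0)" "X n = M"
    and step: "\<And>k. k < n \<Longrightarrow> i k \<in> Hom C (X k) (X (Suc k)) \<and> monic C (i k) \<and>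
      (\<exists>c. is_cokernel C (i k) c \<and> simple_object C (Tgt C c))"
    using assms unfolding has_composition_series_def by blast
  have "filtered C k (X k)" if "k \<le> n" for k
    using that
  proof (induction k)
    case 0
    show ?case using X by (simp add: filtered_zero)
  next
    case (Suc k)
    obtain c where c: "is_cokernel C (i k) c" "simple_object C (Tgt C c)"
      and i: "i k \<in> Hom C (X k) (X (Suc k))" "monic C (i k)" using step[of k] Suc.prems by auto
    show ?case
      using filtered_step[OF Suc.IH i(1) cokernelD(1)[OF c(1) i(1)] normal_monic[OF i(2,1) c(1)] c(2)]
        Suc.prems by simp
  qed
  then show thesis using that X(2) by blast
qed

text \<open>
  A series of \<open>M\<close> induces one on a subobject \<open>X\<close>: if \<open>X\<close> dies in the simple quotient \<open>S\<close> it lies in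
  the previous step \<open>A\<close>, and otherwise \<open>X\<close> is an extension of \<open>S\<close> by \<open>X \<inter> A\<close>. No step is lost
  only if \<open>X\<close> contains every step, that is, \<open>X = M\<close>.
\<close>

lemma filtered_subobject:
  assumes "filtered C n M" "m \<in> Hom C X M" "monic C m"
  shows "\<exists>k\<le>n. filtered C k X \<and> (k < n \<or> isomorphism C m)"
  using assms
proof (induction arbitrary: X m rule: filtered.induct)
  case (filtered_zero Z)
  show ?case
    using zero_object_monic_iso[OF filtered_zero(3,2,1)] filtered.filtered_zero[of C X] by auto
next
  case (filtered_step n A i M c S)
  note i = filtered_step.hyps(2) and c = filtered_step.hyps(3) and m = filtered_step.prems(1)
  note s = short_exactD[OF filtered_step.hyps(4) i c]
  note cm = comp_closed[OF m c]
  show ?case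
  proof (cases "c \<cdot> m = Zero C X S")
    case True
    then obtain b where b: "b \<in> Hom C X A" "i \<cdot> b = m" using s(6)[OF m] by blast
    have mb: "monic C b" by (rule monic_factor[OF b(1) i]) (simp add: b filtered_step.prems)
    obtain k where "k \<le> n" "filtered C k X" using filtered_step.IH[OF b(1) mb] by blast
    then show ?thesis by (intro exI[of _ k]) simp
  next
    case False
    then have ecm: "epic C (c \<cdot> m)" using simple_target[OF filtered_step.hyps(5) cm] by blast
    obtain k A' where k: "k \<in> Hom C A' X" "short_exact C k (c \<cdot> m)" by (rule epic_short_exact[OF ecm cm])
    note ks = short_exactD[OF k(2,1) cm]
    note mk = comp_closed[OF k(1) m]
    have "c \<cdot> (m \<cdot> k) = Zero C A' S" using ks(5) comp_assoc[OF k(1) m c] by simp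
    then obtain b where b: "b \<in> Hom C A' A" "i \<cdot> b = m \<cdot> k" using s(6)[OF mk] by blast
    have mb: "monic C b"
      by (rule monic_factor[OF b(1) i]) (simp add: b monic_comp[OF k(1) m ks(3) filtered_step.prems(2)])
    obtain j where j: "j \<le> n" "filtered C j A'" "j < n \<or> isomorphism C b"
      using filtered_step.IH[OF b(1) mb] by blast
    have "isomorphism C m" if "isomorphism C b"
    proof -
      have "epic C m"
      proof (rule epic_zeroI[OF m])
        fix Z h assume h: "h \<in> Hom C M Z" "h \<cdot> m = Zero C X Z"
        note Z = HomD(5)[OF h(1)]
        have "(h \<cdot> i) \<cdot> b = (h \<cdot> m) \<cdot> k"
          using comp_assoc[OF b(1) i h(1)] comp_assoc[OF k(1) m h(1)] b(2) by simp
        then have "(h \<cdot> i) \<cdot> b = Zero C A' Z" using h(2) comp_zero_left[OF k(1) Z] by simp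
        then have "h \<cdot> i = Zero C A Z"
          by (rule epic_zeroD[OF isomorphism_epic[OF that b(1)] b(1) comp_closed[OF i h(1)]])
        then obtain h' where h': "h' \<in> Hom C S Z" "h' \<cdot> c = h" using s(7)[OF h(1)] by blast
        then have "h' \<cdot> (c \<cdot> m) = Zero C X Z" using comp_assoc[OF m c h'(1)] h(2) by simp
        then have "h' = Zero C S Z" by (rule epic_zeroD[OF ecm cm h'(1)])
        then show "h = Zero C M Z" using h'(2) comp_zero_left[OF c Z] by simp
      qed
      then show ?thesis using balanced[OF filtered_step.prems(2) _ m] by blast
    qed
    moreover have "filtered C (Suc j) X"
      by (rule filtered.filtered_step[OF j(2) k(1) cm k(2) filtered_step.hyps(5)])
    ultimately show ?thesis using j by (intro exI[of _ "Suc j"]) auto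
  qed
qed

text \<open>
  A series of \<open>M\<close> induces one on a quotient \<open>Q\<close>: the image \<open>Q'\<close> of the previous step \<open>A\<close> has as
  cokernel a quotient of the simple object \<open>S\<close>, which is \<open>0\<close> or \<open>S\<close>.
\<close>

lemma filtered_quotient:
  assumes "filtered C n M" "e \<in> Hom C M Q" "epic C e"
  shows "\<exists>k\<le>n. filtered C k Q \<and> (k < n \<or> isomorphism C e)"
  using assms
proof (induction arbitrary: Q e rule: filtered.induct)
  case (filtered_zero Z)
  show ?case
    using zero_object_epic_iso[OF filtered_zero(3,2,1)] filtered.filtered_zero[of C Q] by auto
next
  case (filtered_step n A i M c S)
  note i = filtered_step.hyps(2) and c = filtered_step.hyps(3) and e = filtered_step.prems(1)
  note s = short_exactD[OF filtered_step.hyps(4) i c]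
  note ei = comp_closed[OF i e]
  obtain Q' e1 m1 where e1: "e1 \<in> Hom C A Q'" "m1 \<in> Hom C Q' Q" "epic C e1" "monic C m1" "m1 \<cdot> e1 = e \<cdot> i"
    by (rule image_factorization[OF ei])
  obtain d R where d: "d \<in> Hom C Q R" "short_exact C m1 d" by (rule monic_short_exact[OF e1(4,2)])
  note ds = short_exactD[OF d(2) e1(2) d(1)]
  note de = comp_closed[OF e d(1)]
  have "(d \<cdot> e) \<cdot> i = (d \<cdot> m1) \<cdot> e1"
    using comp_assoc[OF i e d(1)] comp_assoc[OF e1(1,2) d(1)] e1(5) by simp
  then have "(d \<cdot> e) \<cdot> i = Zero C A R"
    using ds(5) comp_zero_left[OF e1(1) HomD(5)[OF d(1)]] by simp
  then obtain r where r: "r \<in> Hom C S R" "r \<cdot> c = d \<cdot> e" using s(7)[OF de] by blast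
  have er: "epic C r"
    by (rule epic_factor[OF c r(1)]) (simp add: r epic_comp[OF e d(1) filtered_step.prems(2) ds(4)])
  from simple_epic_source[OF filtered_step.hyps(5) er r(1)] show ?case
  proof
    assume "zero_object C R"
    then have "epic C m1" using cokernel_zero_epic[OF ds(2) e1(2)] HomD(3)[OF d(1)] by simp
    then have eei: "epic C (e \<cdot> i)" using epic_comp[OF e1(1,2,3)] e1(5) by simp
    obtain k where "k \<le> n" "filtered C k Q" using filtered_step.IH[OF ei eei] by blast
    then show ?thesis by (intro exI[of _ k]) simp
  next
    assume ir: "isomorphism C r"
    then obtain r' where r': "r' \<in> Hom C R S" "isomorphism C r'" using isomorphismE[OF ir r(1)] by blast
    obtain j where j: "j \<le> n" "filtered C j Q'" "j < n \<or> isomorphism C e1"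
      using filtered_step.IH[OF e1(1,3)] by blast
    have "filtered C (Suc j) Q"
      by (rule filtered.filtered_step[OF j(2) e1(2) comp_closed[OF d(1) r'(1)]
            short_exact_iso_right[OF d(2) e1(2) d(1) r'] filtered_step.hyps(5)])
    moreover have "isomorphism C e" if "isomorphism C e1"
    proof -
      have "monic C e"
      proof (rule monic_zeroI[OF e])
        fix Z h assume h: "h \<in> Hom C Z M" "e \<cdot> h = Zero C Z Q"
        note Z = HomD(4)[OF h(1)]
        have "r \<cdot> (c \<cdot> h) = d \<cdot> (e \<cdot> h)"
          using comp_assoc[OF h(1) c r(1)] comp_assoc[OF h(1) e d(1)] r(2) by simp
        then have "r \<cdot> (c \<cdot> h) = Zero C Z R" using h(2) comp_zero_right[OF d(1) Z] by simp
        then have "c \<cdot> h = Zero C Z S"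
          by (rule monic_zeroD[OF isomorphism_monic[OF ir r(1)] r(1) comp_closed[OF h(1) c]])
        then obtain b where b: "b \<in> Hom C Z A" "i \<cdot> b = h" using s(6)[OF h(1)] by blast
        have "(m1 \<cdot> e1) \<cdot> b = Zero C Z Q" using comp_assoc[OF b(1) i e] b(2) h(2) e1(5) by simp
        then have "b = Zero C Z A"
          by (rule monic_zeroD[OF monic_comp[OF e1(1,2) isomorphism_monic[OF that e1(1)] e1(4)]
                comp_closed[OF e1(1,2)] b(1)])
        then show "h = Zero C Z M" using b(2) comp_zero_right[OF i Z] by simp
      qed
      then show ?thesis by (rule balanced[OF _ filtered_step.prems(2) e])
    qed
    ultimately show ?thesis using j by (intro exI[of _ "Suc j"]) auto
  qed
qed

end

text \<open>
  Finite length enters through a function, invariant under isomorphism, that drops strictly on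
  proper subobjects and on proper quotients. Unlike the definition by composition series, these
  axioms are visibly self-dual.
\<close>

locale abelian_category_with_length = abelian_category C
  for C :: "('o, 'm, 'x) preadditive_scheme" (structure) +
  fixes len :: "'o \<Rightarrow> nat"
  assumes len_iso: "h \<in> Hom C X Y \<Longrightarrow> isomorphism C h \<Longrightarrow> len X = len Y"
    and len_subobject: "m \<in> Hom C X Y \<Longrightarrow> monic C m \<Longrightarrow> \<not> isomorphism C m \<Longrightarrow> len X < len Y"
    and len_quotient: "e \<in> Hom C X Y \<Longrightarrow> epic C e \<Longrightarrow> \<not> isomorphism C e \<Longrightarrow> len Y < len X"

text \<open>
  The minimal length of a composition series.
\<close>

lemma (in abelian_length_category) length_exists:
  "\<exists>len. abelian_category_with_length C len"
proof
  define len where "len M = (LEAST n. filtered C n M)" for M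
  have fil: "filtered C (len M) M" if "M \<in> Obj C" for M
  proof -
    obtain n where "filtered C n M"
      by (rule composition_series_filtered[OF ex_composition_series[OF \<open>M \<in> Obj C\<close>]])
    then show ?thesis unfolding len_def by (rule LeastI)
  qed
  have le: "len M \<le> k" if "filtered C k M" for M k unfolding len_def by (rule Least_le[of "\<lambda>n. filtered C n M", OF that])
  have mono: "len X \<le> len Y" if m: "m \<in> Hom C X Y" "monic C m" for m X Y
  proof -
    obtain k where "k \<le> len Y" "filtered C k X"
      using filtered_subobject[OF fil[OF HomD(5)[OF m(1)]] m] by blast
    then show ?thesis using le[of k X] by linarith
  qed
  show "abelian_category_with_length C len"
  proof
    fix h X Y assume h: "h \<in> Hom C X Y" "isomorphism C h"
    obtain k where k: "k \<in> Hom C Y X" "isomorphism C k" by (rule isomorphismE[OF h(2,1)])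
    show "len X = len Y"
      using mono[OF h(1) isomorphism_monic[OF h(2,1)]] mono[OF k(1) isomorphism_monic[OF k(2,1)]]
      by simp
  next
    fix m X Y assume m: "m \<in> Hom C X Y" "monic C m" "\<not> isomorphism C m"
    obtain k where "k \<le> len Y" "filtered C k X" "k < len Y"
      using filtered_subobject[OF fil[OF HomD(5)[OF m(1)]] m(1,2)] m(3) by blast
    then show "len X < len Y" using le[of k X] by linarith
  next
    fix e X Y assume e: "e \<in> Hom C X Y" "epic C e" "\<not> isomorphism C e"
    obtain k where "k \<le> len X" "filtered C k Y" "k < len X"
      using filtered_quotient[OF fil[OF HomD(4)[OF e(1)]] e(1,2)] e(3) by blast
    then show "len Y < len X" using le[of k Y] by linarith
  qed
qed

lemma (in abelian_category_with_length) with_length_op: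
  "abelian_category_with_length (opposite C) len"
  by (intro abelian_category_with_length.intro abelian_op abelian_category_with_length_axioms.intro)
    (auto simp: len_subobject len_quotient len_iso)

section \<open>Torsion pairs\<close>

lemma f_simple_opposite [simp]: "f_simple (opposite C) f t B = t_simple C t f B"
  by (simp add: f_simple_def t_simple_def)

lemma t_simple_opposite [simp]: "t_simple (opposite C) f t B = f_simple C t f B"
  by (simp add: f_simple_def t_simple_def)

lemma torsionfree_almost_torsion_opposite [simp]:
  "torsionfree_almost_torsion (opposite C) f t B = torsion_almost_torsionfree C t f B"
  by (simp add: torsionfree_almost_torsion_def torsion_almost_torsionfree_def)

lemma torsion_almost_torsionfree_opposite [simp]:
  "torsion_almost_torsionfree (opposite C) f t B = torsionfree_almost_torsion C t f B"
  by (simp add: torsionfree_almost_torsion_def torsion_almost_torsionfree_def)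

context preadditive_category
begin

lemma subcategory_opposite: "subcategory (opposite C) S \<longleftrightarrow> subcategory C S"
proof -
  have "isomorphic (opposite C) X Y \<longleftrightarrow> isomorphic C X Y" for X Y
    by (rule isomorphic_opposite) unfold_locales
  then show ?thesis by (simp add: subcategory_def)
qed

end

context category
begin

lemma subcategoryD:
  assumes "subcategory C S" "X \<in> S"
  shows "X \<in> Obj C" and "isomorphism C h \<Longrightarrow> h \<in> Hom C X Y \<Longrightarrow> Y \<in> S"
    and "isomorphism C g \<Longrightarrow> g \<in> Hom C Y X \<Longrightarrow> Y \<in> S"
proof -
  show "X \<in> Obj C" using assms unfolding subcategory_def by blast
  have *: "Y \<in> S" if "isomorphic C X Y" "Y \<in> Obj C" for Y
    using assms that unfolding subcategory_def by blast
  show "Y \<in> S" if "isomorphism C h" "h \<in> Hom C X Y"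
    by (rule *[OF isomorphicI[OF that(2,1)] HomD(5)[OF that(2)]])
  show "Y \<in> S" if "isomorphism C g" "g \<in> Hom C Y X"
    by (rule *[OF isomorphic_sym[OF isomorphicI[OF that(2,1)]] HomD(4)[OF that(2)]])
qed

end

context abelian_category
begin

lemma torsion_pair_opposite:
  "torsion_pair (opposite C) f t \<longleftrightarrow> torsion_pair C t f"
  unfolding torsion_pair_def subcategory_opposite by (auto; blast)

lemma torsion_pairD:
  assumes "torsion_pair C t f"
  shows "subcategory C t" "subcategory C f"
    and "T \<in> t \<Longrightarrow> F \<in> f \<Longrightarrow> g \<in> Hom C T F \<Longrightarrow> g = Zero C T F"
  using assms unfolding torsion_pair_def by blast+

lemma torsion_in_Obj: "torsion_pair C t f \<Longrightarrow> X \<in> t \<Longrightarrow> X \<in> Obj C"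
  by (rule subcategoryD(1)[OF torsion_pairD(1)])

lemma torsionfree_in_Obj: "torsion_pair C t f \<Longrightarrow> X \<in> f \<Longrightarrow> X \<in> Obj C"
  by (rule subcategoryD(1)[OF torsion_pairD(2)])

lemma canonical_sequence:
  assumes "torsion_pair C t f" "M \<in> Obj C"
  obtains T F i p where "T \<in> t" "F \<in> f" "i \<in> Hom C T M" "p \<in> Hom C M F" "short_exact C i p"
  using assms unfolding torsion_pair_def by blast

text \<open>
  The torsionfree quotient of \<open>X\<close> vanishes.
\<close>

lemma torsionI:
  assumes "torsion_pair C t f" "X \<in> Obj C"
    and "\<And>F g. F \<in> f \<Longrightarrow> g \<in> Hom C X F \<Longrightarrow> g = Zero C X F"
  shows "X \<in> t"
proof -
  obtain T F i p where c: "T \<in> t" "F \<in> f" "i \<in> Hom C T X" "p \<in> Hom C X F" "short_exact C i p"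
    by (rule canonical_sequence[OF assms(1,2)])
  note s = short_exactD[OF c(5,3,4)]
  have "p = Zero C X F" by (rule assms(3)[OF c(2,4)])
  then have z: "zero_object C F" by (rule zero_epic_target[OF s(4) c(4)])
  have "epic C i" by (rule cokernel_zero_epic[OF s(2) c(3)]) (simp add: HomD(3)[OF c(4)] z)
  then have "isomorphism C i" by (rule balanced[OF s(3) _ c(3)])
  then show ?thesis by (rule subcategoryD(2)[OF torsion_pairD(1)[OF assms(1)] c(1) _ c(3)])
qed

lemma torsionfreeI:
  assumes "torsion_pair C t f" "X \<in> Obj C"
    and "\<And>T g. T \<in> t \<Longrightarrow> g \<in> Hom C T X \<Longrightarrow> g = Zero C T X"
  shows "X \<in> f"
  using abelian_category.torsionI[OF abelian_op, of f t X] assms by (simp add: torsion_pair_opposite)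

lemma torsion_quotient:
  assumes "torsion_pair C t f" "X \<in> t" "e \<in> Hom C X Y" "epic C e"
  shows "Y \<in> t"
proof (rule torsionI[OF assms(1) HomD(5)[OF assms(3)]])
  fix F g assume g: "F \<in> f" "g \<in> Hom C Y F"
  show "g = Zero C Y F"
    by (rule epic_zeroD[OF assms(4,3) g(2)])
      (rule torsion_pairD(3)[OF assms(1,2) g(1) comp_closed[OF assms(3) g(2)]])
qed

lemma torsionfree_subobject:
  assumes "torsion_pair C t f" "Y \<in> f" "m \<in> Hom C X Y" "monic C m"
  shows "X \<in> f"
  using abelian_category.torsion_quotient[OF abelian_op, of f t Y m X] assms
  by (simp add: torsion_pair_opposite)

lemma torsion_extension:
  assumes "torsion_pair C t f" "short_exact C i p" "i \<in> Hom C X M" "p \<in> Hom C M Y" "X \<in> t" "Y \<in> t"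
  shows "M \<in> t"
proof (rule torsionI[OF assms(1) HomD(5)[OF assms(3)]])
  fix F g assume g: "F \<in> f" "g \<in> Hom C M F"
  note s = short_exactD[OF assms(2-4)]
  have "g \<cdot> i = Zero C X F"
    by (rule torsion_pairD(3)[OF assms(1,5) g(1) comp_closed[OF assms(3) g(2)]])
  then obtain b where b: "b \<in> Hom C Y F" "b \<cdot> p = g" using s(7)[OF g(2)] by blast
  then show "g = Zero C M F"
    using torsion_pairD(3)[OF assms(1,6) g(1) b(1)] comp_zero_left[OF assms(4) HomD(5)[OF g(2)]] by simp
qed

lemma torsionfree_extension:
  assumes "torsion_pair C t f" "short_exact C i p" "i \<in> Hom C X M" "p \<in> Hom C M Y" "X \<in> f" "Y \<in> f"
  shows "M \<in> f"
  using abelian_category.torsion_extension[OF abelian_op, of f t p i Y M X] assms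
  by (simp add: torsion_pair_opposite)

lemma torsion_torsionfree_zero:
  assumes "torsion_pair C t f" "X \<in> t" "X \<in> f"
  shows "zero_object C X"
  using torsion_pairD(3)[OF assms] ident_closed torsion_in_Obj[OF assms(1,2)] zero_object_iff by blast

lemma zero_object_torsion:
  assumes "torsion_pair C t f" "zero_object C Z"
  shows "Z \<in> t" "Z \<in> f"
proof -
  have Z: "Z \<in> Obj C" using assms(2) by (simp add: zero_object_def)
  show "Z \<in> t" by (rule torsionI[OF assms(1) Z]) (rule from_zero_object[OF assms(2)])
  show "Z \<in> f" by (rule torsionfreeI[OF assms(1) Z]) (rule to_zero_object[OF assms(2)])
qed

text \<open>
  The image is torsionfree, and if it is a proper quotient of \<open>B\<close> it is torsion as well, hence
  zero.
\<close>

lemma f_simple_source: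
  assumes "torsion_pair C t f" "f_simple C t f B" "F \<in> f" "g \<in> Hom C B F"
  shows "g = Zero C B F \<or> monic C g"
proof -
  obtain I e m where g: "e \<in> Hom C B I" "m \<in> Hom C I F" "epic C e" "monic C m" "m \<cdot> e = g"
    by (rule image_factorization[OF assms(4)])
  have I: "I \<in> f" by (rule torsionfree_subobject[OF assms(1,3) g(2,4)])
  show ?thesis
  proof (cases "isomorphism C e")
    case True
    then show ?thesis using monic_comp[OF g(1,2) isomorphism_monic[OF True g(1)] g(4)] g(5) by simp
  next
    case False
    then have "I \<in> t" using assms(2) g(3) HomD[OF g(1)] unfolding f_simple_def by blast
    then have "zero_object C I" by (rule torsion_torsionfree_zero[OF assms(1) _ I])
    then show ?thesis
      using to_zero_object[OF _ g(1)] comp_zero_right[OF g(2) HomD(4)[OF g(1)]] g(5) by simp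
  qed
qed

lemma t_simple_target:
  assumes "torsion_pair C t f" "t_simple C t f B" "T \<in> t" "g \<in> Hom C T B"
  shows "g = Zero C T B \<or> epic C g"
  using abelian_category.f_simple_source[OF abelian_op, of f t B T g] assms
  by (simp add: torsion_pair_opposite)

text \<open>
  For an \<open>f\<close>-simple \<open>B\<close>, a map to \<open>F \<in> f\<close> is zero or monic, and pulling back to the torsion part of
  its cokernel leaves a subobject \<open>F'\<close> of \<open>F\<close> that contains \<open>B\<close> with torsion quotient. So the
  condition on cokernels has to be tested on extensions of a torsion object by \<open>B\<close> only.
\<close>

lemma torsionfree_almost_torsionI:
  assumes tp: "torsion_pair C t f" and B: "f_simple C t f B"
    and ext: "\<And>F T i p. i \<in> Hom C B F \<Longrightarrow> p \<in> Hom C F T \<Longrightarrow> short_exact C i p \<Longrightarrow>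
      F \<in> f \<Longrightarrow> T \<in> t \<Longrightarrow> zero_object C T"
  shows "torsionfree_almost_torsion C t f B"
proof -
  have "Tgt C c \<in> f" if F: "F \<in> f" and g: "g \<in> Hom C B F" and c: "is_cokernel C g c" for F g c
    using f_simple_source[OF tp B F g]
  proof
    assume "g = Zero C B F"
    then show ?thesis
      using cokernel_of_zero[of B F c] c HomD(4,5)[OF g]
        subcategoryD(2)[OF torsion_pairD(2)[OF tp] F] by blast
  next
    assume mg: "monic C g"
    let ?D = "Tgt C c"
    note cD = cokernelD[OF c g]
    obtain T Q x y where x: "T \<in> t" "Q \<in> f" "x \<in> Hom C T ?D" "y \<in> Hom C ?D Q" "short_exact C x y"
      by (rule canonical_sequence[OF tp cD(4)])
    note xs = short_exactD[OF x(5,3,4)]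
    obtain F' i p h where F': "i \<in> Hom C B F'" "p \<in> Hom C F' T" "h \<in> Hom C F' F"
      "short_exact C i p" "monic C x \<Longrightarrow> monic C h"
      by (rule pullback_short_exact[OF normal_monic[OF mg g c] g cD(1) x(3)]) blast
    have "F' \<in> f" by (rule torsionfree_subobject[OF tp F F'(3) F'(5)[OF xs(3)]])
    then have z: "zero_object C T" by (rule ext[OF F'(1,2,4) _ x(1)])
    have "monic C y" by (rule kernel_zero_monic[OF xs(1) x(4)]) (simp add: HomD(2)[OF x(3)] z)
    then show ?thesis by (rule torsionfree_subobject[OF tp x(2,4)])
  qed
  then show ?thesis using B unfolding torsionfree_almost_torsion_def by blast
qed

lemma torsion_almost_torsionfreeI:
  assumes tp: "torsion_pair C t f" and B: "t_simple C t f B"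
    and ext: "\<And>F T i p. i \<in> Hom C F T \<Longrightarrow> p \<in> Hom C T B \<Longrightarrow> short_exact C i p \<Longrightarrow>
      T \<in> t \<Longrightarrow> F \<in> f \<Longrightarrow> zero_object C F"
  shows "torsion_almost_torsionfree C t f B"
  using abelian_category.torsionfree_almost_torsionI[OF abelian_op, of f t B] tp B ext
  by (simp add: torsion_pair_opposite)

lemma torsionfree_almost_torsionD:
  assumes "torsionfree_almost_torsion C t f B"
  shows "f_simple C t f B" "B \<in> f" "\<not> zero_object C B"
    and "F \<in> f \<Longrightarrow> g \<in> Hom C B F \<Longrightarrow> c \<in> Hom C F D \<Longrightarrow> is_cokernel C g c \<Longrightarrow> D \<in> f"
  using assms HomD(3)[of c F D] unfolding torsionfree_almost_torsion_def f_simple_def by blast+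

lemma torsion_almost_torsionfreeD:
  assumes "torsion_almost_torsionfree C t f B"
  shows "t_simple C t f B" "B \<in> t" "\<not> zero_object C B"
    and "T \<in> t \<Longrightarrow> g \<in> Hom C T B \<Longrightarrow> k \<in> Hom C K T \<Longrightarrow> is_kernel C g k \<Longrightarrow> K \<in> t"
  using assms HomD(2)[of k K T] unfolding torsion_almost_torsionfree_def t_simple_def by blast+

lemma t_simple_subobject:
  assumes "t_simple C t f B" "m \<in> Hom C X B" "monic C m" "\<not> isomorphism C m"
  shows "X \<in> f"
  using assms HomD[OF assms(2)] unfolding t_simple_def by blast

lemma f_simple_quotient:
  assumes "f_simple C t f B" "e \<in> Hom C B X" "epic C e" "\<not> isomorphism C e"
  shows "X \<in> t"
  using assms HomD[OF assms(2)] unfolding f_simple_def by blast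

lemma wideD:
  assumes "wide C W"
  shows "subcategory C W"
    and "X \<in> W \<Longrightarrow> Y \<in> W \<Longrightarrow> g \<in> Hom C X Y \<Longrightarrow> k \<in> Hom C K X \<Longrightarrow> is_kernel C g k \<Longrightarrow> K \<in> W"
    and "X \<in> W \<Longrightarrow> Y \<in> W \<Longrightarrow> g \<in> Hom C X Y \<Longrightarrow> c \<in> Hom C Y Q \<Longrightarrow> is_cokernel C g c \<Longrightarrow> Q \<in> W"
proof -
  show "subcategory C W" using assms unfolding wide_def by blast
  have *: "(\<forall>k. is_kernel C g k \<longrightarrow> Src C k \<in> W) \<and> (\<forall>c. is_cokernel C g c \<longrightarrow> Tgt C c \<in> W)"
    if "X \<in> W" "Y \<in> W" "g \<in> Hom C X Y" using assms that unfolding wide_def by blast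
  show "K \<in> W" if "X \<in> W" "Y \<in> W" "g \<in> Hom C X Y" "k \<in> Hom C K X" "is_kernel C g k"
    using *[OF that(1-3)] that(5) HomD(2)[OF that(4)] by blast
  show "Q \<in> W" if "X \<in> W" "Y \<in> W" "g \<in> Hom C X Y" "c \<in> Hom C Y Q" "is_cokernel C g c"
    using *[OF that(1-3)] that(5) HomD(3)[OF that(4)] by blast
qed

lemma wide_opposite: "wide (opposite C) W \<longleftrightarrow> wide C W"
  unfolding wide_def subcategory_opposite by (simp, blast)

end

section \<open>Generation by torsion, almost torsionfree objects\<close>

context abelian_category_with_length
begin

text \<open>
  The pair generated by \<open>S\<close>: \<open>F\<close> is the right orthogonal of \<open>S\<close> and \<open>T\<close> the left orthogonal of \<open>F\<close>.
  A subobject of \<open>M\<close> in \<open>T\<close> of maximal length has its quotient in \<open>F\<close>: the image of a map from an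
  object of \<open>S\<close> to the quotient is in \<open>T\<close>, so its preimage in \<open>M\<close> is a subobject in \<open>T\<close>, and by
  maximality it is not larger.
\<close>

lemma generated_torsion_pair:
  assumes "S \<subseteq> Obj C"
  defines "F \<equiv> {X \<in> Obj C. \<forall>A \<in> S. \<forall>g \<in> Hom C A X. g = Zero C A X}"
  defines "T \<equiv> {X \<in> Obj C. \<forall>A \<in> F. \<forall>g \<in> Hom C X A. g = Zero C X A}"
  shows "torsion_pair C T F" "S \<subseteq> T"
proof -
  have Tq: "Y \<in> T" if "X \<in> T" "e \<in> Hom C X Y" "epic C e" for X Y e
  proof -
    have "g = Zero C Y A" if g: "A \<in> F" "g \<in> Hom C Y A" for g A
      by (rule epic_zeroD[OF \<open>epic C e\<close> \<open>e \<in> Hom C X Y\<close> g(2)])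
        (use \<open>X \<in> T\<close> g comp_closed[OF \<open>e \<in> Hom C X Y\<close> g(2)] in \<open>simp add: T_def\<close>)
    then show ?thesis using HomD(5)[OF that(2)] by (simp add: T_def)
  qed
  have Te: "M \<in> T" if x: "short_exact C i p" "i \<in> Hom C X M" "p \<in> Hom C M Y" "X \<in> T" "Y \<in> T" for i p X M Y
  proof -
    note s = short_exactD[OF x(1-3)]
    have "g = Zero C M A" if g: "A \<in> F" "g \<in> Hom C M A" for g A
    proof -
      have "g \<cdot> i = Zero C X A" using x(4) g comp_closed[OF x(2) g(2)] by (simp add: T_def)
      then obtain b where b: "b \<in> Hom C Y A" "b \<cdot> p = g" using s(7)[OF g(2)] by blast
      have "b = Zero C Y A" using x(5) g(1) b(1) by (simp add: T_def)
      then show ?thesis using b(2) comp_zero_left[OF x(3) HomD(5)[OF g(2)]] by simp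
    qed
    then show ?thesis using HomD(5)[OF x(2)] by (simp add: T_def)
  qed
  have Fs: "X \<in> F" if "Y \<in> F" "m \<in> Hom C X Y" "monic C m" for X Y m
  proof -
    have "g = Zero C A X" if g: "A \<in> S" "g \<in> Hom C A X" for g A
      by (rule monic_zeroD[OF \<open>monic C m\<close> \<open>m \<in> Hom C X Y\<close> g(2)])
        (use \<open>Y \<in> F\<close> g comp_closed[OF g(2) \<open>m \<in> Hom C X Y\<close>] in \<open>simp add: F_def\<close>)
    then show ?thesis using HomD(4)[OF that(2)] by (simp add: F_def)
  qed
  show ST: "S \<subseteq> T" using assms(1) by (auto simp: T_def F_def)
  have sT: "subcategory C T"
  proof -
    have "Y \<in> T" if X: "X \<in> T" and XY: "isomorphic C X Y" for X Y
    proof -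
      obtain h where h: "h \<in> Hom C X Y" "isomorphism C h" using XY by (auto simp: isomorphic_def)
      show ?thesis by (rule Tq[OF X h(1) isomorphism_epic[OF h(2,1)]])
    qed
    moreover have "T \<subseteq> Obj C" by (simp add: T_def)
    ultimately show ?thesis unfolding subcategory_def by blast
  qed
  have sF: "subcategory C F"
  proof -
    have "Y \<in> F" if X: "X \<in> F" and XY: "isomorphic C X Y" for X Y
    proof -
      obtain h where h: "h \<in> Hom C Y X" "isomorphism C h"
        using isomorphic_sym[OF XY] by (auto simp: isomorphic_def)
      show ?thesis by (rule Fs[OF X h(1) isomorphism_monic[OF h(2,1)]])
    qed
    moreover have "F \<subseteq> Obj C" by (simp add: F_def)
    ultimately show ?thesis unfolding subcategory_def by blast
  qed
  have hom: "Hom C X Y = {Zero C X Y}" if "X \<in> T" "Y \<in> F" for X Y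
  proof -
    have "X \<in> Obj C" "Y \<in> Obj C" using that unfolding T_def F_def by blast+
    then have "Zero C X Y \<in> Hom C X Y" by (rule zero_closed)
    moreover have "g = Zero C X Y" if "g \<in> Hom C X Y" for g
      using \<open>X \<in> T\<close> \<open>Y \<in> F\<close> that unfolding T_def by blast
    ultimately show ?thesis by blast
  qed
  have seq: "\<exists>A \<in> T. \<exists>B \<in> F. \<exists>i \<in> Hom C A M. \<exists>p \<in> Hom C M B. short_exact C i p" if M: "M \<in> Obj C" for M
  proof -
    obtain Z where Z: "zero_object C Z" using ex_zero_object by blast
    then have Zo: "Z \<in> Obj C" by (simp add: zero_object_def)
    define P where "P n \<longleftrightarrow> (\<exists>A i. A \<in> T \<and> i \<in> Hom C A M \<and> monic C i \<and> len A = n)" for n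
    have "Z \<in> T" using Zo from_zero_object[OF Z] unfolding T_def by blast
    moreover have "monic C (Zero C Z M)"
      by (rule monic_zeroI[OF zero_closed[OF Zo M]]) (rule to_zero_object[OF Z])
    ultimately have "P (len Z)" using zero_closed[OF Zo M] unfolding P_def by blast
    moreover have bound: "n \<le> len M" if Pn: "P n" for n
    proof -
      obtain A i where A: "A \<in> T" "i \<in> Hom C A M" "monic C i" "len A = n" using Pn P_def by blast
      show ?thesis using len_subobject[OF A(2,3)] len_iso[OF A(2)] A(4) by linarith
    qed
    ultimately obtain n where n: "P n" "\<And>m. P m \<Longrightarrow> m \<le> n"
      using Nat.ex_has_greatest_nat[of P "len Z" "len M"] by blast
    obtain A i where A: "A \<in> T" "i \<in> Hom C A M" "monic C i" "len A = n" using n(1) P_def by blast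
    obtain p B where p: "p \<in> Hom C M B" "short_exact C i p" by (rule monic_short_exact[OF A(3,2)])
    have "B \<in> F"
    proof -
      have "g = Zero C X B" if X: "X \<in> S" and g: "g \<in> Hom C X B" for X g
      proof -
        obtain I e m where I: "e \<in> Hom C X I" "m \<in> Hom C I B" "epic C e" "monic C m" "m \<cdot> e = g"
          by (rule image_factorization[OF g])
        have IT: "I \<in> T" using Tq[OF _ I(1,3)] X ST by blast
        obtain E i' p' h where E: "i' \<in> Hom C A E" "p' \<in> Hom C E I" "h \<in> Hom C E M"
          "short_exact C i' p'" "monic C m \<Longrightarrow> monic C h"
          by (rule pullback_short_exact[OF p(2) A(2) p(1) I(2)]) blast
        note Es = short_exactD[OF E(4,1,2)]
        have "E \<in> T" by (rule Te[OF E(4,1,2) A(1) IT])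
        then have "P (len E)" using E(3) E(5)[OF I(4)] unfolding P_def by blast
        then have "len E \<le> len A" using n(2) A(4) by simp
        then have "isomorphism C i'" using len_subobject[OF E(1) Es(3)] by linarith
        then have "p' = Zero C E I"
          by (rule epic_zeroD[OF isomorphism_epic[OF _ E(1)] E(1,2) Es(5)])
        then have "zero_object C I" by (rule zero_epic_target[OF Es(4) E(2)])
        then show ?thesis
          using to_zero_object[OF _ I(1)] comp_zero_right[OF I(2) HomD(4)[OF I(1)]] I(5) by simp
      qed
      then show ?thesis using HomD(5)[OF p(1)] by (simp add: F_def)
    qed
    then show ?thesis using A(1,2) p by blast
  qed
  show "torsion_pair C T F"
    unfolding torsion_pair_def using sT sF hom seq by blast
qed

text \<open>
  Let \<open>t\<close> be generated by the wide subcategory \<open>W\<close>. Then \<open>f\<close> is the right orthogonal of \<open>W\<close>, so some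
  object of \<open>W\<close> maps non-trivially to \<open>X\<close>. One of least length, \<open>Y\<close>, is a simple object of the abelian
  category \<open>W\<close>, and simple objects of \<open>W\<close> are torsion, almost torsionfree: a map from \<open>W\<close> to
  \<open>Y\<close> is zero or epic, so a proper subobject of \<open>Y\<close> receives no map from \<open>W\<close>; and an
  extension of \<open>Y\<close> by \<open>F \<in> f\<close> that lies in \<open>t\<close> is split by a map from \<open>W\<close>, so that \<open>F\<close> is a quotient
  of a torsion object.
\<close>

lemma generating_torsion_almost_torsionfree:
  assumes "widely_generated C t f" "X \<in> t" "\<not> zero_object C X"
  obtains T h where "torsion_almost_torsionfree C t f T" "h \<in> Hom C T X" "h \<noteq> Zero C T X"
proof -
  have tp: "torsion_pair C t f" using assms(1) by (simp add: widely_generated_def)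
  obtain W where W: "wide C W" "W \<subseteq> t" "\<And>t'. torsion_class C t' \<Longrightarrow> W \<subseteq> t' \<Longrightarrow> t \<subseteq> t'"
    using assms(1) unfolding widely_generated_def by blast
  have WO: "W \<subseteq> Obj C" using W(2) torsion_in_Obj[OF tp] by blast
  have perp: "Z \<in> f" if Z: "Z \<in> Obj C" "\<And>A g. A \<in> W \<Longrightarrow> g \<in> Hom C A Z \<Longrightarrow> g = Zero C A Z" for Z
  proof (rule torsionfreeI[OF tp Z(1)])
    fix A g assume g: "A \<in> t" "g \<in> Hom C A Z"
    note gt = generated_torsion_pair[OF WO]
    have "t \<subseteq> {X \<in> Obj C. \<forall>A \<in> {X \<in> Obj C. \<forall>A \<in> W. \<forall>g \<in> Hom C A X. g = Zero C A X}.
        \<forall>g \<in> Hom C X A. g = Zero C X A}"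
      using W(3)[OF _ gt(2)] gt(1) unfolding torsion_class_def by blast
    then show "g = Zero C A Z" using g Z by blast
  qed
  \<comment> \<open>The objects of \<open>W\<close> that detect that \<open>X\<close> is not torsionfree.\<close>
  define P where "P Y \<longleftrightarrow> Y \<in> W \<and> (\<exists>h \<in> Hom C Y X. h \<noteq> Zero C Y X)" for Y
  have "\<exists>Y. P Y"
  proof (rule ccontr)
    assume "\<not> (\<exists>Y. P Y)"
    then have "X \<in> f" using perp[OF torsion_in_Obj[OF tp assms(2)]] unfolding P_def by blast
    then show False using torsion_torsionfree_zero[OF tp assms(2)] assms(3) by blast
  qed
  then obtain Y where Y: "P Y" "\<And>Y'. P Y' \<Longrightarrow> len Y \<le> len Y'"
    using ex_has_least_nat[of P _ len] by blast
  obtain h where YW: "Y \<in> W" and h: "h \<in> Hom C Y X" "h \<noteq> Zero C Y X" using Y(1) P_def by blast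
  have Yt: "Y \<in> t" using YW W(2) by blast
  have Yo: "Y \<in> Obj C" and Xo: "X \<in> Obj C" using HomD[OF h(1)] by auto
  have Ynz: "\<not> zero_object C Y" using from_zero_object[OF _ h(1)] h(2) by blast
  have sub: "zero_object C A \<or> isomorphism C m" if A: "A \<in> W" and m: "m \<in> Hom C A Y" "monic C m" for A m
  proof (rule disjCI)
    assume n: "\<not> isomorphism C m"
    have "\<not> P A" using len_subobject[OF m n] Y(2)[of A] by auto
    then have hm: "h \<cdot> m = Zero C A X" using comp_closed[OF m(1) h(1)] A unfolding P_def by blast
    obtain c Q where c: "c \<in> Hom C Y Q" "short_exact C m c" by (rule monic_short_exact[OF m(2,1)])
    note s = short_exactD[OF c(2) m(1) c(1)]
    have Q: "Q \<in> W" by (rule wideD(3)[OF W(1) A YW m(1) c(1) s(2)])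
    obtain h' where h': "h' \<in> Hom C Q X" "h' \<cdot> c = h" using s(7)[OF h(1) hm] by blast
    then have "h' \<noteq> Zero C Q X" using h(2) comp_zero_left[OF c(1) Xo] by auto
    then have "P Q" using Q h'(1) unfolding P_def by blast
    then have "isomorphism C c" using len_quotient[OF c(1) s(4)] Y(2)[of Q] by linarith
    then have "m = Zero C A Y" by (rule monic_zeroD[OF isomorphism_monic[OF _ c(1)] c(1) m(1) s(5)])
    then show "zero_object C A" by (rule zero_monic_source[OF m(2,1)])
  qed
  have into: "g = Zero C A Y \<or> epic C g" if A: "A \<in> W" and g: "g \<in> Hom C A Y" for A g
  proof -
    obtain c Q where c: "is_cokernel C g c" "c \<in> Hom C Y Q" by (rule cokernel_exists[OF g])
    note cD = cokernelD[OF c(1) g]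
    have Qt: "Tgt C c = Q" using HomD[OF c(2)] by simp
    have Q: "Q \<in> W" by (rule wideD(3)[OF W(1) A YW g c(2,1)])
    obtain m I where m: "is_kernel C c m" "m \<in> Hom C I Y" by (rule kernel_exists[OF c(2)])
    have It: "Src C m = I" using HomD[OF m(2)] by simp
    note mD = kernelD[OF m(1) c(2)]
    have "I \<in> W" by (rule wideD(2)[OF W(1) YW Q c(2) m(2,1)])
    from sub[OF this m(2) mD(3)] show ?thesis
    proof
      assume z: "zero_object C I"
      obtain b where b: "b \<in> Hom C A I" "m \<cdot> b = g" using mD(5)[OF g] cD(2) It Qt by auto
      then have "g = Zero C A Y"
        using to_zero_object[OF z b(1)] comp_zero_right[OF m(2) HomD(4)[OF g]] by simp
      then show ?thesis ..
    next
      assume "isomorphism C m"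
      then have "c = Zero C Y Q"
        using epic_zeroD[OF isomorphism_epic[OF _ m(2)] m(2) c(2)] mD(2) It by blast
      then have "zero_object C Q" using zero_epic_target[OF cD(3) cD(1)] Qt by simp
      then show ?thesis using cokernel_zero_epic[OF c(1) g] Qt by simp
    qed
  qed
  have ts: "t_simple C t f Y"
  proof -
    have "Src C m \<in> f" if m: "monic C m" "Tgt C m = Y" "\<not> isomorphism C m" for m
    proof -
      have mh: "m \<in> Hom C (Src C m) Y" using m(1,2) by (simp add: monic_def Hom_def)
      show ?thesis
      proof (rule perp[OF HomD(4)[OF mh]])
        fix A g assume g: "A \<in> W" "g \<in> Hom C A (Src C m)"
        have "\<not> epic C (m \<cdot> g)"
          using epic_factor[OF g(2) mh] balanced[OF m(1) _ mh] m(3) by blast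
        then have "m \<cdot> g = Zero C A Y" using into[OF g(1) comp_closed[OF g(2) mh]] by blast
        then show "g = Zero C A (Src C m)" by (rule monic_zeroD[OF m(1) mh g(2)])
      qed
    qed
    then show ?thesis using Yt Ynz by (simp add: t_simple_def)
  qed
  have "torsion_almost_torsionfree C t f Y"
  proof (rule torsion_almost_torsionfreeI[OF tp ts])
    fix F Z i p assume x: "i \<in> Hom C F Z" "p \<in> Hom C Z Y" "short_exact C i p" "Z \<in> t" "F \<in> f"
    note s = short_exactD[OF x(3,1,2)]
    have "\<exists>A w. A \<in> W \<and> w \<in> Hom C A Z \<and> p \<cdot> w \<noteq> Zero C A Y"
    proof (rule ccontr)
      assume *: "\<not> ?thesis"
      have "Z \<in> f"
      proof (rule perp[OF HomD(5)[OF x(1)]])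
        fix A w assume w: "A \<in> W" "w \<in> Hom C A Z"
        then obtain b where b: "b \<in> Hom C A F" "i \<cdot> b = w" using * s(6)[OF w(2)] by blast
        have "b = Zero C A F" using torsion_pairD(3)[OF tp _ x(5) b(1)] w(1) W(2) by blast
        then show "w = Zero C A Z" using b(2) comp_zero_right[OF x(1) HomD(4)[OF w(2)]] by simp
      qed
      then have "zero_object C Z" by (rule torsion_torsionfree_zero[OF tp x(4)])
      then have "zero_object C Y" using zero_object_epic_iso[OF s(4) x(2)] by blast
      then show False using Ynz by blast
    qed
    then obtain A w where w: "A \<in> W" "w \<in> Hom C A Z" "p \<cdot> w \<noteq> Zero C A Y" by blast
    note pw = comp_closed[OF w(2) x(2)]
    have epw: "epic C (p \<cdot> w)" using into[OF w(1) pw] w(3) by blast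
    obtain k K where k: "k \<in> Hom C K A" "short_exact C k (p \<cdot> w)" by (rule epic_short_exact[OF epw pw])
    note ks = short_exactD[OF k(2,1) pw]
    note wk = comp_closed[OF k(1) w(2)]
    have K: "K \<in> W" by (rule wideD(2)[OF W(1) w(1) YW pw k(1) ks(1)])
    have "p \<cdot> (w \<cdot> k) = Zero C K Y" using ks(5) comp_assoc[OF k(1) w(2) x(2)] by simp
    then obtain b where b: "b \<in> Hom C K F" "i \<cdot> b = w \<cdot> k" using s(6)[OF wk] by blast
    have "b = Zero C K F" using torsion_pairD(3)[OF tp _ x(5) b(1)] K W(2) by blast
    then have "w \<cdot> k = Zero C K Z" using b(2) comp_zero_right[OF x(1) HomD(4)[OF k(1)]] by simp
    \<comment> \<open>The kernel of \<open>p w : A \<rightarrow> Y\<close> is in \<open>W \<subseteq> t\<close> and maps to \<open>F\<close> by zero, so \<open>w\<close> descends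
      to a section \<open>r\<close> of \<open>p\<close>.\<close>
    then obtain r where r: "r \<in> Hom C Y Z" "r \<cdot> (p \<cdot> w) = w" using ks(7)[OF w(2)] by blast
    have "(p \<cdot> r) \<cdot> (p \<cdot> w) = Ident C Y \<cdot> (p \<cdot> w)"
      using comp_assoc[OF pw r(1) x(2)] r(2) comp_ident_left[OF pw] by simp
    then have "p \<cdot> r = Ident C Y"
      by (rule epicD[OF epw pw comp_closed[OF r(1) x(2)] ident_closed[OF Yo]])
    then obtain q where q: "q \<in> Hom C Z F" "q \<cdot> i = Ident C F"
      by (rule section_retraction[OF x(3,1,2) r(1)])
    have "q = Zero C Z F" by (rule torsion_pairD(3)[OF tp x(4,5) q(1)])
    then have "Ident C F = Zero C F F" using q(2) comp_zero_left[OF x(1) HomD(5)[OF q(1)]] by simp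
    then show "zero_object C F" using HomD(5)[OF q(1)] zero_object_iff by blast
  qed
  then show thesis using that h by blast
qed

end

section \<open>Envelopes and reflections\<close>

definition reflection ::
    "('o, 'm, 'x) preadditive_scheme \<Rightarrow> 'o set \<Rightarrow> 'o \<Rightarrow> 'm \<Rightarrow> 'o \<Rightarrow> bool" where
  "reflection C W V r P \<longleftrightarrow> r \<in> Hom C V P \<and> P \<in> W \<and>
     (\<forall>Y \<in> W. \<forall>g \<in> Hom C V Y. \<exists>!h. h \<in> Hom C P Y \<and> h \<cdot>\<^bsub>C\<^esub> r = g)"

context abelian_category
begin

lemma reflectionD:
  assumes "reflection C W V r P"
  shows "r \<in> Hom C V P" "P \<in> W"
    and "Y \<in> W \<Longrightarrow> g \<in> Hom C V Y \<Longrightarrow> \<exists>h \<in> Hom C P Y. h \<cdot> r = g"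
    and "Y \<in> W \<Longrightarrow> h \<in> Hom C P Y \<Longrightarrow> h' \<in> Hom C P Y \<Longrightarrow> h \<cdot> r = h' \<cdot> r \<Longrightarrow> h = h'"
proof -
  show r: "r \<in> Hom C V P" and "P \<in> W" using assms by (auto simp: reflection_def)
  have *: "\<exists>!h. h \<in> Hom C P Y \<and> h \<cdot> r = g" if "Y \<in> W" "g \<in> Hom C V Y" for Y g
    using assms that unfolding reflection_def by blast
  show "\<exists>h \<in> Hom C P Y. h \<cdot> r = g" if "Y \<in> W" "g \<in> Hom C V Y" using *[OF that] by blast
  show "h = h'" if "Y \<in> W" "h \<in> Hom C P Y" "h' \<in> Hom C P Y" "h \<cdot> r = h' \<cdot> r"
    using *[OF that(1) comp_closed[OF r that(2)]] that by auto
qed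

lemma reflectionI:
  assumes "r \<in> Hom C V P" "P \<in> W"
    and "\<And>Y g. Y \<in> W \<Longrightarrow> g \<in> Hom C V Y \<Longrightarrow> \<exists>h \<in> Hom C P Y. h \<cdot> r = g"
    and "\<And>Y h. Y \<in> W \<Longrightarrow> h \<in> Hom C P Y \<Longrightarrow> h \<cdot> r = Zero C V Y \<Longrightarrow> h = Zero C P Y"
  shows "reflection C W V r P"
proof -
  have "\<exists>!h. h \<in> Hom C P Y \<and> h \<cdot> r = g" if Y: "Y \<in> W" and g: "g \<in> Hom C V Y" for Y g
  proof (rule ex_ex1I)
    show "\<exists>h. h \<in> Hom C P Y \<and> h \<cdot> r = g" using assms(3)[OF Y g] by blast
    fix h h' assume hh: "h \<in> Hom C P Y \<and> h \<cdot> r = g" "h' \<in> Hom C P Y \<and> h' \<cdot> r = g"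
    then have h: "h \<in> Hom C P Y" and h': "h' \<in> Hom C P Y" by auto
    have "diff h h' \<cdot> r = diff g g" using comp_diff_left[OF assms(1) h h'] hh by simp
    then have "diff h h' \<cdot> r = Zero C V Y" using diff_eq_zero_iff[OF g g] by simp
    then have "diff h h' = Zero C P Y" by (rule assms(4)[OF Y diff_closed[OF h h']])
    then show "h = h'" using diff_eq_zero_iff[OF h h'] by simp
  qed
  then show ?thesis using assms(1,2) unfolding reflection_def by blast
qed

lemma reflection_is_envelope:
  assumes "reflection C W V r P" "P \<in> Obj C"
  shows "is_envelope C W V r"
proof -
  note r = reflectionD[OF assms(1)]
  have "isomorphism C h" if h: "h \<in> Hom C P P" "h \<cdot> r = r" for h
  proof -
    have "h = Ident C P"
      using r(4)[OF r(2) h(1) ident_closed[OF assms(2)]] h(2) comp_ident_left[OF r(1)] by simp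
    then show ?thesis using isomorphism_ident[OF assms(2)] by simp
  qed
  then show ?thesis unfolding is_envelope_def using r(2,3) HomD(1-3)[OF r(1)] by simp
qed

text \<open>
  If \<open>r\<close> is a reflection, any envelope \<open>e\<close> is isomorphic to it: for the comparison maps \<open>h\<close> and
  \<open>k\<close>, the composite \<open>k h\<close> is the identity by uniqueness of factorisations through \<open>r\<close>, and \<open>h k\<close>
  is an automorphism because it fixes \<open>e\<close>.
\<close>

lemma envelope_of_reflective:
  assumes "reflection C W V r P" "is_envelope C W V e"
  obtains h where "h \<in> Hom C P (Tgt C e)" "isomorphism C h" "h \<cdot> r = e" "e \<in> Hom C V (Tgt C e)"
    "Tgt C e \<in> W"
proof -
  note r = reflectionD[OF assms(1)]
  let ?E = "Tgt C e"
  have e: "e \<in> Hom C V ?E" "?E \<in> W" using assms(2) by (auto simp: is_envelope_def Hom_def)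
  have e2: "\<And>Y g. Y \<in> W \<Longrightarrow> g \<in> Hom C V Y \<Longrightarrow> \<exists>h \<in> Hom C ?E Y. h \<cdot> e = g"
    and e3: "\<And>h. h \<in> Hom C ?E ?E \<Longrightarrow> h \<cdot> e = e \<Longrightarrow> isomorphism C h"
    using assms(2) unfolding is_envelope_def by blast+
  have P: "P \<in> Obj C" and E: "?E \<in> Obj C" using HomD(5)[OF r(1)] HomD(5)[OF e(1)] by auto
  obtain h where h: "h \<in> Hom C P ?E" "h \<cdot> r = e" using r(3)[OF e(2,1)] by blast
  obtain k where k: "k \<in> Hom C ?E P" "k \<cdot> e = r" using e2[OF r(2,1)] by blast
  have "(k \<cdot> h) \<cdot> r = Ident C P \<cdot> r"
    using comp_assoc[OF r(1) h(1) k(1)] h k comp_ident_left[OF r(1)] by simp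
  then have kh: "k \<cdot> h = Ident C P"
    by (rule r(4)[OF r(2) comp_closed[OF h(1) k(1)] ident_closed[OF P]])
  have "(h \<cdot> k) \<cdot> e = e" using comp_assoc[OF e(1) k(1) h(1)] h k by simp
  then have hk: "isomorphism C (h \<cdot> k)" by (rule e3[OF comp_closed[OF k(1) h(1)]])
  have "monic C h"
    by (rule monic_factor[OF h(1) k(1)]) (simp add: kh isomorphism_monic[OF isomorphism_ident ident_closed] P)
  moreover have "epic C h"
    by (rule epic_factor[OF k(1) h(1)]) (rule isomorphism_epic[OF hk comp_closed[OF k(1) h(1)]])
  ultimately have "isomorphism C h" by (rule balanced[OF _ _ h(1)])
  then show thesis using that h e by blast
qed

lemma cokernel_after_iso:
  assumes "r \<in> Hom C V P" "h \<in> Hom C P P'" "isomorphism C h" "c \<in> Hom C P' T" "is_cokernel C (h \<cdot> r) c"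
  shows "is_cokernel C r (c \<cdot> h)"
proof -
  note hr = comp_closed[OF assms(1,2)] and ch = comp_closed[OF assms(2,4)]
  have T: "Tgt C c = T" using HomD(3)[OF assms(4)] .
  note c = cokernelD[OF assms(5) hr, unfolded T]
  show ?thesis
  proof (rule is_cokernelI[OF assms(1) ch])
    show "(c \<cdot> h) \<cdot> r = Zero C V T" using comp_assoc[OF assms(1,2,4)] c(2) by simp
    show "epic C (c \<cdot> h)" by (rule epic_comp[OF assms(2,4) isomorphism_epic[OF assms(3,2)] c(3)])
    fix Z a assume a: "a \<in> Hom C P Z" "a \<cdot> r = Zero C V Z"
    obtain k where k: "k \<in> Hom C P' P" "k \<cdot> h = Ident C P" by (rule isomorphismE[OF assms(3,2)])
    note ak = comp_closed[OF k(1) a(1)]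
    have akh: "(a \<cdot> k) \<cdot> h = a" using comp_assoc[OF assms(2) k(1) a(1)] k(2) comp_ident_right[OF a(1)] by simp
    have "(a \<cdot> k) \<cdot> (h \<cdot> r) = Zero C V Z" using comp_assoc[OF assms(1,2) ak] akh a(2) by simp
    then obtain b where b: "b \<in> Hom C T Z" "b \<cdot> c = a \<cdot> k" using c(5)[OF ak] by blast
    have "b \<cdot> (c \<cdot> h) = a" using comp_assoc[OF assms(2,4) b(1)] b(2) akh by simp
    then show "\<exists>b \<in> Hom C T Z. b \<cdot> (c \<cdot> h) = a" using b(1) by blast
  qed
qed

lemma kernel_before_monic:
  assumes "r \<in> Hom C V P" "h \<in> Hom C P P'" "monic C h" "is_kernel C (h \<cdot> r) k"
  shows "is_kernel C r k"
proof -
  note hr = comp_closed[OF assms(1,2)]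
  note k = kernelD[OF assms(4) hr]
  have "h \<cdot> (r \<cdot> k) = Zero C (Src C k) P'" using comp_assoc[OF k(1) assms(1,2)] k(2) by simp
  then have rk: "r \<cdot> k = Zero C (Src C k) P" by (rule monic_zeroD[OF assms(3,2) comp_closed[OF k(1) assms(1)]])
  show ?thesis
  proof (rule is_kernelI[OF assms(1) k(1) rk k(3)])
    fix Z a assume a: "a \<in> Hom C Z V" "r \<cdot> a = Zero C Z P"
    then have "(h \<cdot> r) \<cdot> a = Zero C Z P'"
      using comp_assoc[OF a(1) assms(1,2)] comp_zero_right[OF assms(2) HomD(4)[OF a(1)]] by simp
    then show "\<exists>b \<in> Hom C Z (Src C k). k \<cdot> b = a" by (rule k(5)[OF a(1)])
  qed
qed

end

section \<open>Extensions and reflections in a wide interval\<close>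

text \<open>
  The setting of the theorem, with the two generation hypotheses replaced by the consequences that
  the proof uses. Passing to the opposite category exchanges \<open>t\<close> with \<open>v\<close> and \<open>f\<close> with \<open>u\<close>.
\<close>

locale generated_wide_interval = abelian_category_with_length C len
  for C :: "('o, 'm, 'x) preadditive_scheme" (structure) and len +
  fixes t f u v :: "'o set"
  assumes tp_t: "torsion_pair C t f"
    and tp_u: "torsion_pair C u v"
    and t_sub_u: "t \<subseteq> u"
    and wide_heart: "wide C (u \<inter> f)"
    and generating: "X \<in> t \<Longrightarrow> \<not> zero_object C X \<Longrightarrow>
      \<exists>T h. torsion_almost_torsionfree C t f T \<and> h \<in> Hom C T X \<and> h \<noteq> Zero C T X"
    and cogenerating: "X \<in> v \<Longrightarrow> \<not> zero_object C X \<Longrightarrow>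
      \<exists>V h. torsionfree_almost_torsion C u v V \<and> h \<in> Hom C X V \<and> h \<noteq> Zero C X V"

context generated_wide_interval
begin

abbreviation "W \<equiv> u \<inter> f"

abbreviation "Up_u \<equiv> torsionfree_almost_torsion C u v"
abbreviation "Low_u \<equiv> torsion_almost_torsionfree C u v"
abbreviation "Up_t \<equiv> torsionfree_almost_torsion C t f"
abbreviation "Low_t \<equiv> torsion_almost_torsionfree C t f"

lemma v_sub_f: "v \<subseteq> f"
proof
  fix X assume X: "X \<in> v"
  show "X \<in> f"
    by (rule torsionfreeI[OF tp_t torsionfree_in_Obj[OF tp_u X]])
      (use torsion_pairD(3)[OF tp_u _ X] t_sub_u in blast)
qed

lemma dual: "generated_wide_interval (opposite C) len v u f t"
  by (intro generated_wide_interval.intro with_length_op generated_wide_interval_axioms.intro)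
    (use generating cogenerating in \<open>simp_all add: torsion_pair_opposite wide_opposite tp_t tp_u
      v_sub_f wide_heart Int_commute[of f u]\<close>)

lemma heart_kernel:
  assumes "short_exact C i p" "i \<in> Hom C X M" "p \<in> Hom C M Y" "M \<in> W" "Y \<in> W"
  shows "X \<in> W"
  by (rule wideD(2)[OF wide_heart assms(4,5,3,2) short_exactD(1)[OF assms(1-3)]])

lemma heart_cokernel:
  assumes "short_exact C i p" "i \<in> Hom C X M" "p \<in> Hom C M Y" "X \<in> W" "M \<in> W"
  shows "Y \<in> W"
  by (rule wideD(3)[OF wide_heart assms(4,5,2,3) short_exactD(2)[OF assms(1-3)]])

lemma heart_extension:
  assumes "short_exact C i p" "i \<in> Hom C X M" "p \<in> Hom C M Y" "X \<in> W" "Y \<in> W"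
  shows "M \<in> W"
  using torsion_extension[OF tp_u assms(1-3)] torsionfree_extension[OF tp_t assms(1-3)] assms(4,5) by blast

text \<open>
  Compare \<open>V\<close> with the torsionfree quotient \<open>B\<close> of \<open>Z\<close> for the pair \<open>(u, v)\<close>. The map \<open>V \<rightarrow> B\<close> is zero
  or monic. If it is zero, \<open>B\<close> is a quotient of \<open>X \<in> u\<close>, so \<open>B = 0\<close>. If it is monic, its cokernel
  is in \<open>v\<close> since \<open>V\<close> is almost torsion, but is also a quotient of \<open>X\<close>, so \<open>V\<close> is isomorphic to \<open>B\<close>.
\<close>

lemma extension_of_Up:
  assumes "Up_u V" "short_exact C i p" "i \<in> Hom C V Z" "p \<in> Hom C Z X" "X \<in> u"
  shows "Z \<in> u \<or> (\<exists>r \<in> Hom C Z V. r \<cdot> i = Ident C V)"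
proof -
  note V = torsionfree_almost_torsionD[OF assms(1)]
  note s = short_exactD[OF assms(2-4)]
  note Xo = HomD(5)[OF assms(4)]
  obtain U B a b where ab: "U \<in> u" "B \<in> v" "a \<in> Hom C U Z" "b \<in> Hom C Z B" "short_exact C a b"
    by (rule canonical_sequence[OF tp_u HomD(5)[OF assms(3)]])
  note ss = short_exactD[OF ab(5,3,4)]
  note bi = comp_closed[OF assms(3) ab(4)]
  from f_simple_source[OF tp_u V(1) ab(2) bi] show ?thesis
  proof
    assume "b \<cdot> i = Zero C V B"
    then obtain b' where b': "b' \<in> Hom C X B" "b' \<cdot> p = b" using s(7)[OF ab(4)] by blast
    have "b' = Zero C X B" by (rule torsion_pairD(3)[OF tp_u assms(5) ab(2) b'(1)])
    then have "b = Zero C Z B" using b'(2) comp_zero_left[OF assms(4) HomD(5)[OF ab(4)]] by simp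
    then have "zero_object C B" by (rule zero_epic_target[OF ss(4) ab(4)])
    then have "B \<in> u" by (rule zero_object_torsion(1)[OF tp_u])
    then show ?thesis using torsion_extension[OF tp_u ab(5,3,4,1)] by blast
  next
    assume m: "monic C (b \<cdot> i)"
    obtain c D where c: "c \<in> Hom C B D" "short_exact C (b \<cdot> i) c" by (rule monic_short_exact[OF m bi])
    note cs = short_exactD[OF c(2) bi c(1)]
    have D: "D \<in> v" by (rule V(4)[OF ab(2) bi c(1) cs(2)])
    note cb = comp_closed[OF ab(4) c(1)]
    have "(c \<cdot> b) \<cdot> i = Zero C V D" using cs(5) comp_assoc[OF assms(3) ab(4) c(1)] by simp
    then obtain c' where c': "c' \<in> Hom C X D" "c' \<cdot> p = c \<cdot> b" using s(7)[OF cb] by blast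
    have "c' = Zero C X D" by (rule torsion_pairD(3)[OF tp_u assms(5) D c'(1)])
    then have "c \<cdot> b = Zero C Z D" using c'(2) comp_zero_left[OF assms(4) HomD(5)[OF c(1)]] by simp
    then have "c = Zero C B D" by (rule epic_zeroD[OF ss(4) ab(4) c(1)])
    then have "zero_object C D" by (rule zero_epic_target[OF cs(4) c(1)])
    then have "epic C (b \<cdot> i)" using cokernel_zero_epic[OF cs(2) bi] HomD(3)[OF c(1)] by simp
    then have "isomorphism C (b \<cdot> i)" by (rule balanced[OF m _ bi])
    then obtain g where g: "g \<in> Hom C B V" "g \<cdot> (b \<cdot> i) = Ident C V" by (rule isomorphismE[OF _ bi])
    then have "(g \<cdot> b) \<cdot> i = Ident C V" using comp_assoc[OF assms(3) ab(4) g(1)] by simp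
    then show ?thesis using comp_closed[OF ab(4) g(1)] by blast
  qed
qed

text \<open>
  In the split case \<open>X\<close> would be a torsion subobject of the torsionfree object \<open>Z\<close>.
\<close>

lemma extension_of_Up_by_torsion:
  assumes "Up_u V" "short_exact C i p" "i \<in> Hom C V Z" "p \<in> Hom C Z X" "X \<in> t" "Z \<in> f"
  shows "Z \<in> W \<or> zero_object C X"
proof -
  have "X \<in> u" using assms(5) t_sub_u by blast
  from extension_of_Up[OF assms(1-4) this] show ?thesis
  proof
    assume "Z \<in> u"
    then show ?thesis using assms(6) by blast
  next
    assume "\<exists>r \<in> Hom C Z V. r \<cdot> i = Ident C V"
    then obtain r where r: "r \<in> Hom C Z V" "r \<cdot> i = Ident C V" by blast
    obtain s where s: "s \<in> Hom C X Z" "p \<cdot> s = Ident C X"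
      by (rule retraction_section[OF assms(2-4) r])
    have "s = Zero C X Z" by (rule torsion_pairD(3)[OF tp_t assms(5,6) s(1)])
    then have "Ident C X = Zero C X X" using s(2) comp_zero_right[OF assms(4) HomD(4)[OF s(1)]] by simp
    then show ?thesis using zero_object_iff HomD(4)[OF s(1)] by blast
  qed
qed

text \<open>
  The torsion part \<open>A\<close> of an extension \<open>P\<close> of \<open>T\<close> by \<open>K \<in> W\<close> is a copy of \<open>T\<close>. The map \<open>A \<rightarrow> T\<close> kills
  no torsion object since \<open>K\<close> is torsionfree, and it is zero or epic. It is not zero, for
  otherwise \<open>A = 0\<close>, then \<open>P\<close> lies in \<open>u \<inter> f\<close>, and so does the cokernel \<open>T\<close> of \<open>K \<rightarrow> P\<close>, although \<open>T\<close> is a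
  non-zero torsion object. So it is epic, its kernel is torsion because \<open>T\<close> is almost
  torsionfree, and hence zero.
\<close>

lemma torsion_part_of_extension:
  assumes T: "Low_t T" and x: "short_exact C k g" "k \<in> Hom C K P" "g \<in> Hom C P T" "K \<in> W"
    and ab: "short_exact C a b" "a \<in> Hom C A P" "b \<in> Hom C P B" "A \<in> t" "B \<in> f"
  shows "isomorphism C (g \<cdot> a)"
proof -
  note TD = torsion_almost_torsionfreeD[OF T]
  note s = short_exactD[OF x(1-3)] and abs = short_exactD[OF ab(1-3)]
  note ga = comp_closed[OF ab(2) x(3)]
  have lift0: "y = Zero C D A" if y: "y \<in> Hom C D A" "D \<in> t" "(g \<cdot> a) \<cdot> y = Zero C D T" for y D
  proof -
    have "g \<cdot> (a \<cdot> y) = Zero C D T" using y(3) comp_assoc[OF y(1) ab(2) x(3)] by simp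
    then obtain z where z: "z \<in> Hom C D K" "k \<cdot> z = a \<cdot> y" using s(6)[OF comp_closed[OF y(1) ab(2)]] by blast
    have "z = Zero C D K" using torsion_pairD(3)[OF tp_t y(2) _ z(1)] x(4) by blast
    then have "a \<cdot> y = Zero C D P" using z(2) comp_zero_right[OF x(2) HomD(4)[OF y(1)]] by simp
    then show ?thesis by (rule monic_zeroD[OF abs(3) ab(2) y(1)])
  qed
  from t_simple_target[OF tp_t TD(1) ab(4) ga] have ep: "epic C (g \<cdot> a)"
  proof
    assume z: "g \<cdot> a = Zero C A T"
    have Ao: "A \<in> Obj C" by (rule HomD(4)[OF ab(2)])
    have "Ident C A = Zero C A A"
      by (rule lift0[OF ident_closed[OF Ao] ab(4)]) (use comp_ident_right[OF ga] z in simp)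
    then have "zero_object C A" using Ao zero_object_iff by blast
    then have "monic C b" using kernel_zero_monic[OF abs(1) ab(3)] HomD(2)[OF ab(2)] by simp
    then have Pf: "P \<in> f" by (rule torsionfree_subobject[OF tp_t ab(5,3)])
    have "T \<in> u" using TD(2) t_sub_u by blast
    then have "P \<in> u" using torsion_extension[OF tp_u x(1-3)] x(4) by blast
    then have "T \<in> W" using heart_cokernel[OF x] Pf by blast
    then have "zero_object C T" using torsion_torsionfree_zero[OF tp_t TD(2)] by blast
    then show ?thesis using TD(3) by blast
  qed
  obtain y D where y: "y \<in> Hom C D A" "short_exact C y (g \<cdot> a)" by (rule epic_short_exact[OF ep ga])
  note ys = short_exactD[OF y(2,1) ga]
  have "D \<in> t" by (rule TD(4)[OF ab(4) ga y(1) ys(1)])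
  then have "y = Zero C D A" by (rule lift0[OF y(1) _ ys(5)])
  then have "zero_object C D" by (rule zero_monic_source[OF ys(3) y(1)])
  then have "monic C (g \<cdot> a)" using kernel_zero_monic[OF ys(1) ga] HomD(2)[OF y(1)] by simp
  then show ?thesis by (rule balanced[OF _ ep ga])
qed

text \<open>
  To extend \<open>g : V \<rightarrow> Y\<close> along \<open>e\<close>, push out along \<open>g\<close>. The resulting extension of \<open>T\<close> by \<open>Y \<in> W\<close> is
  split by its torsion part. The extension of \<open>g\<close> is unique because there are no non-zero maps
  from \<open>T\<close> to \<open>W\<close>.
\<close>

lemma reflection_with_Low_cokernel:
  assumes "short_exact C e c" "e \<in> Hom C V P" "c \<in> Hom C P T" "P \<in> W" "Low_t T"
  shows "reflection C W V e P"
proof (rule reflectionI[OF assms(2,4)])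
  note T = torsion_almost_torsionfreeD[OF assms(5)]
  note s = short_exactD[OF assms(1-3)]
  { fix Y h assume Y: "Y \<in> W" and h: "h \<in> Hom C P Y" "h \<cdot> e = Zero C V Y"
    obtain b where b: "b \<in> Hom C T Y" "b \<cdot> c = h" using s(7)[OF h] by blast
    have "b = Zero C T Y" using torsion_pairD(3)[OF tp_t T(2) _ b(1)] Y by blast
    then show "h = Zero C P Y" using b(2) comp_zero_left[OF assms(3) HomD(5)[OF h(1)]] by simp }
  fix Y g assume Y: "Y \<in> W" and g: "g \<in> Hom C V Y"
  obtain Z k q e' where Z: "k \<in> Hom C Y Z" "q \<in> Hom C Z T" "e' \<in> Hom C P Z" "short_exact C k q"
    "e' \<cdot> e = k \<cdot> g"
    by (rule pushout_short_exact[OF assms(1-3) g]) blast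
  obtain A B a b where ab: "A \<in> t" "B \<in> f" "a \<in> Hom C A Z" "b \<in> Hom C Z B" "short_exact C a b"
    by (rule canonical_sequence[OF tp_t HomD(5)[OF Z(1)]])
  note qa = comp_closed[OF ab(3) Z(2)]
  have iso: "isomorphism C (q \<cdot> a)"
    by (rule torsion_part_of_extension[OF assms(5) Z(4,1,2) Y ab(5,3,4,1,2)])
  obtain j where j: "j \<in> Hom C T A" "(q \<cdot> a) \<cdot> j = Ident C T" by (rule isomorphismE[OF iso qa])
  have "q \<cdot> (a \<cdot> j) = Ident C T" using j(2) comp_assoc[OF j(1) ab(3) Z(2)] by simp
  then obtain r where r: "r \<in> Hom C Z Y" "r \<cdot> k = Ident C Y"
    by (rule section_retraction[OF Z(4,1,2) comp_closed[OF j(1) ab(3)]])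
  have "(r \<cdot> e') \<cdot> e = (r \<cdot> k) \<cdot> g"
    using comp_assoc[OF assms(2) Z(3) r(1)] comp_assoc[OF g Z(1) r(1)] Z(5) by simp
  then have "(r \<cdot> e') \<cdot> e = g" using r(2) comp_ident_left[OF g] by simp
  then show "\<exists>h \<in> Hom C P Y. h \<cdot> e = g" using comp_closed[OF Z(3) r(1)] by blast
qed

text \<open>
  A map \<open>g : V \<rightarrow> Y\<close> has to kill \<open>F\<close>. Otherwise \<open>F\<close> embeds into \<open>Y\<close> with cokernel in \<open>f\<close>, and in \<open>u\<close> as a
  quotient of \<open>Y\<close>; then \<open>F\<close> is a kernel between objects of \<open>W\<close>, but \<open>F\<close> is a non-zero object of
  \<open>v\<close>.
\<close>

lemma reflection_with_Up_kernel:
  assumes "short_exact C k q" "k \<in> Hom C F V" "q \<in> Hom C V X" "X \<in> W" "V \<in> v" "Up_t F"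
  shows "reflection C W V q X"
proof (rule reflectionI[OF assms(3,4)])
  note F = torsionfree_almost_torsionD[OF assms(6)]
  note s = short_exactD[OF assms(1-3)]
  { fix Y h assume Y: "Y \<in> W" and h: "h \<in> Hom C X Y" "h \<cdot> q = Zero C V Y"
    show "h = Zero C X Y" by (rule epic_zeroD[OF s(4) assms(3) h]) }
  fix Y g assume Y: "Y \<in> W" and g: "g \<in> Hom C V Y"
  note gk = comp_closed[OF assms(2) g]
  have Yf: "Y \<in> f" and Yu: "Y \<in> u" using Y by auto
  from f_simple_source[OF tp_t F(1) Yf gk] have "g \<cdot> k = Zero C F Y"
  proof
    assume m: "monic C (g \<cdot> k)"
    obtain c D where c: "c \<in> Hom C Y D" "short_exact C (g \<cdot> k) c" by (rule monic_short_exact[OF m gk])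
    note cs = short_exactD[OF c(2) gk c(1)]
    have "D \<in> f" by (rule F(4)[OF Yf gk c(1) cs(2)])
    moreover have "D \<in> u" by (rule torsion_quotient[OF tp_u Yu c(1) cs(4)])
    ultimately have "F \<in> W" using heart_kernel[OF c(2) gk c(1) Y] by blast
    moreover have "F \<in> v" by (rule torsionfree_subobject[OF tp_u assms(5,2) s(3)])
    ultimately have "zero_object C F" using torsion_torsionfree_zero[OF tp_u] by blast
    then show ?thesis using F(3) by blast
  qed
  then show "\<exists>h \<in> Hom C X Y. h \<cdot> q = g" by (rule s(7)[OF g])
qed

end

section \<open>Existence of partners\<close>

context generated_wide_interval
begin

text \<open>
  Take a quotient \<open>X \<in> W\<close> of \<open>V\<close> with kernel \<open>F\<close> as short as possible. Every map \<open>V \<rightarrow> Y\<close> with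
  \<open>Y \<in> W\<close> kills \<open>F\<close>: the image of \<open>V \<rightarrow> X \<oplus> Y\<close> is in \<open>W\<close> (it is a proper quotient of the
  \<open>v\<close>-simple object \<open>V\<close>, since \<open>V\<close> does not embed into \<open>W\<close>), and its kernel is contained in \<open>F\<close>. This
  maximality of \<open>X\<close> makes proper quotients of \<open>F\<close> torsion: a proper torsionfree quotient \<open>I\<close> of \<open>F\<close>
  yields, by pushout, a proper quotient \<open>Z \<in> W\<close> of \<open>V\<close> in which \<open>F\<close> has image \<open>I\<close>. An extension of a
  torsion object by \<open>F\<close> inside \<open>f\<close> pushes out to one by \<open>V\<close>, to which
  \<open>extension_of_Up_by_torsion\<close> applies.
\<close>

lemma Up_without_embedding:
  assumes V: "Up_u V" and no_mono: "\<And>Y g. Y \<in> W \<Longrightarrow> g \<in> Hom C V Y \<Longrightarrow> \<not> monic C g"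
  obtains k q F X where "Up_t F" "X \<in> W" "k \<in> Hom C F V" "q \<in> Hom C V X" "short_exact C k q"
proof -
  note VD = torsionfree_almost_torsionD[OF V]
  have Vf: "V \<in> f" using VD(2) v_sub_f by blast
  have Vo: "V \<in> Obj C" by (rule torsionfree_in_Obj[OF tp_u VD(2)])
  define P where "P n \<longleftrightarrow> (\<exists>k q F X. X \<in> W \<and> k \<in> Hom C F V \<and> q \<in> Hom C V X \<and> short_exact C k q \<and> len F = n)" for n
  have "\<exists>n. P n"
  proof -
    obtain Z where Z: "zero_object C Z" using ex_zero_object by blast
    have ZW: "Z \<in> W" using zero_object_torsion[OF tp_u Z] zero_object_torsion[OF tp_t Z] by blast
    have Zo: "Z \<in> Obj C" using Z by (simp add: zero_object_def)
    note z = zero_closed[OF Vo Zo]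
    have "epic C (Zero C V Z)" by (rule epic_zeroI[OF z]) (rule from_zero_object[OF Z])
    then obtain k K where "k \<in> Hom C K V" "short_exact C k (Zero C V Z)"
      by (rule epic_short_exact[OF _ z])
    then show ?thesis using ZW z unfolding P_def by blast
  qed
  then obtain n where n: "P n" "\<And>m. P m \<Longrightarrow> n \<le> m" using LeastI_ex[of P] Least_le[of P] by blast
  obtain k q F X where kq: "X \<in> W" "k \<in> Hom C F V" "q \<in> Hom C V X" "short_exact C k q" "len F = n"
    using n(1) P_def by blast
  note s = short_exactD[OF kq(4,2,3)]
  have kill: "g \<cdot> k = Zero C F Y" if Y: "Y \<in> W" and g: "g \<in> Hom C V Y" for Y g
  proof -
    have Xo: "X \<in> Obj C" and Yo: "Y \<in> Obj C" using HomD(5)[OF kq(3)] HomD(5)[OF g] by auto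
    obtain B i j p r where bp: "is_biproduct C X Y B i j p r" using ex_biproduct[OF Xo Yo] by blast
    have p: "p \<in> Hom C B X" and r: "r \<in> Hom C B Y" using bp by (auto simp: is_biproduct_def)
    have BW: "B \<in> W" by (rule heart_extension[OF biproduct_short_exact[OF bp] kq(1) Y])
    obtain w where w: "w \<in> Hom C V B" "p \<cdot> w = q" "r \<cdot> w = g"
      using biproduct_pair[OF bp kq(3) g] by blast
    obtain I e m where I: "e \<in> Hom C V I" "m \<in> Hom C I B" "epic C e" "monic C m" "m \<cdot> e = w"
      by (rule image_factorization[OF w(1)])
    have "\<not> isomorphism C e"
      using monic_comp[OF I(1,2) isomorphism_monic[OF _ I(1)] I(4)] no_mono[OF BW w(1)] I(5) by auto
    then have Iu: "I \<in> u" by (rule f_simple_quotient[OF VD(1) I(1,3)])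
    have "I \<in> f" using torsionfree_subobject[OF tp_t _ I(2,4)] BW by blast
    with Iu have IW: "I \<in> W" by blast
    obtain l K where l: "l \<in> Hom C K V" "short_exact C l e" by (rule epic_short_exact[OF I(3,1)])
    note ls = short_exactD[OF l(2,1) I(1)]
    note Ko = HomD(4)[OF l(1)]
    have wl: "w \<cdot> l = Zero C K B"
      using comp_assoc[OF l(1) I(1,2)] ls(5) I(5) comp_zero_right[OF I(2) Ko] by simp
    have "q \<cdot> l = Zero C K X" using comp_assoc[OF l(1) w(1) p] w(2) wl comp_zero_right[OF p Ko] by simp
    then obtain b where b: "b \<in> Hom C K F" "k \<cdot> b = l" using s(6)[OF l(1)] by blast
    have mb: "monic C b" by (rule monic_factor[OF b(1) kq(2)]) (simp add: b ls)
    have "P (len K)" using IW l I(1) unfolding P_def by blast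
    then have "isomorphism C b" using n(2) kq(5) len_subobject[OF b(1) mb] by (meson not_le)
    then have eb: "epic C b" by (rule isomorphism_epic[OF _ b(1)])
    have "(g \<cdot> k) \<cdot> b = g \<cdot> l" using comp_assoc[OF b(1) kq(2) g] b(2) by simp
    also have "\<dots> = Zero C K Y" using comp_assoc[OF l(1) w(1) r] w(3) wl comp_zero_right[OF r Ko] by simp
    finally show ?thesis by (rule epic_zeroD[OF eb b(1) comp_closed[OF kq(2) g]])
  qed
  have Ff: "F \<in> f" by (rule torsionfree_subobject[OF tp_t Vf kq(2) s(3)])
  have Fnz: "\<not> zero_object C F"
    using kernel_zero_monic[OF s(1) kq(3)] no_mono[OF kq(1,3)] HomD(2)[OF kq(2)] by auto
  have "Tgt C r \<in> t" if r: "epic C r" "Src C r = F" "\<not> isomorphism C r" for r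
  proof -
    let ?R = "Tgt C r"
    have rh: "r \<in> Hom C F ?R" using r(1,2) by (simp add: epic_def Hom_def)
    obtain l N where l: "l \<in> Hom C N F" "short_exact C l r" by (rule epic_short_exact[OF r(1) rh])
    note ls = short_exactD[OF l(2,1) rh]
    note No = HomD(4)[OF l(1)]
    have lnz: "l \<noteq> Zero C N F"
    proof
      assume "l = Zero C N F"
      then have "zero_object C N" by (rule zero_monic_source[OF ls(3) l(1)])
      then have "monic C r" using kernel_zero_monic[OF ls(1) rh] HomD(2)[OF l(1)] by simp
      then show False using balanced[OF _ r(1) rh] r(3) by blast
    qed
    show ?thesis
    proof (rule torsionI[OF tp_t HomD(5)[OF rh]])
      fix G g assume G: "G \<in> f" "g \<in> Hom C ?R G"
      note gr = comp_closed[OF rh G(2)]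
      obtain I e m where I: "e \<in> Hom C F I" "m \<in> Hom C I G" "epic C e" "monic C m" "m \<cdot> e = g \<cdot> r"
        by (rule image_factorization[OF gr])
      have If: "I \<in> f" by (rule torsionfree_subobject[OF tp_t G(1) I(2,4)])
      have "m \<cdot> (e \<cdot> l) = Zero C N G"
        using comp_assoc[OF l(1) I(1,2)] comp_assoc[OF l(1) rh G(2)] I(5) ls(5) comp_zero_right[OF G(2) No]
        by simp
      then have el: "e \<cdot> l = Zero C N I" by (rule monic_zeroD[OF I(4,2) comp_closed[OF l(1) I(1)]])
      obtain Z k' q' e' where Z: "k' \<in> Hom C I Z" "q' \<in> Hom C Z X" "e' \<in> Hom C V Z"
        "short_exact C k' q'" "e' \<cdot> k = k' \<cdot> e" "epic C e \<Longrightarrow> epic C e'"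
        by (rule pushout_short_exact[OF kq(4,2,3) I(1)]) blast
      have Zf: "Z \<in> f" using torsionfree_extension[OF tp_t Z(4,1,2) If] kq(1) by blast
      \<comment> \<open>An isomorphism \<open>e'\<close> would be injective on \<open>F\<close>, where it restricts to the
      non-injective map \<open>e\<close>.\<close>
      have "\<not> isomorphism C e'"
      proof
        assume "isomorphism C e'"
        then have me': "monic C e'" by (rule isomorphism_monic[OF _ Z(3)])
        have "e' \<cdot> (k \<cdot> l) = k' \<cdot> (e \<cdot> l)"
          using comp_assoc[OF l(1) kq(2) Z(3)] comp_assoc[OF l(1) I(1) Z(1)] Z(5) by simp
        then have "e' \<cdot> (k \<cdot> l) = Zero C N Z" using el comp_zero_right[OF Z(1) No] by simp
        then have "k \<cdot> l = Zero C N V" by (rule monic_zeroD[OF me' Z(3) comp_closed[OF l(1) kq(2)]])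
        then have "l = Zero C N F" by (rule monic_zeroD[OF s(3) kq(2) l(1)])
        then show False using lnz by blast
      qed
      then have "Z \<in> u" by (rule f_simple_quotient[OF VD(1) Z(3) Z(6)[OF I(3)]])
      then have "e' \<cdot> k = Zero C F Z" using kill[OF _ Z(3)] Zf by blast
      then have "e = Zero C F I"
        using monic_zeroD[OF short_exactD(3)[OF Z(4,1,2)] Z(1) I(1)] Z(5) by simp
      then have "g \<cdot> r = Zero C F G" using I(5) comp_zero_right[OF I(2) HomD(4)[OF I(1)]] by simp
      then show "g = Zero C ?R G" by (rule epic_zeroD[OF r(1) rh G(2)])
    qed
  qed
  then have Fs: "f_simple C t f F" using Ff Fnz by (simp add: f_simple_def)
  have "Up_t F"
  proof (rule torsionfree_almost_torsionI[OF tp_t Fs])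
    fix G T i p assume x: "i \<in> Hom C F G" "p \<in> Hom C G T" "short_exact C i p" "G \<in> f" "T \<in> t"
    obtain Z k' p' g where Z: "k' \<in> Hom C V Z" "p' \<in> Hom C Z T" "g \<in> Hom C G Z" "short_exact C k' p'"
      "\<exists>c \<in> Hom C Z X. short_exact C g c"
      by (rule pushout_short_exact[OF x(3,1,2) kq(2)]) (use s(2,3) kq(3) in blast)
    obtain c where c: "c \<in> Hom C Z X" "short_exact C g c" using Z(5) by blast
    have "Z \<in> f" using torsionfree_extension[OF tp_t c(2) Z(3) c(1) x(4)] kq(1) by blast
    from extension_of_Up_by_torsion[OF V Z(4,1,2) x(5) this] show "zero_object C T"
      using no_mono[OF _ Z(1)] short_exactD(3)[OF Z(4,1,2)] by blast
  qed
  then show thesis using that kq(1-4) by blast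
qed

text \<open>
  Embed \<open>V\<close> into an object \<open>P \<in> W\<close> of least length, with cokernel \<open>Q\<close>. A non-zero
  torsionfree quotient \<open>B\<close> of \<open>Q\<close> would be in \<open>W\<close>, and the kernel of \<open>P \<rightarrow> B\<close> a smaller choice of \<open>P\<close>; so \<open>Q\<close> is torsion, and some \<open>T\<close>
  in \<open>Low t\<close> maps to it. Pulling \<open>P\<close> back along \<open>T \<rightarrow> Q\<close> gives the required sequence: the
  pullback is torsionfree because a torsion object mapping to it vanishes in \<open>P\<close>, hence in \<open>Q\<close>, so
  that it cannot map onto \<open>T\<close> and vanishes in \<open>T\<close> too.
\<close>

lemma Up_with_embedding:
  assumes V: "Up_u V" and Y: "Y \<in> W" "g \<in> Hom C V Y" "monic C g"
  obtains e c P T where "Low_t T" "P \<in> W" "e \<in> Hom C V P" "c \<in> Hom C P T" "short_exact C e c"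
proof -
  note VD = torsionfree_almost_torsionD[OF V]
  define S where "S P \<longleftrightarrow> P \<in> W \<and> (\<exists>e \<in> Hom C V P. monic C e)" for P
  have "S Y" using Y S_def by blast
  then obtain P where P: "S P" "\<And>P'. S P' \<Longrightarrow> len P \<le> len P'"
    using ex_has_least_nat[of S Y len] by blast
  obtain e where PW: "P \<in> W" and e: "e \<in> Hom C V P" "monic C e" using P(1) S_def by blast
  have Pu: "P \<in> u" and Pf: "P \<in> f" using PW by auto
  obtain c Q where c: "c \<in> Hom C P Q" "short_exact C e c" by (rule monic_short_exact[OF e(2,1)])
  note s = short_exactD[OF c(2) e(1) c(1)]
  have Qu: "Q \<in> u" by (rule torsion_quotient[OF tp_u Pu c(1) s(4)])
  have Qt: "Q \<in> t"
  proof -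
    obtain A B a b where ab: "A \<in> t" "B \<in> f" "a \<in> Hom C A Q" "b \<in> Hom C Q B" "short_exact C a b"
      by (rule canonical_sequence[OF tp_t HomD(5)[OF c(1)]])
    note abs = short_exactD[OF ab(5,3,4)]
    have BW: "B \<in> W" using torsion_quotient[OF tp_u Qu ab(4) abs(4)] ab(2) by blast
    note bc = comp_closed[OF c(1) ab(4)]
    have ebc: "epic C (b \<cdot> c)" by (rule epic_comp[OF c(1) ab(4) s(4) abs(4)])
    obtain n N where n: "n \<in> Hom C N P" "short_exact C n (b \<cdot> c)" by (rule epic_short_exact[OF ebc bc])
    note ns = short_exactD[OF n(2,1) bc]
    have NW: "N \<in> W" by (rule heart_kernel[OF n(2,1) bc PW BW])
    have "(b \<cdot> c) \<cdot> e = Zero C V B"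
      using comp_assoc[OF e(1) c(1) ab(4)] s(5) comp_zero_right[OF ab(4) HomD(4)[OF e(1)]] by simp
    then obtain d where d: "d \<in> Hom C V N" "n \<cdot> d = e" using ns(6)[OF e(1)] by blast
    have "monic C d" by (rule monic_factor[OF d(1) n(1)]) (simp add: d e)
    then have "S N" using NW d(1) S_def by blast
    then have "isomorphism C n" using P(2) len_subobject[OF n(1) ns(3)] by (meson not_le)
    then have "b \<cdot> c = Zero C P B" by (rule epic_zeroD[OF isomorphism_epic[OF _ n(1)] n(1) bc ns(5)])
    then have "zero_object C B" by (rule zero_epic_target[OF ebc bc])
    then have "B \<in> t" by (rule zero_object_torsion[OF tp_t])
    then show ?thesis by (rule torsion_extension[OF tp_t ab(5,3,4,1)])
  qed
  have "\<not> zero_object C Q"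
  proof
    assume "zero_object C Q"
    then have "epic C e" using cokernel_zero_epic[OF s(2) e(1)] HomD(3)[OF c(1)] by simp
    then have "isomorphism C e" by (rule balanced[OF e(2) _ e(1)])
    then have "V \<in> u" by (rule subcategoryD(3)[OF torsion_pairD(1)[OF tp_u] Pu _ e(1)])
    then show False using torsion_torsionfree_zero[OF tp_u _ VD(2)] VD(3) by blast
  qed
  then obtain T h where T: "Low_t T" "h \<in> Hom C T Q" "h \<noteq> Zero C T Q" using generating[OF Qt] by blast
  note TD = torsion_almost_torsionfreeD[OF T(1)]
  obtain Z i p g' where Z: "i \<in> Hom C V Z" "p \<in> Hom C Z T" "g' \<in> Hom C Z P" "short_exact C i p"
    "c \<cdot> g' = h \<cdot> p" and joint: "\<And>A z w. z \<in> Hom C A Z \<Longrightarrow> w \<in> Hom C A Z \<Longrightarrow> g' \<cdot> z = g' \<cdot> w \<Longrightarrow> p \<cdot> z = p \<cdot> w \<Longrightarrow> z = w"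
    by (rule pullback_short_exact[OF c(2) e(1) c(1) T(2)]) blast
  have Zo: "Z \<in> Obj C" by (rule HomD(5)[OF Z(1)])
  have Zf: "Z \<in> f"
  proof (rule torsionfreeI[OF tp_t Zo])
    fix A x assume A: "A \<in> t" "x \<in> Hom C A Z"
    note Ao = HomD(4)[OF A(2)] and px = comp_closed[OF A(2) Z(2)]
    have g'x: "g' \<cdot> x = Zero C A P"
      by (rule torsion_pairD(3)[OF tp_t A(1) Pf comp_closed[OF A(2) Z(3)]])
    have "h \<cdot> (p \<cdot> x) = c \<cdot> (g' \<cdot> x)"
      using comp_assoc[OF A(2) Z(2) T(2)] comp_assoc[OF A(2) Z(3) c(1)] Z(5) by simp
    then have hpx: "h \<cdot> (p \<cdot> x) = Zero C A Q" using g'x comp_zero_right[OF c(1) Ao] by simp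
    then have "\<not> epic C (p \<cdot> x)" using epic_zeroD[OF _ px T(2) hpx] T(3) by blast
    then have "p \<cdot> x = Zero C A T" using t_simple_target[OF tp_t TD(1) A(1) px] by blast
    then show "x = Zero C A Z"
      using joint[OF A(2) zero_closed[OF Ao Zo]] g'x comp_zero_right[OF Z(3) Ao]
        comp_zero_right[OF Z(2) Ao] by simp
  qed
  have "Z \<in> W" using extension_of_Up_by_torsion[OF V Z(4,1,2) TD(2) Zf] TD(3) by blast
  then show thesis using that T(1) Z(1,2,4) by blast
qed

text \<open>
  If \<open>U\<close> has a quotient \<open>B\<close> in \<open>f\<close>, then \<open>B\<close> is in \<open>W\<close>, and so is the kernel of \<open>U \<rightarrow> B\<close>; this kernel
  is then a subobject of the \<open>u\<close>-simple object \<open>U\<close> which lies in \<open>u\<close>, so it is \<open>0\<close> or \<open>U\<close>. And if an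
  extension of a torsion object by \<open>U\<close> is in \<open>f\<close>, it is in \<open>W\<close>; then the torsion object, a cokernel in
  \<open>W\<close>, is torsionfree as well.
\<close>

lemma Low_in_heart:
  assumes U: "Low_u U" and Uf: "U \<in> f"
  shows "Up_t U"
proof -
  note UD = torsion_almost_torsionfreeD[OF U]
  have UW: "U \<in> W" using UD(2) Uf by blast
  have "Tgt C r \<in> t" if r: "epic C r" "Src C r = U" "\<not> isomorphism C r" for r
  proof -
    let ?R = "Tgt C r"
    have rh: "r \<in> Hom C U ?R" using r(1,2) by (simp add: epic_def Hom_def)
    have Ru: "?R \<in> u" by (rule torsion_quotient[OF tp_u UD(2) rh r(1)])
    obtain A B a b where ab: "A \<in> t" "B \<in> f" "a \<in> Hom C A ?R" "b \<in> Hom C ?R B" "short_exact C a b"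
      by (rule canonical_sequence[OF tp_t HomD(5)[OF rh]])
    note abs = short_exactD[OF ab(5,3,4)]
    have BW: "B \<in> W" using torsion_quotient[OF tp_u Ru ab(4) abs(4)] ab(2) by blast
    note br = comp_closed[OF rh ab(4)]
    have ebr: "epic C (b \<cdot> r)" by (rule epic_comp[OF rh ab(4) r(1) abs(4)])
    obtain n N where n: "n \<in> Hom C N U" "short_exact C n (b \<cdot> r)" by (rule epic_short_exact[OF ebr br])
    note ns = short_exactD[OF n(2,1) br]
    have "N \<in> u" using heart_kernel[OF n(2,1) br UW BW] by blast
    from t_simple_target[OF tp_u UD(1) this n(1)] show ?thesis
    proof
      assume "n = Zero C N U"
      then have "zero_object C N" by (rule zero_monic_source[OF ns(3) n(1)])
      then have "monic C (b \<cdot> r)" using kernel_zero_monic[OF ns(1) br] HomD(2)[OF n(1)] by simp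
      then have "monic C r" by (rule monic_factor[OF rh ab(4)])
      then show ?thesis using balanced[OF _ r(1) rh] r(3) by blast
    next
      assume "epic C n"
      then have "b \<cdot> r = Zero C U B" by (rule epic_zeroD[OF _ n(1) br ns(5)])
      then have "zero_object C B" by (rule zero_epic_target[OF ebr br])
      then have "B \<in> t" by (rule zero_object_torsion[OF tp_t])
      then show ?thesis by (rule torsion_extension[OF tp_t ab(5,3,4,1)])
    qed
  qed
  then have "f_simple C t f U" using Uf UD(3) by (simp add: f_simple_def)
  then show ?thesis
  proof (rule torsionfree_almost_torsionI[OF tp_t])
    fix F T i p assume x: "i \<in> Hom C U F" "p \<in> Hom C F T" "short_exact C i p" "F \<in> f" "T \<in> t"
    have "F \<in> u" using torsion_extension[OF tp_u x(3,1,2) UD(2)] x(5) t_sub_u by blast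
    then have "T \<in> W" using heart_cokernel[OF x(3,1,2) UW] x(4) by blast
    then show "zero_object C T" using torsion_torsionfree_zero[OF tp_t x(5)] by blast
  qed
qed

text \<open>
  The torsion part of \<open>U\<close> for \<open>(t, f)\<close> lies in \<open>u\<close>, so it is \<open>0\<close> or \<open>U\<close>.
\<close>

lemma Low_outside_heart:
  assumes U: "Low_u U" and Uf: "U \<notin> f"
  shows "U \<in> t"
proof -
  note UD = torsion_almost_torsionfreeD[OF U]
  obtain A B a b where ab: "A \<in> t" "B \<in> f" "a \<in> Hom C A U" "b \<in> Hom C U B" "short_exact C a b"
    by (rule canonical_sequence[OF tp_t torsion_in_Obj[OF tp_u UD(2)]])
  note abs = short_exactD[OF ab(5,3,4)]
  have Au: "A \<in> u" using ab(1) t_sub_u by blast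
  from t_simple_target[OF tp_u UD(1) Au ab(3)] show ?thesis
  proof
    assume "a = Zero C A U"
    then have "zero_object C A" by (rule zero_monic_source[OF abs(3) ab(3)])
    then have "monic C b" using kernel_zero_monic[OF abs(1) ab(4)] HomD(2)[OF ab(3)] by simp
    then show ?thesis using torsionfree_subobject[OF tp_t ab(2,4)] Uf by blast
  next
    assume "epic C a"
    then show ?thesis by (rule torsion_quotient[OF tp_t ab(1,3)])
  qed
qed

lemma map_Low_t_to_Low_u:
  assumes U: "Low_u U" and T: "Low_t T" and x: "x \<in> Hom C T U" "x \<noteq> Zero C T U"
  obtains k K where "K \<in> W" "k \<in> Hom C K T" "short_exact C k x"
proof -
  note UD = torsion_almost_torsionfreeD[OF U] and TD = torsion_almost_torsionfreeD[OF T]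
  have Tu: "T \<in> u" using TD(2) t_sub_u by blast
  have ex: "epic C x" using t_simple_target[OF tp_u UD(1) Tu x(1)] x(2) by blast
  obtain k K where k: "k \<in> Hom C K T" "short_exact C k x" by (rule epic_short_exact[OF ex x(1)])
  note ks = short_exactD[OF k(2,1) x(1)]
  have "K \<in> u" by (rule UD(4)[OF Tu x(1) k(1) ks(1)])
  moreover have "\<not> isomorphism C k"
    using epic_zeroD[OF isomorphism_epic[OF _ k(1)] k(1) x(1) ks(5)] x(2) by blast
  then have "K \<in> f" by (rule t_simple_subobject[OF TD(1) k(1) ks(3)])
  ultimately show thesis using that k by blast
qed

text \<open>
  The fibre product of \<open>T\<close> and \<open>T'\<close> over \<open>U\<close> is an extension of either by an object of \<open>W\<close>, so its
  torsion part is isomorphic to both.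
\<close>

lemma Low_t_over_Low_u_unique:
  assumes T: "Low_t T" and T': "Low_t T'"
    and x: "short_exact C k x" "k \<in> Hom C K T" "x \<in> Hom C T U" "K \<in> W"
    and x': "short_exact C k' x'" "k' \<in> Hom C K' T'" "x' \<in> Hom C T' U" "K' \<in> W"
  shows "isomorphic C T T'"
proof -
  note s' = short_exactD[OF x'(1-3)]
  obtain P i p g where P: "i \<in> Hom C K P" "p \<in> Hom C P T'" "g \<in> Hom C P T" "short_exact C i p"
    "\<exists>l \<in> Hom C K' P. short_exact C l g"
    by (rule pullback_short_exact[OF x(1-3) x'(3)]) (use s'(1,4) x'(2) in blast)
  obtain l where l: "l \<in> Hom C K' P" "short_exact C l g" using P(5) by blast
  obtain A B a b where ab: "A \<in> t" "B \<in> f" "a \<in> Hom C A P" "b \<in> Hom C P B" "short_exact C a b"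
    by (rule canonical_sequence[OF tp_t HomD(5)[OF P(1)]])
  have 1: "isomorphism C (p \<cdot> a)" by (rule torsion_part_of_extension[OF T' P(4,1,2) x(4) ab(5,3,4,1,2)])
  have 2: "isomorphism C (g \<cdot> a)" by (rule torsion_part_of_extension[OF T l(2,1) P(3) x'(4) ab(5,3,4,1,2)])
  have "isomorphic C A T'" by (rule isomorphicI[OF comp_closed[OF ab(3) P(2)] 1])
  moreover have "isomorphic C A T" by (rule isomorphicI[OF comp_closed[OF ab(3) P(3)] 2])
  ultimately show ?thesis using isomorphic_trans isomorphic_sym by blast
qed

end

section \<open>The partner relation\<close>

text \<open>
  The graph of the bijection on representatives, with \<open>Inl\<close> for \<open>Up\<close> and \<open>Inr\<close> for \<open>Low\<close>. In the
  derived category these sequences are universal extensions of simple objects of the heart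
  belonging to \<open>(u, v)\<close> by objects of \<open>W\<close>. In this form the relation is self-dual.
\<close>

fun partner ::
    "('o, 'm, 'x) preadditive_scheme \<Rightarrow> 'o set \<Rightarrow> 'o set \<Rightarrow> 'o set \<Rightarrow> 'o set \<Rightarrow>
     'o + 'o \<Rightarrow> 'o + 'o \<Rightarrow> bool" where
  "partner C t f u v (Inl V) (Inr T) \<longleftrightarrow>
     torsionfree_almost_torsion C u v V \<and> torsion_almost_torsionfree C t f T \<and>
     (\<exists>P \<in> u \<inter> f. \<exists>e \<in> Hom C V P. \<exists>c \<in> Hom C P T. short_exact C e c)"
| "partner C t f u v (Inl V) (Inl F) \<longleftrightarrow>
     torsionfree_almost_torsion C u v V \<and> torsionfree_almost_torsion C t f F \<and>
     (\<exists>X \<in> u \<inter> f. \<exists>k \<in> Hom C F V. \<exists>q \<in> Hom C V X. short_exact C k q)"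
| "partner C t f u v (Inr U) (Inr T) \<longleftrightarrow>
     torsion_almost_torsionfree C u v U \<and> torsion_almost_torsionfree C t f T \<and>
     (\<exists>K \<in> u \<inter> f. \<exists>k \<in> Hom C K T. \<exists>x \<in> Hom C T U. short_exact C k x)"
| "partner C t f u v (Inr U) (Inl F) \<longleftrightarrow>
     torsion_almost_torsionfree C u v U \<and> torsionfree_almost_torsion C t f F \<and> isomorphic C U F"

definition swap :: "'a + 'a \<Rightarrow> 'a + 'a" where
  "swap = case_sum Inr Inl"

lemma swap_simps [simp]: "swap (Inl x) = Inr x" "swap (Inr x) = Inl x" "swap (swap y) = y"
  by (simp_all add: swap_def split: sum.split)

context category
begin

abbreviation same_type :: "'o + 'o \<Rightarrow> 'o + 'o \<Rightarrow> bool" where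
  "same_type \<equiv> rel_sum (isomorphic C) (isomorphic C)"

lemma same_type_swap: "same_type (swap x) (swap y) \<longleftrightarrow> same_type x y"
  by (cases x; cases y) simp_all

end

context abelian_category
begin

lemma short_exact_iso_middle:
  assumes "short_exact C i p" "i \<in> Hom C X M" "p \<in> Hom C M Y" "h \<in> Hom C M' M" "isomorphism C h"
  obtains h' where "short_exact C (h' \<cdot> i) (p \<cdot> h)" "h' \<cdot> i \<in> Hom C X M'"
proof -
  obtain h' where h': "h' \<in> Hom C M M'" "h \<cdot> h' = Ident C M" "isomorphism C h'"
    by (rule isomorphismE[OF assms(5,4)])
  note s = short_exactD[OF assms(1-3)]
  note hi = comp_closed[OF assms(2) h'(1)]
  have "h \<cdot> (h' \<cdot> i) = i"
    using comp_assoc[OF assms(2) h'(1) assms(4)] h'(2) comp_ident_left[OF assms(2)] by simp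
  then have "is_cokernel C (h' \<cdot> i) (p \<cdot> h)"
    using cokernel_after_iso[OF hi assms(4,5,3)] s(2) by simp
  then have "short_exact C (h' \<cdot> i) (p \<cdot> h)"
    by (rule normal_monic[OF monic_comp[OF assms(2) h'(1) s(3) isomorphism_monic[OF h'(3,1)]] hi])
  then show thesis using that hi by blast
qed

end

context generated_wide_interval
begin

abbreviation brick_u :: "'o + 'o \<Rightarrow> bool" where "brick_u \<equiv> case_sum Up_u Low_u"
abbreviation brick_t :: "'o + 'o \<Rightarrow> bool" where "brick_t \<equiv> case_sum Up_t Low_t"

abbreviation matched :: "'o + 'o \<Rightarrow> 'o + 'o \<Rightarrow> bool" where "matched \<equiv> partner C t f u v"

text \<open>
  Passing to the opposite category turns the relation into its converse: the first and the
  last clause are self-dual, the second and the third are dual to each other.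
\<close>

lemma matched_dual: "partner (opposite C) v u f t (swap y) (swap x) \<longleftrightarrow> matched x y"
proof -
  have iso: "isomorphic (opposite C) X Y \<longleftrightarrow> isomorphic C Y X" for X Y
    by (auto simp: isomorphic_def)
  show ?thesis
    by (cases x; cases y) (auto simp: Int_commute[of f u] iso)
qed

lemma matched_bricks:
  assumes "matched x y"
  shows "brick_u x" "brick_t y"
  using assms by (cases x; cases y; simp)+

lemma matched_exists:
  assumes "brick_u x"
  shows "\<exists>y. matched x y"
proof (cases x)
  case (Inl V)
  then have V: "Up_u V" using assms by simp
  show ?thesis
  proof (cases "\<exists>Y g. Y \<in> W \<and> g \<in> Hom C V Y \<and> monic C g")
    case True
    then obtain Y g where Y: "Y \<in> W" "g \<in> Hom C V Y" "monic C g" by blast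
    obtain e c P T where "Low_t T" "P \<in> W" "e \<in> Hom C V P" "c \<in> Hom C P T" "short_exact C e c"
      by (rule Up_with_embedding[OF V Y])
    then have "matched x (Inr T)" using V unfolding Inl partner.simps by blast
    then show ?thesis ..
  next
    case False
    obtain k q F X where "Up_t F" "X \<in> W" "k \<in> Hom C F V" "q \<in> Hom C V X" "short_exact C k q"
      by (rule Up_without_embedding[OF V]) (use False in blast)
    then have "matched x (Inl F)" using V unfolding Inl partner.simps by blast
    then show ?thesis ..
  qed
next
  case (Inr U)
  then have U: "Low_u U" using assms by simp
  show ?thesis
  proof (cases "U \<in> f")
    case True
    have "isomorphic C U U" by (rule isomorphic_refl[OF torsionfree_in_Obj[OF tp_t True]])
    then have "matched x (Inl U)" using U Low_in_heart[OF U True] by (simp add: Inr)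
    then show ?thesis ..
  next
    case False
    obtain T h where T: "Low_t T" "h \<in> Hom C T U" "h \<noteq> Zero C T U"
      using generating[OF Low_outside_heart[OF U False] torsion_almost_torsionfreeD(3)[OF U]] by blast
    obtain k K where "K \<in> W" "k \<in> Hom C K T" "short_exact C k h"
      by (rule map_Low_t_to_Low_u[OF U T])
    then have "matched x (Inr T)" using U T unfolding Inr partner.simps by blast
    then show ?thesis ..
  qed
qed

lemma matched_transport:
  assumes "matched x y" "same_type x' x" "brick_u x'"
  shows "matched x' y"
proof (cases x)
  case (Inl V)
  then obtain V' where x': "x' = Inl V'" and "isomorphic C V' V" using assms(2) by (cases x') auto
  then obtain h where h: "h \<in> Hom C V' V" "isomorphism C h" by (auto simp: isomorphic_def)
  have V': "Up_u V'" using assms(3) x' by simp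
  show ?thesis
  proof (cases y)
    case (Inr T)
    then obtain P e c where P: "Low_t T" "P \<in> W" "e \<in> Hom C V P" "c \<in> Hom C P T" "short_exact C e c"
      using assms(1) Inl by auto
    have "short_exact C (e \<cdot> h) c" by (rule short_exact_iso_left[OF P(5,3,4) h])
    then show ?thesis using V' P(1,2,4) comp_closed[OF h(1) P(3)] unfolding x' Inr partner.simps by blast
  next
    case [simp]: (Inl F)
    then obtain X k q where X: "Up_t F" "X \<in> W" "k \<in> Hom C F V" "q \<in> Hom C V X" "short_exact C k q"
      using assms(1) \<open>x = Inl V\<close> by auto
    obtain h' where "short_exact C (h' \<cdot> k) (q \<cdot> h)" "h' \<cdot> k \<in> Hom C F V'"
      by (rule short_exact_iso_middle[OF X(5,3,4) h])
    then show ?thesis using V' X(1,2) comp_closed[OF h(1) X(4)] unfolding x' Inl partner.simps by blast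
  qed
next
  case (Inr U)
  then obtain U' where x': "x' = Inr U'" and iso: "isomorphic C U' U" using assms(2) by (cases x') auto
  have U': "Low_u U'" using assms(3) x' by simp
  show ?thesis
  proof (cases y)
    case (Inl F)
    then show ?thesis using assms(1) Inr U' x' isomorphic_trans[OF iso] by auto
  next
    case [simp]: (Inr T)
    then obtain K k g where K: "Low_t T" "K \<in> W" "k \<in> Hom C K T" "g \<in> Hom C T U" "short_exact C k g"
      using assms(1) \<open>x = Inr U\<close> by auto
    obtain h where h: "h \<in> Hom C U U'" "isomorphism C h"
      using isomorphic_sym[OF iso] by (auto simp: isomorphic_def)
    have "short_exact C k (h \<cdot> g)" by (rule short_exact_iso_right[OF K(5,3,4) h])
    then show ?thesis using U' K(1-3) comp_closed[OF K(4) h(1)] unfolding x' Inr partner.simps by blast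
  qed
qed

lemma Up_reflection:
  assumes "matched (Inl V) y"
  obtains (mono) T P e c where "y = Inr T" "Low_t T" "P \<in> W" "e \<in> Hom C V P" "c \<in> Hom C P T"
      "short_exact C e c" "reflection C W V e P"
  | (epi) F X k q where "y = Inl F" "Up_t F" "X \<in> W" "k \<in> Hom C F V" "q \<in> Hom C V X"
      "short_exact C k q" "reflection C W V q X"
proof (cases y)
  case (Inr T)
  then obtain P e c where "Low_t T" "P \<in> W" "e \<in> Hom C V P" "c \<in> Hom C P T" "short_exact C e c"
    using assms by auto
  then show thesis using mono[OF Inr] reflection_with_Low_cokernel by blast
next
  case (Inl F)
  then obtain X k q where X: "Up_t F" "X \<in> W" "k \<in> Hom C F V" "q \<in> Hom C V X" "short_exact C k q"
    and V: "Up_u V"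
    using assms by auto
  have "V \<in> v" by (rule torsionfree_almost_torsionD(2)[OF V])
  then show thesis using epi[OF Inl X] reflection_with_Up_kernel[OF X(5,3,4,2) _ X(1)] by blast
qed

text \<open>
  An object of \<open>Up u\<close> is a non-zero object of \<open>v\<close>, so it is not isomorphic to an object of \<open>u\<close>.
\<close>

lemma no_iso_to_heart:
  assumes "Up_u V" "e \<in> Hom C V P" "P \<in> W" "monic C e" "epic C e"
  shows False
proof -
  note V = torsionfree_almost_torsionD[OF assms(1)]
  have "P \<in> u" using assms(3) by blast
  then have "V \<in> u"
    by (rule subcategoryD(3)[OF torsion_pairD(1)[OF tp_u] _ balanced[OF assms(4,5,2)] assms(2)])
  then show False using torsion_torsionfree_zero[OF tp_u _ V(2)] V(3) by blast
qed

text \<open>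
  An envelope is isomorphic to the reflection provided by a partner, which is monic or epic but
  not both; hence the type of the envelope tells to which side the partner belongs, and its
  cokernel or kernel is the partner.
\<close>

lemma envelope_of_Up:
  assumes y: "matched (Inl V) y" and e: "is_envelope C W V e"
  shows "monic C e \<or> epic C e"
    and "monic C e \<Longrightarrow> is_cokernel C e c \<Longrightarrow> \<exists>T. y = Inr T \<and> isomorphic C T (Tgt C c)"
    and "epic C e \<Longrightarrow> is_kernel C e k \<Longrightarrow> \<exists>F. y = Inl F \<and> isomorphic C F (Src C k)"
proof -
  have V: "Up_u V" using matched_bricks(1)[OF y] by simp
  have "(monic C e \<or> epic C e) \<and>
    (monic C e \<longrightarrow> is_cokernel C e c \<longrightarrow> (\<exists>T. y = Inr T \<and> isomorphic C T (Tgt C c))) \<and>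
    (epic C e \<longrightarrow> is_kernel C e k \<longrightarrow> (\<exists>F. y = Inl F \<and> isomorphic C F (Src C k)))"
    using y
  proof (cases rule: Up_reflection)
    case (mono T P e0 c0)
    note s = short_exactD[OF mono(6,4,5)]
    obtain h where h: "h \<in> Hom C P (Tgt C e)" "isomorphism C h" "h \<cdot> e0 = e" "e \<in> Hom C V (Tgt C e)"
      "Tgt C e \<in> W"
      by (rule envelope_of_reflective[OF mono(7) e])
    have me: "monic C e" using monic_comp[OF mono(4) h(1) s(3) isomorphism_monic[OF h(2,1)]] h(3) by simp
    have "isomorphic C T (Tgt C c)" if c: "is_cokernel C e c"
    proof -
      have ch: "c \<in> Hom C (Tgt C e) (Tgt C c)" by (rule cokernelD(1)[OF c h(4)])
      have "is_cokernel C e0 (c \<cdot> h)"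
        using cokernel_after_iso[OF mono(4) h(1,2) ch] c h(3) by simp
      then obtain g where "g \<in> Hom C (Tgt C c0) (Tgt C (c \<cdot> h))" "isomorphism C g"
        by (rule cokernel_unique[OF mono(4) s(2)])
      then show ?thesis using isomorphicI HomD(3)[OF mono(5)] HomD(3)[OF comp_closed[OF h(1) ch]] by simp
    qed
    moreover have "\<not> epic C e" using no_iso_to_heart[OF V h(4,5) me] by blast
    ultimately show ?thesis using me mono(1) by blast
  next
    case (epi F X k0 q0)
    note s = short_exactD[OF epi(6,4,5)]
    obtain h where h: "h \<in> Hom C X (Tgt C e)" "isomorphism C h" "h \<cdot> q0 = e" "e \<in> Hom C V (Tgt C e)"
      "Tgt C e \<in> W"
      by (rule envelope_of_reflective[OF epi(7) e])
    have ee: "epic C e" using epic_comp[OF epi(5) h(1) s(4) isomorphism_epic[OF h(2,1)]] h(3) by simp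
    have "isomorphic C F (Src C k)" if k: "is_kernel C e k"
    proof -
      have "is_kernel C q0 k"
        using kernel_before_monic[OF epi(5) h(1) isomorphism_monic[OF h(2,1)]] k h(3) by simp
      then obtain g where "g \<in> Hom C (Src C k0) (Src C k)" "isomorphism C g"
        using kernel_unique[OF epi(5) _ s(1)] by blast
      then show ?thesis using isomorphicI HomD(2)[OF epi(4)] by simp
    qed
    moreover have "\<not> monic C e" using no_iso_to_heart[OF V h(4,5) _ ee] by blast
    ultimately show ?thesis using ee epi(1) by blast
  qed
  then show "monic C e \<or> epic C e"
    and "monic C e \<Longrightarrow> is_cokernel C e c \<Longrightarrow> \<exists>T. y = Inr T \<and> isomorphic C T (Tgt C c)"
    and "epic C e \<Longrightarrow> is_kernel C e k \<Longrightarrow> \<exists>F. y = Inl F \<and> isomorphic C F (Src C k)" by blast+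
qed

lemma envelope_exists:
  assumes "Up_u V"
  shows "\<exists>e. is_envelope C W V e"
proof -
  obtain y where "matched (Inl V) y" using matched_exists[of "Inl V"] assms by auto
  then obtain r P where r: "reflection C W V r P" by (cases rule: Up_reflection) blast+
  show ?thesis using reflection_is_envelope[OF r HomD(5)[OF reflectionD(1)[OF r]]] by blast
qed

text \<open>
  For objects of \<open>Up u\<close> this is uniqueness of envelopes. An object \<open>U\<close> of \<open>Low u\<close> cannot have partners
  on both sides, since an extension of \<open>U \<in> W\<close> by an object of \<open>W\<close> is torsionfree for \<open>(t, f)\<close>.
\<close>

lemma matched_unique:
  assumes "matched x y" "matched x y'"
  shows "same_type y y'"
proof (cases x)
  case (Inl V)
  have y: "matched (Inl V) y" "matched (Inl V) y'" using assms Inl by simp_all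
  then show ?thesis
  proof (cases rule: Up_reflection[case_names mono epi])
    case (mono T P e c)
    note s = short_exactD[OF mono(6,4,5)]
    have "is_envelope C W V e" by (rule reflection_is_envelope[OF mono(7) HomD(5)[OF mono(4)]])
    then obtain T' where "y' = Inr T'" "isomorphic C T' (Tgt C c)"
      using envelope_of_Up(2)[OF y(2) _ s(3,2)] by blast
    then show ?thesis using mono(1) isomorphic_sym HomD(3)[OF mono(5)] by simp
  next
    case (epi F X k q)
    note s = short_exactD[OF epi(6,4,5)]
    have "is_envelope C W V q" by (rule reflection_is_envelope[OF epi(7) HomD(5)[OF epi(5)]])
    then obtain F' where "y' = Inl F'" "isomorphic C F' (Src C k)"
      using envelope_of_Up(3)[OF y(2) _ s(4,1)] by blast
    then show ?thesis using epi(1) isomorphic_sym HomD(2)[OF epi(4)] by simp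
  qed
next
  case (Inr U)
  have no: False if m: "matched (Inr U) (Inl F)" "matched (Inr U) (Inr T)" for F T
  proof -
    obtain h where h: "h \<in> Hom C U F" "isomorphism C h" using m(1) by (auto simp: isomorphic_def)
    have F: "Up_t F" and U: "Low_u U" and T: "Low_t T" using m by auto
    obtain K k x where K: "K \<in> W" "k \<in> Hom C K T" "x \<in> Hom C T U" "short_exact C k x"
      using m(2) by auto
    have "U \<in> f"
      by (rule subcategoryD(3)[OF torsion_pairD(2)[OF tp_t] torsionfree_almost_torsionD(2)[OF F] h(2,1)])
    then have "U \<in> W" using torsion_almost_torsionfreeD(2)[OF U] by blast
    then have "T \<in> W" by (rule heart_extension[OF K(4,2,3,1)])
    then show False
      using torsion_torsionfree_zero[OF tp_t] torsion_almost_torsionfreeD(2,3)[OF T] by blast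
  qed
  have y: "matched (Inr U) y" "matched (Inr U) y'" using assms Inr by blast+
  show ?thesis
  proof (cases y)
    case F: (Inl F)
    have "y' \<noteq> Inr T" for T
    proof
      assume T: "y' = Inr T"
      show False by (rule no[OF y(1)[unfolded F] y(2)[unfolded T]])
    qed
    then obtain F' where F': "y' = Inl F'" by (cases y') blast+
    have iso: "isomorphic C U F" "isomorphic C U F'" using y unfolding F F' by simp_all
    show ?thesis unfolding F F' using isomorphic_trans[OF isomorphic_sym[OF iso(1)] iso(2)] by simp
  next
    case T: (Inr T)
    have "y' \<noteq> Inl F" for F
    proof
      assume F: "y' = Inl F"
      show False by (rule no[OF y(2)[unfolded F] y(1)[unfolded T]])
    qed
    then obtain T' where T': "y' = Inr T'" by (cases y') blast+
    obtain K k x where K: "Low_t T" "K \<in> W" "k \<in> Hom C K T" "x \<in> Hom C T U" "short_exact C k x"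
      using y(1) T by auto
    obtain K' k' x' where K': "Low_t T'" "K' \<in> W" "k' \<in> Hom C K' T'" "x' \<in> Hom C T' U"
      "short_exact C k' x'"
      using y(2) T' by auto
    show ?thesis
      using Low_t_over_Low_u_unique[OF K(1) K'(1) K(5,3,4,2) K'(5,3,4,2)] unfolding T T' by simp
  qed
qed

lemma matched_same_type:
  assumes "matched x y" "matched x' y'" "same_type x x'"
  shows "same_type y y'"
  by (rule matched_unique[OF assms(1) matched_transport[OF assms(2,3) matched_bricks(1)[OF assms(1)]]])

lemma matched_exists_converse:
  assumes "brick_t y"
  shows "\<exists>x. matched x y"
proof -
  interpret op: generated_wide_interval "opposite C" len v u f t by (rule dual)
  have "op.brick_u (swap y)" using assms by (cases y) simp_all
  then obtain z where "op.matched (swap y) z" using op.matched_exists by blast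
  then have "matched (swap z) y" using matched_dual[of y "swap z"] by simp
  then show ?thesis ..
qed

lemma matched_same_type_converse:
  assumes "matched x y" "matched x' y'" "same_type y y'"
  shows "same_type x x'"
proof -
  interpret op: generated_wide_interval "opposite C" len v u f t by (rule dual)
  have iso: "isomorphic (opposite C) = isomorphic C"
    by (intro ext isomorphic_opposite) unfold_locales
  have "op.same_type (swap x) (swap x')"
    by (rule op.matched_same_type[of "swap y" _ "swap y'"])
      (use assms matched_dual same_type_swap iso in simp_all)
  then show ?thesis using same_type_swap iso by simp
qed

end

section \<open>The bijection\<close>

lemma bijection_of_matching:
  assumes left: "\<And>x. P x \<Longrightarrow> \<exists>y. R x y" and right: "\<And>y. Q y \<Longrightarrow> \<exists>x. R x y"
    and dom: "\<And>x y. R x y \<Longrightarrow> P x \<and> Q y"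
    and cls: "\<And>x y x' y'. R x y \<Longrightarrow> R x' y' \<Longrightarrow> c x = c x' \<longleftrightarrow> d y = d y'"
  shows "\<exists>\<Phi>. bij_betw \<Phi> (c ` Collect P) (d ` Collect Q) \<and> (\<forall>x y. R x y \<longrightarrow> \<Phi> (c x) = d y)"
proof -
  define \<Phi> where "\<Phi> a = d (SOME y. \<exists>x. c x = a \<and> R x y)" for a
  have \<Phi>: "\<Phi> (c x) = d y" if R: "R x y" for x y
  proof -
    have "\<exists>y' x'. c x' = c x \<and> R x' y'" using R by blast
    then obtain x' where "c x' = c x" "R x' (SOME y. \<exists>x'. c x' = c x \<and> R x' y)"
      using someI_ex[of "\<lambda>y. \<exists>x'. c x' = c x \<and> R x' y"] by blast
    then show ?thesis using cls[OF _ R] unfolding \<Phi>_def by blast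
  qed
  have "inj_on \<Phi> (c ` Collect P)"
  proof (rule inj_onI)
    fix a b assume ab: "a \<in> c ` Collect P" "b \<in> c ` Collect P" "\<Phi> a = \<Phi> b"
    then obtain x x' where x: "a = c x" "P x" "b = c x'" "P x'" by blast
    obtain y y' where y: "R x y" "R x' y'" using left x by blast
    then show "a = b" using cls[OF y] \<Phi>[OF y(1)] \<Phi>[OF y(2)] ab(3) x by simp
  qed
  moreover have "\<Phi> ` c ` Collect P = d ` Collect Q"
  proof (intro equalityI subsetI)
    fix b assume "b \<in> \<Phi> ` c ` Collect P"
    then obtain x where x: "P x" "b = \<Phi> (c x)" by blast
    then obtain y where y: "R x y" using left by blast
    then show "b \<in> d ` Collect Q" using x(2) \<Phi>[OF y] dom[OF y] by simp
  next
    fix b assume "b \<in> d ` Collect Q"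
    then obtain y where y: "Q y" "b = d y" by blast
    then obtain x where x: "R x y" using right by blast
    then have "b = \<Phi> (c x)" "P x" using y(2) \<Phi>[OF x] dom[OF x] by simp_all
    then show "b \<in> \<Phi> ` c ` Collect P" by blast
  qed
  ultimately show ?thesis using \<Phi> unfolding bij_betw_def by blast
qed

lemma map_sum_Up_Low:
  "map_sum (iso_class C) (iso_class C) `
     Collect (case_sum (torsionfree_almost_torsion C t f) (torsion_almost_torsionfree C t f)) =
   Up C t f <+> Low C t f" (is "?c ` Collect ?b = _")
proof (intro equalityI subsetI)
  fix a assume "a \<in> ?c ` Collect ?b"
  then obtain x where "?b x" "a = ?c x" by blast
  then show "a \<in> Up C t f <+> Low C t f"
    by (cases x) (auto simp: Up_def Low_def)
next
  fix a assume "a \<in> Up C t f <+> Low C t f"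
  then consider B where "a = ?c (Inl B)" "?b (Inl B)" | B where "a = ?c (Inr B)" "?b (Inr B)"
    by (auto simp: Up_def Low_def)
  then show "a \<in> ?c ` Collect ?b" by cases blast+
qed

lemma widely_generated_opposite:
  assumes "abelian_category C" "widely_cogenerated C u v"
  shows "widely_generated (opposite C) v u"
proof -
  interpret abelian_category C by fact
  show ?thesis
    using assms(2) unfolding widely_generated_def widely_cogenerated_def torsion_class_def
      torsionfree_class_def torsion_pair_opposite wide_opposite .
qed

lemma generated_wide_intervalI:
  assumes "abelian_category_with_length C len" "wide_interval C t f u v"
    and "widely_generated C t f" "widely_cogenerated C u v"
  shows "generated_wide_interval C len t f u v"
proof -
  interpret abelian_category_with_length C len by fact
  interpret op: abelian_category_with_length "opposite C" len by (rule with_length_op)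
  have w: "torsion_pair C t f" "torsion_pair C u v" "t \<subset> u" "wide C (u \<inter> f)"
    using assms(2) by (auto simp: wide_interval_def)
  show ?thesis
  proof
    fix X assume "X \<in> t" "\<not> zero_object C X"
    then show "\<exists>T h. torsion_almost_torsionfree C t f T \<and> h \<in> Hom C T X \<and> h \<noteq> Zero C T X"
      using generating_torsion_almost_torsionfree[OF assms(3)] by blast
  next
    fix X assume X: "X \<in> v" "\<not> zero_object C X"
    obtain V h where "torsion_almost_torsionfree (opposite C) v u V" "h \<in> Hom (opposite C) V X"
      "h \<noteq> Zero (opposite C) V X"
      by (rule op.generating_torsion_almost_torsionfree[OF widely_generated_opposite[OF abelian_category_axioms assms(4)] X(1)])
        (use X(2) in simp)
    then show "\<exists>V h. torsionfree_almost_torsion C u v V \<and> h \<in> Hom C X V \<and> h \<noteq> Zero C X V"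
      by auto
  qed (use w in auto)
qed

theorem theorem3p9:
  fixes C :: "('o, 'm, 'x) preadditive_scheme"
    and t f u v W :: "'o set"
  assumes "abelian_length_category C"
    and "torsion_pair C t f"
    and "torsion_pair C u v"
    and "wide_interval C t f u v"
    and "W = u \<inter> f"
    and "widely_generated C t f"
    and "widely_cogenerated C u v"
  shows "\<exists>\<Phi> :: 'o set + 'o set \<Rightarrow> 'o set + 'o set.
    bij_betw \<Phi> (Up C u v <+> Low C u v) (Up C t f <+> Low C t f) \<and>
    (\<forall>V. torsionfree_almost_torsion C u v V \<longrightarrow>
       (\<exists>e. is_envelope C W V e) \<and>
       (\<forall>e. is_envelope C W V e \<longrightarrow>
          (monic C e \<or> epic C e) \<and>
          (monic C e \<longrightarrow> (\<forall>c. is_cokernel C e c \<longrightarrow>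
             underlying_class (\<Phi> (Inl (iso_class C V))) = iso_class C (Tgt C c))) \<and>
          (epic C e \<longrightarrow> (\<forall>k. is_kernel C e k \<longrightarrow>
             underlying_class (\<Phi> (Inl (iso_class C V))) = iso_class C (Src C k))))) \<and>
    (\<forall>U. torsion_almost_torsionfree C u v U \<longrightarrow>
       (U \<in> W \<longrightarrow> underlying_class (\<Phi> (Inr (iso_class C U))) = iso_class C U) \<and>
       (U \<notin> W \<longrightarrow>
          (\<exists>T. torsion_almost_torsionfree C t f T \<and> Hom C T U \<noteq> {Zero C T U} \<and>
             (\<forall>T'. torsion_almost_torsionfree C t f T' \<and> Hom C T' U \<noteq> {Zero C T' U} \<longrightarrow>
                isomorphic C T' T) \<and>
             underlying_class (\<Phi> (Inr (iso_class C U))) = iso_class C T)))"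
proof -
  interpret abelian_length_category C by fact
  obtain len where "abelian_category_with_length C len" using length_exists by blast
  then interpret generated_wide_interval C len t f u v
    by (rule generated_wide_intervalI[OF _ assms(4,6,7)])
  let ?cls = "map_sum (iso_class C) (iso_class C)"
  have brick_obj: "B \<in> Obj C" if "Up_u B \<or> Low_u B \<or> Up_t B \<or> Low_t B" for B
    using that torsionfree_almost_torsionD(2) torsion_almost_torsionfreeD(2)
      torsion_in_Obj[OF tp_t] torsion_in_Obj[OF tp_u] torsionfree_in_Obj[OF tp_t]
      torsionfree_in_Obj[OF tp_u] by blast
  have cls_u: "?cls x = ?cls x' \<longleftrightarrow> same_type x x'" if "brick_u x" "brick_u x'" for x x'
    using that brick_obj by (cases x; cases x') (simp_all add: iso_class_eq_iff)
  have cls_t: "?cls y = ?cls y' \<longleftrightarrow> same_type y y'" if "brick_t y" "brick_t y'" for y y'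
    using that brick_obj by (cases y; cases y') (simp_all add: iso_class_eq_iff)
  have "\<exists>\<Phi>. bij_betw \<Phi> (?cls ` Collect brick_u) (?cls ` Collect brick_t) \<and>
      (\<forall>x y. matched x y \<longrightarrow> \<Phi> (?cls x) = ?cls y)"
  proof (rule bijection_of_matching[OF matched_exists matched_exists_converse])
    show "brick_u x \<and> brick_t y" if "matched x y" for x y using matched_bricks[OF that] by blast
    show "?cls x = ?cls x' \<longleftrightarrow> ?cls y = ?cls y'" if m: "matched x y" "matched x' y'" for x y x' y'
      using cls_u[OF matched_bricks(1)[OF m(1)] matched_bricks(1)[OF m(2)]]
        cls_t[OF matched_bricks(2)[OF m(1)] matched_bricks(2)[OF m(2)]]
        matched_same_type[OF m] matched_same_type_converse[OF m] by blast
  qed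
  then obtain \<Phi> where bij: "bij_betw \<Phi> (Up C u v <+> Low C u v) (Up C t f <+> Low C t f)"
    and \<Phi>: "\<And>x y. matched x y \<Longrightarrow> \<Phi> (?cls x) = ?cls y"
    unfolding map_sum_Up_Low by blast
  have und: "underlying_class (\<Phi> (Inl (iso_class C V))) = iso_class C B"
    if "matched (Inl V) y" "y = Inl B \<or> y = Inr B" for V B y
    using \<Phi>[OF that(1)] that(2) by (auto simp: underlying_class_def)
  have und': "underlying_class (\<Phi> (Inr (iso_class C U))) = iso_class C B"
    if "matched (Inr U) y" "y = Inl B \<or> y = Inr B" for U B y
    using \<Phi>[OF that(1)] that(2) by (auto simp: underlying_class_def)
  have eq: "iso_class C X = iso_class C Y" if "isomorphic C X Y" for X Y
    using that iso_class_eq_iff[of X Y] HomD(4,5) by (auto simp: isomorphic_def)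
  have up: "(\<exists>e. is_envelope C W V e) \<and>
       (\<forall>e. is_envelope C W V e \<longrightarrow>
          (monic C e \<or> epic C e) \<and>
          (monic C e \<longrightarrow> (\<forall>c. is_cokernel C e c \<longrightarrow>
             underlying_class (\<Phi> (Inl (iso_class C V))) = iso_class C (Tgt C c))) \<and>
          (epic C e \<longrightarrow> (\<forall>k. is_kernel C e k \<longrightarrow>
             underlying_class (\<Phi> (Inl (iso_class C V))) = iso_class C (Src C k))))"
    if V: "Up_u V" for V
  proof -
    obtain y where y: "matched (Inl V) y" using matched_exists[of "Inl V"] V by auto
    have "underlying_class (\<Phi> (Inl (iso_class C V))) = iso_class C (Tgt C c)"
      if e: "is_envelope C W V e" "monic C e" "is_cokernel C e c" for e c
    proof -
      obtain T where "y = Inr T" "isomorphic C T (Tgt C c)"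
        using envelope_of_Up(2)[OF y _ e(2,3)] e(1) assms(5) by blast
      then show ?thesis using und[OF y] eq by simp
    qed
    moreover have "underlying_class (\<Phi> (Inl (iso_class C V))) = iso_class C (Src C k)"
      if e: "is_envelope C W V e" "epic C e" "is_kernel C e k" for e k
    proof -
      obtain F where "y = Inl F" "isomorphic C F (Src C k)"
        using envelope_of_Up(3)[OF y _ e(2,3)] e(1) assms(5) by blast
      then show ?thesis using und[OF y] eq by simp
    qed
    ultimately show ?thesis
      using envelope_exists[OF V] envelope_of_Up(1)[OF y] unfolding assms(5) by blast
  qed
  have low_in: "underlying_class (\<Phi> (Inr (iso_class C U))) = iso_class C U"
    if U: "Low_u U" "U \<in> W" for U
  proof -
    have "U \<in> f" using U(2) assms(5) by blast
    then have "matched (Inr U) (Inl U)"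
      using U(1) Low_in_heart[OF U(1)] isomorphic_refl[OF torsionfree_in_Obj[OF tp_t]] by simp
    then show ?thesis using und' by blast
  qed
  have low_out: "\<exists>T. Low_t T \<and> Hom C T U \<noteq> {Zero C T U} \<and>
      (\<forall>T'. Low_t T' \<and> Hom C T' U \<noteq> {Zero C T' U} \<longrightarrow> isomorphic C T' T) \<and>
      underlying_class (\<Phi> (Inr (iso_class C U))) = iso_class C T"
    if U: "Low_u U" "U \<notin> W" for U
  proof -
    have Uo: "U \<in> Obj C" using brick_obj U(1) by blast
    have Uf: "U \<notin> f" using U assms(5) torsion_almost_torsionfreeD(2) by blast
    have m: "matched (Inr U) (Inr T)" if T: "Low_t T" "Hom C T U \<noteq> {Zero C T U}" for T
    proof -
      have "Zero C T U \<in> Hom C T U" by (rule zero_closed[OF _ Uo]) (use brick_obj T(1) in blast)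
      then obtain x where x: "x \<in> Hom C T U" "x \<noteq> Zero C T U" using T(2) by blast
      obtain k K where "K \<in> u \<inter> f" "k \<in> Hom C K T" "short_exact C k x"
        by (rule map_Low_t_to_Low_u[OF U(1) T(1) x])
      then show ?thesis using U(1) T(1) x(1) unfolding partner.simps by blast
    qed
    obtain T h where T: "Low_t T" "h \<in> Hom C T U" "h \<noteq> Zero C T U"
      using generating[OF Low_outside_heart[OF U(1) Uf] torsion_almost_torsionfreeD(3)[OF U(1)]] by blast
    have ne: "Hom C T U \<noteq> {Zero C T U}" using T(2,3) by blast
    have "isomorphic C T' T" if "Low_t T'" "Hom C T' U \<noteq> {Zero C T' U}" for T'
      using matched_unique[OF m[OF that] m[OF T(1) ne]] by simp
    moreover have "underlying_class (\<Phi> (Inr (iso_class C U))) = iso_class C T"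
      using und'[OF m[OF T(1) ne]] by blast
    ultimately show ?thesis using T(1) ne by blast
  qed
  show ?thesis
    by (intro exI[of _ \<Phi>] conjI bij allI impI) (use up low_in low_out in blast)+
qed

end
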